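(* Let $p\in(0,1)$, let $\{X_k\}_{k\ge1}$ be the $\{+1,-1\}$-valued Markov chain with parameter $p$ defined in the context, let $\{a_k\}_{k\ge1}$ be a deterministic real sequence, and let $S_n:=\sum_{k=1}^n a_kX_k$, $s_n:=E[(S_n)^2]^{1/2}$, $A_n:=\sum_{k=1}^n a_k^2$. Suppose that $A_n\to\infty$ as $n\to\infty$ and that $a_n^2=O(A_n^{1-\delta})$ as $n\to\infty$ for some $\delta\in(0,1]$. Then: (i) (CLT) For every $y\in\mathbb{R}$, $$\lim_{n\to\infty}P\left(\frac{S_n}{s_n}\le y\right)=\int_{-\infty}^y\frac{1}{\sqrt{2\pi}}e^{-t^2/2}\,dt.$$ (ii) (the compact LIL) With probability one, the set of limit points (as $n\to\infty$) of $$\frac{S_n}{\sqrt{2s_n^2\log\log s_n^2}}$$ coincides with the closed interval $[-1,1]$. (iii) (the other LIL) $$\liminf_{n\to\infty}\sqrt{\frac{\log\log s_n^2}{s_n^2}}\ \max_{1\le k\le n}|S_k|=\frac{\pi}{\sqrt8}\quad P\text{-a.s.}$$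
   Context: For $p\in(0,1)$, $\{X_k\}_{k\ge1}$ is the $\{+1,-1\}$-valued Markov chain with $P(X_1=+1)=P(X_1=-1)=\tfrac12$ and, for $k\ge1$, $P(X_{k+1}=+1\mid X_k=+1)=P(X_{k+1}=-1\mid X_k=-1)=p$ and $P(X_{k+1}=-1\mid X_k=+1)=P(X_{k+1}=+1\mid X_k=-1)=1-p$. *)

theory Defs
  imports "HOL-Probability.Probability" "HOL-Library.Landau_Symbols"
begin

text \<open>Time starts at 1; the value \<open>X 0\<close> is unconstrained and never used.  The last assumption
  is the Markov property; its guard avoids conditioning on null histories, for which
  \<^const>\<open>cond_prob\<close> would be the arbitrary value 0.\<close>

locale pm_markov_chain = prob_space M
  for M :: "'a measure" and X :: "nat \<Rightarrow> 'a \<Rightarrow> real" and p :: real +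
  assumes rv: "\<And>k. 1 \<le> k \<Longrightarrow> X k \<in> borel_measurable M"
    and values_pm: "\<And>k \<omega>. 1 \<le> k \<Longrightarrow> \<omega> \<in> space M \<Longrightarrow> X k \<omega> \<in> {1, -1}"
    and init_pos: "\<P>(\<omega> in M. X 1 \<omega> = 1) = 1 / 2"
    and init_neg: "\<P>(\<omega> in M. X 1 \<omega> = -1) = 1 / 2"
    and trans_pos_pos: "\<And>k. 1 \<le> k \<Longrightarrow> \<P>(\<omega> in M. X (k + 1) \<omega> = 1 \<bar> X k \<omega> = 1) = p"
    and trans_neg_neg: "\<And>k. 1 \<le> k \<Longrightarrow> \<P>(\<omega> in M. X (k + 1) \<omega> = -1 \<bar> X k \<omega> = -1) = p"
    and trans_pos_neg: "\<And>k. 1 \<le> k \<Longrightarrow> \<P>(\<omega> in M. X (k + 1) \<omega> = -1 \<bar> X k \<omega> = 1) = 1 - p"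
    and trans_neg_pos: "\<And>k. 1 \<le> k \<Longrightarrow> \<P>(\<omega> in M. X (k + 1) \<omega> = 1 \<bar> X k \<omega> = -1) = 1 - p"
    and markov: "\<And>k x y. 1 \<le> k \<Longrightarrow> \<P>(\<omega> in M. \<forall>j\<in>{1..k}. X j \<omega> = x j) > 0 \<Longrightarrow>
      \<P>(\<omega> in M. X (k + 1) \<omega> = y \<bar> \<forall>j\<in>{1..k}. X j \<omega> = x j) =
      \<P>(\<omega> in M. X (k + 1) \<omega> = y \<bar> X k \<omega> = x k)"

definition wsum :: "(nat \<Rightarrow> real) \<Rightarrow> (nat \<Rightarrow> 'a \<Rightarrow> real) \<Rightarrow> nat \<Rightarrow> 'a \<Rightarrow> real" where
  "wsum a X n \<omega> = (\<Sum>k=1..n. a k * X k \<omega>)"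

definition wsd :: "'a measure \<Rightarrow> (nat \<Rightarrow> real) \<Rightarrow> (nat \<Rightarrow> 'a \<Rightarrow> real) \<Rightarrow> nat \<Rightarrow> real" where
  "wsd M a X n = sqrt (integral\<^sup>L M (\<lambda>\<omega>. (wsum a X n \<omega>)\<^sup>2))"

definition sqsum :: "(nat \<Rightarrow> real) \<Rightarrow> nat \<Rightarrow> real" where
  "sqsum a n = (\<Sum>k=1..n. (a k)\<^sup>2)"

text \<open>Limit points of a sequence are its subsequential limits, not the accumulation points
  of its range.\<close>

definition seq_limit_points :: "(nat \<Rightarrow> real) \<Rightarrow> real set" where
  "seq_limit_points u = {l. \<exists>r. strict_mono r \<and> (u \<circ> r) \<longlonglongrightarrow> l}"

end

theory Submission
  imports Defs "HOL-Real_Asymp.Real_Asymp"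
begin

text \<open>Put \<open>r = 2 * p - 1\<close> and \<open>b n = (\<Sum>i. a (n + i) * r ^ i)\<close>. Then \<open>S n\<close> differs by
  \<open>r * b (Suc n) * X n\<close> from the martingale \<open>W n = (\<Sum>k\<le>n. b k * (X k - r * X (k - 1)))\<close>,
  whose conditional variances are deterministic because \<open>X k\<^sup>2 = 1\<close>, and whose differences are
  bounded by a power less than \<open>1 / 2\<close> of the accumulated variance \<open>V\<close>. For such martingales no
  embedding into Brownian motion is needed. The central limit theorem follows from telescoping the
  characteristic function. The law of the iterated logarithm follows from the two-sided estimate
  \<open>exp (l\<^sup>2 * V / 2)\<close> of the exponential moments, the lower tail being obtained by exponential tilting.
  The other law follows from small-ball probabilities estimated with the eigenfunction
  \<open>cos (t * W n)\<close>. All lower bounds hold conditionally on the past with deterministic constants,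
  so that a conditional second Borel-Cantelli argument along super-exponentially growing variance
  levels applies.\<close>

section \<open>Bounded measurable functions and martingale differences\<close>

text \<open>Given the past, \<open>X (n + i)\<close> has conditional mean
  \<open>r ^ i * X n\<close>, so \<open>r * b (Suc n) * X n\<close> is the conditional mean of all
  later summands, and \<open>W n\<close> is formally the conditional mean of the whole series. One
  smallness condition serves all three laws: jumps and correction must be negligible on the finest
  scale in play, sqrt (V / ln (ln V)). The exponent \<open>1 - \<delta>\<close> of the hypothesis
  provides this. The constant pi / sqrt 8 comes from the cosine: staying in [-L, L] up to variance V
  has probability of order exp (- t^2 V / 2) with t = pi / (2 L), and this is 1 / ln V exactly for L
  = (pi / sqrt 8) sqrt (V / ln (ln V)). Bounds that hold eventually need summable probabilities;
  geometric levels are dense enough to interpolate between. Bounds attained infinitely often need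
  the past of a block to be negligible at its end, even when the past is only known on the scale of
  the iterated logarithm law and is set against the smaller scale of the other law. Levels k^k
  achieve this, and ln (ln (k^k)) = ln k + ln (ln k) still keeps the block probabilities
  nonsummable.\<close>

definition bdd_meas :: "'a measure \<Rightarrow> ('a \<Rightarrow> real) \<Rightarrow> bool" where
  "bdd_meas N Z \<longleftrightarrow> Z \<in> borel_measurable N \<and> (\<exists>B. \<forall>\<omega>\<in>space N. \<bar>Z \<omega>\<bar> \<le> B)"

lemma bdd_measI: "Z \<in> borel_measurable N \<Longrightarrow> (\<And>\<omega>. \<omega> \<in> space N \<Longrightarrow> \<bar>Z \<omega>\<bar> \<le> B) \<Longrightarrow> bdd_meas N Z"
  unfolding bdd_meas_def by blast

lemma bdd_meas_measurable: "bdd_meas N Z \<Longrightarrow> Z \<in> borel_measurable N"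
  unfolding bdd_meas_def by blast

lemma bdd_meas_const: "bdd_meas N (\<lambda>_. c)"
  by (rule bdd_measI[where B = "\<bar>c\<bar>"]) auto

lemma bdd_meas_add:
  assumes "bdd_meas N Y" "bdd_meas N Z"
  shows "bdd_meas N (\<lambda>\<omega>. Y \<omega> + Z \<omega>)"
proof -
  obtain B C where "\<And>\<omega>. \<omega> \<in> space N \<Longrightarrow> \<bar>Y \<omega>\<bar> \<le> B" "\<And>\<omega>. \<omega> \<in> space N \<Longrightarrow> \<bar>Z \<omega>\<bar> \<le> C"
    using assms unfolding bdd_meas_def by blast
  then show ?thesis
    using assms unfolding bdd_meas_def
    by (intro conjI exI[of _ "B + C"] ballI) (auto intro: order_trans[OF abs_triangle_ineq] add_mono)
qed

lemma bdd_meas_mult: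
  assumes "bdd_meas N Y" "bdd_meas N Z"
  shows "bdd_meas N (\<lambda>\<omega>. Y \<omega> * Z \<omega>)"
proof -
  obtain B C where B: "\<And>\<omega>. \<omega> \<in> space N \<Longrightarrow> \<bar>Y \<omega>\<bar> \<le> B" and C: "\<And>\<omega>. \<omega> \<in> space N \<Longrightarrow> \<bar>Z \<omega>\<bar> \<le> C"
    using assms unfolding bdd_meas_def by blast
  have "\<bar>Y \<omega> * Z \<omega>\<bar> \<le> \<bar>B\<bar> * \<bar>C\<bar>" if "\<omega> \<in> space N" for \<omega>
    unfolding abs_mult using B[OF that] C[OF that] by (intro mult_mono) auto
  then show ?thesis
    using assms unfolding bdd_meas_def by (intro conjI exI[of _ "\<bar>B\<bar> * \<bar>C\<bar>"]) auto
qed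

lemma bdd_meas_minus: "bdd_meas N Z \<Longrightarrow> bdd_meas N (\<lambda>\<omega>. - Z \<omega>)"
  using bdd_meas_mult[OF bdd_meas_const[of N "-1"], of Z] by simp

lemma bdd_meas_diff: "bdd_meas N Y \<Longrightarrow> bdd_meas N Z \<Longrightarrow> bdd_meas N (\<lambda>\<omega>. Y \<omega> - Z \<omega>)"
  using bdd_meas_add[OF _ bdd_meas_minus, of N Y Z] by simp

lemma bdd_meas_power: "bdd_meas N Z \<Longrightarrow> bdd_meas N (\<lambda>\<omega>. Z \<omega> ^ n)"
  by (induction n) (auto intro: bdd_meas_const bdd_meas_mult)

lemma bdd_meas_sum: "(\<And>i. i \<in> I \<Longrightarrow> bdd_meas N (Z i)) \<Longrightarrow> bdd_meas N (\<lambda>\<omega>. \<Sum>i\<in>I. Z i \<omega>)"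
  by (induction I rule: infinite_finite_induct) (auto intro: bdd_meas_const bdd_meas_add)

lemma bdd_meas_cos: "bdd_meas N Z \<Longrightarrow> bdd_meas N (\<lambda>\<omega>. cos (Z \<omega>))"
  by (rule bdd_measI[where B = 1]) (auto dest: bdd_meas_measurable)

lemma bdd_meas_sin: "bdd_meas N Z \<Longrightarrow> bdd_meas N (\<lambda>\<omega>. sin (Z \<omega>))"
  by (rule bdd_measI[where B = 1]) (auto dest: bdd_meas_measurable)

lemma bdd_meas_exp:
  assumes "bdd_meas N Z"
  shows "bdd_meas N (\<lambda>\<omega>. exp (Z \<omega>))"
proof -
  obtain B where "\<And>\<omega>. \<omega> \<in> space N \<Longrightarrow> \<bar>Z \<omega>\<bar> \<le> B" "Z \<in> borel_measurable N"
    using assms unfolding bdd_meas_def by blast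
  then show ?thesis
    by (intro bdd_measI[where B = "exp B"]) (auto dest: abs_le_D1)
qed

lemma bdd_meas_indicator: "A \<in> sets N \<Longrightarrow> bdd_meas N (indicator A)"
  by (rule bdd_measI[where B = 1]) (auto simp: indicator_def)

text \<open>This is why a bound at every sample point is demanded: the class is closed under
  products, powers, exponentials and cosines, so integrability obligations reduce to closure
  rules.\<close>

lemma (in finite_measure) bdd_meas_integrable: "bdd_meas M Z \<Longrightarrow> integrable M Z"
  unfolding bdd_meas_def by (elim conjE exE, rule integrable_const_bound) auto

lemmas bdd_meas_intros = bdd_meas_const bdd_meas_add bdd_meas_mult bdd_meas_minus bdd_meas_diff
  bdd_meas_power bdd_meas_sum bdd_meas_cos bdd_meas_sin bdd_meas_exp bdd_meas_indicator

section \<open>Taylor estimates with explicit remainders\<close>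

lemma cos_taylor2: "\<bar>cos (x + y) - (cos x - y * sin x - y\<^sup>2 / 2 * cos x)\<bar> \<le> \<bar>y\<bar> ^ 3 / (6::real)"
proof -
  let ?z = "iexp y - (\<Sum>k\<le>2. (\<i> * y) ^ k / fact k)"
  \<comment> \<open>The cosine remainder is the real part of the exponential remainder rotated by
    \<open>x\<close>; rotation keeps the modulus, so the bound does not depend on
    \<open>x\<close>.\<close>
  have "\<bar>Re (iexp x * ?z)\<bar> \<le> cmod (iexp x * ?z)" by (rule abs_Re_le_cmod)
  also have "\<dots> = cmod ?z" by (simp add: norm_mult)
  also have "\<dots> \<le> \<bar>y\<bar> ^ 3 / 6" using iexp_approx1[of y 2] by (simp add: eval_nat_numeral)
  also have "Re (iexp x * ?z) = cos (x + y) - (cos x - y * sin x - y\<^sup>2 / 2 * cos x)"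
    by (simp add: eval_nat_numeral algebra_simps cos_add flip: cis_conv_exp)
  finally show ?thesis .
qed

text \<open>The cubic remainder is absorbed into the quadratic coefficient: its factor is at most 3
  / 6, so it costs at most \<open>e * x\<^sup>2 / 2\<close>. The bound thus stays quadratic, and a
  quadratic in \<open>D k\<close> can be integrated exactly.\<close>

lemma exp_taylor2_bounds:
  fixes x e :: real
  assumes "\<bar>x\<bar> \<le> e" "e \<le> 1"
  shows "exp x \<le> 1 + x + (1 + e) * x\<^sup>2 / 2" and "1 + x + (1 - e) * x\<^sup>2 / 2 \<le> exp x"
proof -
  obtain t where t: "\<bar>t\<bar> \<le> \<bar>x\<bar>" "exp x = (\<Sum>m<3. x ^ m / fact m) + exp t / fact 3 * x ^ 3"
    using Maclaurin_exp_le by blast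
  have "exp t \<le> 3"
    using exp_le t assms by (intro order_trans[OF _ exp_le]) auto
  then have "\<bar>exp t / fact 3 * x ^ 3\<bar> \<le> 1 / 2 * (\<bar>x\<bar> * x\<^sup>2)"
    unfolding abs_mult by (intro mult_mono) (auto simp: eval_nat_numeral abs_mult)
  also have "\<dots> \<le> 1 / 2 * (e * x\<^sup>2)" using assms by (intro mult_left_mono mult_right_mono) auto
  finally have "\<bar>exp t / fact 3 * x ^ 3\<bar> \<le> e * x\<^sup>2 / 2" by simp
  moreover have "exp x = 1 + x + x\<^sup>2 / 2 + exp t / fact 3 * x ^ 3"
    unfolding t(2) by (simp add: eval_nat_numeral)
  moreover have "(1 + e) * x\<^sup>2 / 2 = x\<^sup>2 / 2 + e * x\<^sup>2 / 2" "(1 - e) * x\<^sup>2 / 2 = x\<^sup>2 / 2 - e * x\<^sup>2 / 2"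
    by (simp_all add: field_simps)
  ultimately show "exp x \<le> 1 + x + (1 + e) * x\<^sup>2 / 2" "1 + x + (1 - e) * x\<^sup>2 / 2 \<le> exp x"
    unfolding abs_le_iff by simp_all
qed

text \<open>The conditional variance of the \<open>k\<close>-th difference given \<open>F k\<close> is the deterministic number
  \<open>v k\<close>; the two conditional expectations are tested against bounded \<open>F k\<close>-measurable functions.\<close>

locale det_var_mds = prob_space M for M :: "'a measure" +
  fixes F :: "nat \<Rightarrow> 'a measure" and D :: "nat \<Rightarrow> 'a \<Rightarrow> real" and v :: "nat \<Rightarrow> real"
  assumes subalg: "subalgebra M (F k)"
    and F_Suc: "sets (F k) \<subseteq> sets (F (Suc k))"
    and D_bdd: "bdd_meas (F (Suc k)) (D k)"
    and orth: "bdd_meas (F k) Z \<Longrightarrow> expectation (\<lambda>\<omega>. Z \<omega> * D k \<omega>) = 0"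
    and cvar: "bdd_meas (F k) Z \<Longrightarrow> expectation (\<lambda>\<omega>. Z \<omega> * (D k \<omega>)\<^sup>2) = v k * expectation Z"
begin

text \<open>Both sums stop before \<open>n\<close>: the difference \<open>D k\<close> is only known
  at time \<open>Suc k\<close>, so \<open>W n\<close> is \<open>F n\<close>-measurable.\<close>

definition W :: "nat \<Rightarrow> 'a \<Rightarrow> real" where "W n \<omega> = (\<Sum>k<n. D k \<omega>)"
definition V :: "nat \<Rightarrow> real" where "V n = (\<Sum>k<n. v k)"

lemma W_0 [simp]: "W 0 \<omega> = 0" and W_Suc: "W (Suc n) \<omega> = W n \<omega> + D n \<omega>"
  and V_0 [simp]: "V 0 = 0" and V_Suc: "V (Suc n) = V n + v n"
  by (simp_all add: W_def V_def)

lemma space_F [simp]: "space (F k) = space M"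
  using subalg by (auto simp: subalgebra_def)

lemma sets_F_mono: "j \<le> k \<Longrightarrow> sets (F j) \<subseteq> sets (F k)"
  by (rule lift_Suc_mono_le[of "\<lambda>k. sets (F k)"]) (use F_Suc in auto)

lemma sets_F: "A \<in> sets (F k) \<Longrightarrow> A \<in> events"
  using subalg by (auto simp: subalgebra_def)

lemma bdd_meas_F_mono:
  assumes "bdd_meas (F j) Z" "j \<le> k"
  shows "bdd_meas (F k) Z"
proof -
  have "subalgebra (F k) (F j)" using sets_F_mono[OF assms(2)] by (auto simp: subalgebra_def)
  then show ?thesis using assms(1) unfolding bdd_meas_def by (auto intro: measurable_from_subalg)
qed

lemma bdd_meas_F: "bdd_meas (F j) Z \<Longrightarrow> bdd_meas M Z"
  using subalg unfolding bdd_meas_def by (auto intro: measurable_from_subalg)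

lemma bdd_meas_D: "k < n \<Longrightarrow> bdd_meas (F n) (D k)"
  using D_bdd bdd_meas_F_mono by (metis Suc_leI)

lemma bdd_meas_W: "k \<le> n \<Longrightarrow> bdd_meas (F n) (W k)"
  unfolding W_def by (intro bdd_meas_sum bdd_meas_D) auto

lemma bdd_meas_D_M: "bdd_meas M (D k)" and bdd_meas_W_M: "bdd_meas M (W k)"
  using bdd_meas_D bdd_meas_W bdd_meas_F by blast+

lemma D_measurable [measurable]: "D k \<in> borel_measurable M"
  and W_measurable [measurable]: "W k \<in> borel_measurable M"
  using bdd_meas_D_M bdd_meas_W_M bdd_meas_measurable by blast+

lemma W_measurable_F: "k \<le> n \<Longrightarrow> W k \<in> borel_measurable (F n)"
  using bdd_meas_W bdd_meas_measurable by blast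

lemma expectation_D_sq: "expectation (\<lambda>\<omega>. (D k \<omega>)\<^sup>2) = v k"
  using cvar[OF bdd_meas_const[of _ 1], of k] by (simp add: prob_space)

lemma v_nonneg: "0 \<le> v k"
  unfolding expectation_D_sq[symmetric] by simp

lemma V_mono: "m \<le> n \<Longrightarrow> V m \<le> V n"
  unfolding V_def using v_nonneg by (intro sum_mono2) auto

lemma V_nonneg: "0 \<le> V n"
  using V_mono[of 0 n] by simp

lemma v_le:
  assumes "\<And>\<omega>. \<omega> \<in> space M \<Longrightarrow> \<bar>D k \<omega>\<bar> \<le> d"
  shows "v k \<le> d\<^sup>2"
proof -
  have "expectation (\<lambda>\<omega>. (D k \<omega>)\<^sup>2) \<le> expectation (\<lambda>_. d\<^sup>2)"
    using power_mono[OF assms abs_ge_zero, of _ 2]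
    by (intro integral_mono bdd_meas_integrable bdd_meas_power bdd_meas_D_M bdd_meas_const) simp
  then show ?thesis by (simp add: expectation_D_sq prob_space)
qed

lemma expectation_quadratic:
  assumes "bdd_meas (F k) Z0" "bdd_meas (F k) Z1" "bdd_meas (F k) Z2"
  shows "expectation (\<lambda>\<omega>. Z0 \<omega> + Z1 \<omega> * D k \<omega> + Z2 \<omega> * (D k \<omega>)\<^sup>2) =
    expectation Z0 + v k * expectation Z2"
  using assms
  by (subst Bochner_Integration.integral_add Bochner_Integration.integral_add,
      (intro bdd_meas_integrable bdd_meas_intros bdd_meas_D_M; blast intro: bdd_meas_F)+)+
     (simp add: orth cvar)

text \<open>The estimates for exponential and trigonometric functionals are inductions whose step is
  this rule or its mirror image \<open>one_step_ge\<close>: a pointwise quadratic bound in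
  \<open>D k\<close> with \<open>F k\<close>-measurable coefficients loses its linear term to
  \<open>orth\<close> and has its square replaced by the number \<open>v k\<close>.\<close>

lemma one_step_le:
  assumes "bdd_meas M G" "bdd_meas (F k) Z0" "bdd_meas (F k) Z1" "bdd_meas (F k) Z2"
    and "\<And>\<omega>. \<omega> \<in> space M \<Longrightarrow> G \<omega> \<le> Z0 \<omega> + Z1 \<omega> * D k \<omega> + Z2 \<omega> * (D k \<omega>)\<^sup>2"
  shows "expectation G \<le> expectation Z0 + v k * expectation Z2"
  unfolding expectation_quadratic[OF assms(2-4), symmetric]
  using assms by (intro integral_mono bdd_meas_integrable bdd_meas_intros bdd_meas_D_M) (auto intro: bdd_meas_F)

lemma one_step_ge:
  assumes "bdd_meas M G" "bdd_meas (F k) Z0" "bdd_meas (F k) Z1" "bdd_meas (F k) Z2"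
    and "\<And>\<omega>. \<omega> \<in> space M \<Longrightarrow> Z0 \<omega> + Z1 \<omega> * D k \<omega> + Z2 \<omega> * (D k \<omega>)\<^sup>2 \<le> G \<omega>"
  shows "expectation Z0 + v k * expectation Z2 \<le> expectation G"
  unfolding expectation_quadratic[OF assms(2-4), symmetric]
  using assms by (intro integral_mono bdd_meas_integrable bdd_meas_intros bdd_meas_D_M) (auto intro: bdd_meas_F)

lemma expectation_W_sq: "expectation (\<lambda>\<omega>. (W n \<omega>)\<^sup>2) = V n"
proof (induction n)
  case (Suc n)
  have "expectation (\<lambda>\<omega>. (W (Suc n) \<omega>)\<^sup>2) =
      expectation (\<lambda>\<omega>. (W n \<omega>)\<^sup>2 + (2 * W n \<omega>) * D n \<omega> + 1 * (D n \<omega>)\<^sup>2)"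
    by (simp add: W_Suc power2_sum algebra_simps)
  also have "\<dots> = expectation (\<lambda>\<omega>. (W n \<omega>)\<^sup>2) + v n * expectation (\<lambda>_. 1)"
    by (intro expectation_quadratic bdd_meas_intros bdd_meas_W) auto
  finally show ?case by (simp add: Suc V_Suc prob_space)
qed simp

end

section \<open>Exponential moments and small balls\<close>

lemma bdd_meas_of_bool:
  assumes "Measurable.pred N P"
  shows "bdd_meas N (\<lambda>\<omega>. of_bool (P \<omega>))"
  using assms by (intro bdd_measI[where B = 1]) (auto simp: of_bool_def)

context det_var_mds
begin

lemma uminus_mds: "det_var_mds M F (\<lambda>k \<omega>. - D k \<omega>) v"
  using subalg F_Suc orth cvar
  by unfold_locales (auto intro: bdd_meas_minus D_bdd)

text \<open>The weight \<open>Z\<close> is the conditioning device: with the indicator of an event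
  of \<open>F m\<close> the bound becomes conditional on the past, with a constant independent of
  the event. Each step multiplies the moment by at most \<open>1 + u * v n\<close>, hence by at most
  \<open>exp (u * v n)\<close>.\<close>

lemma exp_moment_le:
  assumes Z: "bdd_meas (F m) Z" "\<And>\<omega>. \<omega> \<in> space M \<Longrightarrow> 0 \<le> Z \<omega>"
    and l: "\<bar>l\<bar> * d \<le> e" "e \<le> 1" and "m \<le> n"
    and bD: "\<And>k \<omega>. k < n \<Longrightarrow> \<omega> \<in> space M \<Longrightarrow> \<bar>D k \<omega>\<bar> \<le> d"
  shows "expectation (\<lambda>\<omega>. Z \<omega> * exp (l * (W n \<omega> - W m \<omega>)))
    \<le> exp ((1 + e) * l\<^sup>2 / 2 * (V n - V m)) * expectation Z"
  using \<open>m \<le> n\<close> bD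
proof (induction n rule: dec_induct)
  case (step n)
  define Y where "Y = (\<lambda>\<omega>. Z \<omega> * exp (l * (W n \<omega> - W m \<omega>)))"
  have Y: "bdd_meas (F n) Y" unfolding Y_def
    using step.hyps Z(1) by (intro bdd_meas_intros bdd_meas_W bdd_meas_F_mono[OF Z(1)]) auto
  have Y0: "0 \<le> Y \<omega>" if "\<omega> \<in> space M" for \<omega> using Z(2)[OF that] by (simp add: Y_def)
  have EY: "0 \<le> expectation Y" using Y0 by (intro integral_nonneg_AE) auto
  define u where "u = (1 + e) * l\<^sup>2 / 2"
  have "expectation (\<lambda>\<omega>. Z \<omega> * exp (l * (W (Suc n) \<omega> - W m \<omega>)))
      \<le> expectation Y + v n * expectation (\<lambda>\<omega>. u * Y \<omega>)"
  proof (rule one_step_le[where ?Z1.0 = "\<lambda>\<omega>. Y \<omega> * l"])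
    show "bdd_meas M (\<lambda>\<omega>. Z \<omega> * exp (l * (W (Suc n) \<omega> - W m \<omega>)))"
      using Z(1) by (intro bdd_meas_intros bdd_meas_W_M bdd_meas_F[OF Z(1)])
    fix \<omega> assume \<omega>: "\<omega> \<in> space M"
    have "\<bar>l * D n \<omega>\<bar> \<le> e"
      unfolding abs_mult using step.prems[OF _ \<omega>, of n] l(1)
      by (meson abs_ge_zero lessI mult_left_mono order_trans)
    then have "exp (l * D n \<omega>) \<le> 1 + l * D n \<omega> + (1 + e) * (l * D n \<omega>)\<^sup>2 / 2"
      using exp_taylor2_bounds(1) l(2) by blast
    from mult_left_mono[OF this Y0[OF \<omega>]]
    show "Z \<omega> * exp (l * (W (Suc n) \<omega> - W m \<omega>))
        \<le> Y \<omega> + Y \<omega> * l * D n \<omega> + u * Y \<omega> * (D n \<omega>)\<^sup>2"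
      by (simp add: Y_def W_Suc u_def algebra_simps power_mult_distrib flip: exp_add)
  qed (use Y in \<open>auto intro!: bdd_meas_intros\<close>)
  also have "\<dots> = (1 + u * v n) * expectation Y" by (simp add: algebra_simps)
  also have "\<dots> \<le> exp (u * v n) * expectation Y"
    using EY by (intro mult_right_mono) auto
  also have "\<dots> \<le> exp (u * v n) * (exp (u * (V n - V m)) * expectation Z)"
    using step unfolding Y_def u_def by (intro mult_left_mono) auto
  also have "\<dots> = exp (u * (V (Suc n) - V m)) * expectation Z"
    by (simp add: V_Suc algebra_simps exp_add exp_diff)
  finally show ?case unfolding u_def .
qed simp

text \<open>The deficit is \<open>2 * e\<close> because two losses occur: one \<open>e\<close> in
  the Taylor bound, which gives the step factor \<open>1 + u * v n\<close>, and one when that factor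
  is turned back into an exponential through ln (1 + y) >= y - y^2 with y at most
  \<open>e\<close>.\<close>

lemma exp_moment_ge:
  assumes Z: "bdd_meas (F m) Z" "\<And>\<omega>. \<omega> \<in> space M \<Longrightarrow> 0 \<le> Z \<omega>"
    and l: "\<bar>l\<bar> * d \<le> e" "0 \<le> e" "e \<le> 1" and "m \<le> n"
    and bD: "\<And>k \<omega>. k < n \<Longrightarrow> \<omega> \<in> space M \<Longrightarrow> \<bar>D k \<omega>\<bar> \<le> d"
  shows "exp ((1 - 2 * e) * l\<^sup>2 / 2 * (V n - V m)) * expectation Z
    \<le> expectation (\<lambda>\<omega>. Z \<omega> * exp (l * (W n \<omega> - W m \<omega>)))"
  using \<open>m \<le> n\<close> bD
proof (induction n rule: dec_induct)
  case (step n)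
  define Y where "Y = (\<lambda>\<omega>. Z \<omega> * exp (l * (W n \<omega> - W m \<omega>)))"
  have Y: "bdd_meas (F n) Y" unfolding Y_def
    using step.hyps Z(1) by (intro bdd_meas_intros bdd_meas_W bdd_meas_F_mono[OF Z(1)]) auto
  have Y0: "0 \<le> Y \<omega>" if "\<omega> \<in> space M" for \<omega> using Z(2)[OF that] by (simp add: Y_def)
  have EY: "0 \<le> expectation Y" using Y0 by (intro integral_nonneg_AE) auto
  define u where "u = (1 - e) * l\<^sup>2 / 2"
  define x where "x = (1 - 2 * e) * l\<^sup>2 / 2"
  \<comment> \<open>The variance of one step is controlled by its range,
    \<open>v n \<le> d\<^sup>2\<close>, so \<open>l\<^sup>2 * v n\<close> is at most
    \<open>e\<^sup>2\<close> and thus at most \<open>e\<close>.\<close>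
  have "\<bar>l\<bar> * sqrt (v n) \<le> \<bar>l\<bar> * d"
    using v_le[of n d] step.prems[of n] D_bdd not_empty
    by (intro mult_left_mono real_le_lsqrt) (auto intro: order_trans[OF abs_ge_zero])
  then have "(\<bar>l\<bar> * sqrt (v n))\<^sup>2 \<le> e\<^sup>2"
    using l v_nonneg[of n] by (intro power_mono) auto
  also have "\<dots> \<le> e * 1" unfolding power2_eq_square using l by (intro mult_left_mono) auto
  finally have lv: "l\<^sup>2 * v n \<le> e" using v_nonneg[of n] by (simp add: power_mult_distrib)
  have uv: "0 \<le> u * v n" "u * v n \<le> 1" "u * v n \<le> e"
  proof -
    show "0 \<le> u * v n" unfolding u_def using l v_nonneg by auto
    have "u * v n = (1 - e) / 2 * (l\<^sup>2 * v n)" by (simp add: u_def)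
    also have "\<dots> \<le> 1 * e" using lv l v_nonneg[of n] by (intro mult_mono) auto
    finally show "u * v n \<le> e" "u * v n \<le> 1" using l by auto
  qed
  have "x * v n \<le> u * v n - (u * v n)\<^sup>2"
  proof -
    have "(u * v n)\<^sup>2 \<le> (u * v n) * e" unfolding power2_eq_square using uv by (intro mult_left_mono) auto
    moreover have "u * v n - (u * v n) * e = x * v n + e\<^sup>2 * l\<^sup>2 * v n / 2"
      by (simp add: u_def x_def field_simps power2_eq_square)
    moreover have "0 \<le> e\<^sup>2 * l\<^sup>2 * v n / 2" using v_nonneg by simp
    ultimately show ?thesis by linarith
  qed
  also have "\<dots> \<le> ln (1 + u * v n)" using uv by (intro ln_one_plus_pos_lower_bound) auto
  finally have xv: "exp (x * v n) \<le> 1 + u * v n"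
    using uv by (subst (asm) ln_ge_iff) auto
  have "exp (x * (V (Suc n) - V m)) * expectation Z
      = exp (x * v n) * (exp (x * (V n - V m)) * expectation Z)"
    by (simp add: V_Suc algebra_simps exp_add exp_diff)
  also have "\<dots> \<le> exp (x * v n) * expectation Y"
    using step unfolding Y_def x_def by (intro mult_left_mono) auto
  also have "\<dots> \<le> (1 + u * v n) * expectation Y"
    using EY xv by (intro mult_right_mono) auto
  also have "\<dots> = expectation Y + v n * expectation (\<lambda>\<omega>. u * Y \<omega>)" by (simp add: algebra_simps)
  also have "\<dots> \<le> expectation (\<lambda>\<omega>. Z \<omega> * exp (l * (W (Suc n) \<omega> - W m \<omega>)))"
  proof (rule one_step_ge[where ?Z1.0 = "\<lambda>\<omega>. Y \<omega> * l"])
    show "bdd_meas M (\<lambda>\<omega>. Z \<omega> * exp (l * (W (Suc n) \<omega> - W m \<omega>)))"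
      using Z(1) by (intro bdd_meas_intros bdd_meas_W_M bdd_meas_F[OF Z(1)])
    fix \<omega> assume \<omega>: "\<omega> \<in> space M"
    have "\<bar>l * D n \<omega>\<bar> \<le> e"
      unfolding abs_mult using step.prems[OF _ \<omega>, of n] l(1)
      by (meson abs_ge_zero lessI mult_left_mono order_trans)
    then have "1 + l * D n \<omega> + (1 - e) * (l * D n \<omega>)\<^sup>2 / 2 \<le> exp (l * D n \<omega>)"
      using exp_taylor2_bounds(2) l(3) by blast
    from mult_left_mono[OF this Y0[OF \<omega>]]
    show "Y \<omega> + Y \<omega> * l * D n \<omega> + u * Y \<omega> * (D n \<omega>)\<^sup>2
        \<le> Z \<omega> * exp (l * (W (Suc n) \<omega> - W m \<omega>))"
      by (simp add: Y_def W_Suc u_def algebra_simps power_mult_distrib flip: exp_add)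
  qed (use Y in \<open>auto intro!: bdd_meas_intros\<close>)
  finally show ?case unfolding x_def .
qed simp

text \<open>Exponential tilting without a change of measure. Weighted by exp (l Y), the increment Y
  of variance U concentrates near \<open>l * U\<close>; the last condition on \<open>l\<close> makes
  the window from \<open>(1 - g) * l * U\<close> to \<open>(1 + g) * l * U\<close> wide enough to
  carry half of the lower bound for the tilted mass. On the window exp (l Y) is at most its value at
  the right end, and dividing by that value leaves an unweighted probability. The 2 in
  \<open>2 * l * d\<close> is there because the tilts in use reach
  \<open>(1 + g) * l\<close>.\<close>

lemma lower_tail:
  assumes Z: "bdd_meas (F m) Z" "\<And>\<omega>. \<omega> \<in> space M \<Longrightarrow> 0 \<le> Z \<omega>"
    and g: "0 < g" "g \<le> 1" and l: "0 \<le> l" "2 * l * d \<le> g\<^sup>2 / 16" "16 \<le> g\<^sup>2 * l\<^sup>2 * (V n - V m)"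
    and "m \<le> n" and d: "0 \<le> d" and bD: "\<And>k \<omega>. k < n \<Longrightarrow> \<omega> \<in> space M \<Longrightarrow> \<bar>D k \<omega>\<bar> \<le> d"
  shows "exp (- (1 + 4 * g) * l\<^sup>2 / 2 * (V n - V m)) * expectation Z
    \<le> expectation (\<lambda>\<omega>. Z \<omega> * of_bool ((1 - g) * l * (V n - V m) \<le> W n \<omega> - W m \<omega>))"
proof -
  define U where "U = V n - V m"
  define e where "e = g\<^sup>2 / 16"
  define T where "T = l\<^sup>2 / 2 * U"
  define Y where "Y = (\<lambda>\<omega>. W n \<omega> - W m \<omega>)"
  define y1 y2 where "y1 = (1 - g) * l * U" and "y2 = (1 + g) * l * U"
  define B where "B = expectation (\<lambda>\<omega>. Z \<omega> * of_bool (y1 \<le> Y \<omega>))"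
  have g2: "g\<^sup>2 \<le> 1" "0 < g\<^sup>2" "g\<^sup>2 \<le> g"
    using g by (auto simp: power_le_one power2_eq_square mult_le_one)
  have e: "0 \<le> e" "e \<le> 1" using g2 by (auto simp: e_def)
  have U: "0 \<le> U" using V_mono[OF \<open>m \<le> n\<close>] by (simp add: U_def)
  have T0: "0 \<le> T" using U by (simp add: T_def)
  have Tg2: "8 \<le> T * g\<^sup>2" using l(3) by (simp add: T_def U_def algebra_simps)
  also have "T * g\<^sup>2 \<le> T * g" using g2 T0 by (intro mult_left_mono) auto
  finally have Tg: "8 \<le> T * g" .
  have EZ: "0 \<le> expectation Z" using Z(2) by (intro integral_nonneg_AE) auto
  have ld: "0 \<le> l * d" using l d by simp
  have mom: "expectation (\<lambda>\<omega>. Z \<omega> * exp (l' * Y \<omega>)) \<le> exp ((1 + e) * l'\<^sup>2 / 2 * U) * expectation Z"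
    if "0 \<le> l'" "l' \<le> 2 * l" for l'
    unfolding Y_def U_def
  proof (rule exp_moment_le[OF Z _ \<open>e \<le> 1\<close> \<open>m \<le> n\<close> bD])
    have "l' * d \<le> 2 * l * d" using that d by (intro mult_right_mono) auto
    then show "\<bar>l'\<bar> * d \<le> e" using l(2) that by (simp add: e_def)
  qed auto
  have ZM: "bdd_meas M Z" using Z(1) by (rule bdd_meas_F)
  have YM: "bdd_meas M Y" unfolding Y_def by (intro bdd_meas_intros bdd_meas_W_M)
  have [measurable]: "Z \<in> borel_measurable M" "Y \<in> borel_measurable M"
    using ZM YM bdd_meas_measurable by blast+
  have obM: "bdd_meas M (\<lambda>\<omega>. of_bool (y1 \<le> Y \<omega>))" by (intro bdd_meas_of_bool) measurable
  have "exp ((1 - 2 * e) * l\<^sup>2 / 2 * U) * expectation Z \<le> expectation (\<lambda>\<omega>. Z \<omega> * exp (l * Y \<omega>))"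
    unfolding Y_def U_def using l ld e by (intro exp_moment_ge[OF Z _ _ _ \<open>m \<le> n\<close> bD]) (auto simp: e_def)
  also have "\<dots> \<le> expectation (\<lambda>\<omega>. exp (g * l * y1) * (Z \<omega> * exp ((1 - g) * l * Y \<omega>))
      + exp (- g * l * y2) * (Z \<omega> * exp ((1 + g) * l * Y \<omega>))
      + exp (l * y2) * (Z \<omega> * of_bool (y1 \<le> Y \<omega>)))"
  proof (intro integral_mono bdd_meas_integrable)
    fix \<omega> assume \<omega>: "\<omega> \<in> space M"
    have "exp (l * Y \<omega>) \<le> exp (g * l * y1) * exp ((1 - g) * l * Y \<omega>)
      + exp (- g * l * y2) * exp ((1 + g) * l * Y \<omega>) + exp (l * y2) * of_bool (y1 \<le> Y \<omega>)"
    proof -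
      \<comment> \<open>Outside the window the tilt is moved from \<open>l\<close> to
        \<open>(1 - g) * l\<close> or \<open>(1 + g) * l\<close>; the difference
        \<open>g * l * Y \<omega>\<close> is replaced by its value at the nearer end of the
        window.\<close>
      consider "Y \<omega> < y1" | "y1 \<le> Y \<omega>" "Y \<omega> \<le> y2" | "y2 < Y \<omega>" by linarith
      then show ?thesis
      proof cases
        case 1
        have "g * l * Y \<omega> \<le> g * l * y1" using 1 g l by (intro mult_left_mono) auto
        then have "l * Y \<omega> \<le> g * l * y1 + (1 - g) * l * Y \<omega>" by (simp add: algebra_simps)
        then have "exp (l * Y \<omega>) \<le> exp (g * l * y1) * exp ((1 - g) * l * Y \<omega>)" by (simp flip: exp_add)
        then show ?thesis by (simp add: add_increasing2)
      next
        case 2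
        then have "exp (l * Y \<omega>) \<le> exp (l * y2)" using l by (simp add: mult_left_mono)
        then show ?thesis using 2 by (simp add: add_increasing)
      next
        case 3
        have "g * l * y2 \<le> g * l * Y \<omega>" using 3 g l by (intro mult_left_mono) auto
        then have "l * Y \<omega> \<le> - g * l * y2 + (1 + g) * l * Y \<omega>" by (simp add: algebra_simps)
        then have "exp (l * Y \<omega>) \<le> exp (- g * l * y2) * exp ((1 + g) * l * Y \<omega>)" by (simp flip: exp_add)
        then show ?thesis by (simp add: add_increasing add_increasing2)
      qed
    qed
    from mult_left_mono[OF this Z(2)[OF \<omega>]]
    show "Z \<omega> * exp (l * Y \<omega>) \<le> exp (g * l * y1) * (Z \<omega> * exp ((1 - g) * l * Y \<omega>))
      + exp (- g * l * y2) * (Z \<omega> * exp ((1 + g) * l * Y \<omega>))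
      + exp (l * y2) * (Z \<omega> * of_bool (y1 \<le> Y \<omega>))"
      by (simp add: algebra_simps)
  qed (intro bdd_meas_intros ZM YM obM)+
  also have "\<dots> = exp (g * l * y1) * expectation (\<lambda>\<omega>. Z \<omega> * exp ((1 - g) * l * Y \<omega>))
      + exp (- g * l * y2) * expectation (\<lambda>\<omega>. Z \<omega> * exp ((1 + g) * l * Y \<omega>))
      + exp (l * y2) * B"
    unfolding B_def
    by (subst Bochner_Integration.integral_add Bochner_Integration.integral_add,
        (intro bdd_meas_integrable bdd_meas_intros ZM YM obM)+)+ simp
  also have "\<dots> \<le> exp (T * (1 - 3 / 4 * g\<^sup>2)) * expectation Z
      + exp (T * (1 - 3 / 4 * g\<^sup>2)) * expectation Z + exp (l * y2) * B"
  proof (intro add_mono order_refl)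
    have "exp (g * l * y1) * expectation (\<lambda>\<omega>. Z \<omega> * exp ((1 - g) * l * Y \<omega>))
      \<le> exp (g * l * y1) * (exp ((1 + e) * ((1 - g) * l)\<^sup>2 / 2 * U) * expectation Z)"
      using g l by (intro mult_left_mono mom) (auto intro: mult_right_mono)
    also have "\<dots> = exp (T * (2 * g * (1 - g) + (1 + e) * (1 - g)\<^sup>2)) * expectation Z"
      by (simp add: T_def y1_def field_simps power2_eq_square flip: exp_add)
    also have "\<dots> \<le> exp (T * (1 - 3 / 4 * g\<^sup>2)) * expectation Z"
    proof -
      have "e * (1 - g)\<^sup>2 \<le> e * 1" using e g by (intro mult_left_mono) (auto simp: power_le_one)
      then have "2 * g * (1 - g) + (1 + e) * (1 - g)\<^sup>2 \<le> 1 - 3 / 4 * g\<^sup>2"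
      proof -
        have "2 * g * (1 - g) + (1 + e) * (1 - g)\<^sup>2 = 1 - g\<^sup>2 + e * (1 - g)\<^sup>2"
          by (simp add: algebra_simps power2_eq_square)
        also have "\<dots> \<le> 1 - g\<^sup>2 + g\<^sup>2 / 16"
          using \<open>e * (1 - g)\<^sup>2 \<le> e * 1\<close> by (simp add: e_def)
        finally show ?thesis using g2 by linarith
      qed
      then show ?thesis using T0 EZ by (intro mult_right_mono) (auto intro: mult_left_mono)
    qed
    finally show "exp (g * l * y1) * expectation (\<lambda>\<omega>. Z \<omega> * exp ((1 - g) * l * Y \<omega>))
      \<le> exp (T * (1 - 3 / 4 * g\<^sup>2)) * expectation Z" .
    have "exp (- g * l * y2) * expectation (\<lambda>\<omega>. Z \<omega> * exp ((1 + g) * l * Y \<omega>))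
      \<le> exp (- g * l * y2) * (exp ((1 + e) * ((1 + g) * l)\<^sup>2 / 2 * U) * expectation Z)"
      using g l by (intro mult_left_mono mom) (auto intro: mult_right_mono)
    also have "\<dots> = exp (T * (- 2 * g * (1 + g) + (1 + e) * (1 + g)\<^sup>2)) * expectation Z"
      by (simp add: T_def y2_def field_simps power2_eq_square flip: exp_add)
    also have "\<dots> \<le> exp (T * (1 - 3 / 4 * g\<^sup>2)) * expectation Z"
    proof -
      have "(1 + g)\<^sup>2 \<le> 2\<^sup>2" using g by (intro power_mono) auto
      then have "e * (1 + g)\<^sup>2 \<le> e * 4" using e by (intro mult_left_mono) auto
      then have "- 2 * g * (1 + g) + (1 + e) * (1 + g)\<^sup>2 \<le> 1 - 3 / 4 * g\<^sup>2"
      proof -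
        have "- 2 * g * (1 + g) + (1 + e) * (1 + g)\<^sup>2 = 1 - g\<^sup>2 + e * (1 + g)\<^sup>2"
          by (simp add: algebra_simps power2_eq_square)
        also have "\<dots> \<le> 1 - g\<^sup>2 + g\<^sup>2 / 4"
          using \<open>e * (1 + g)\<^sup>2 \<le> e * 4\<close> by (simp add: e_def)
        finally show ?thesis by linarith
      qed
      then show ?thesis using T0 EZ by (intro mult_right_mono) (auto intro: mult_left_mono)
    qed
    finally show "exp (- g * l * y2) * expectation (\<lambda>\<omega>. Z \<omega> * exp ((1 + g) * l * Y \<omega>))
      \<le> exp (T * (1 - 3 / 4 * g\<^sup>2)) * expectation Z" .
  qed
  finally have main: "exp ((1 - 2 * e) * l\<^sup>2 / 2 * U) * expectation Z
      \<le> 2 * (exp (T * (1 - 3 / 4 * g\<^sup>2)) * expectation Z) + exp (l * y2) * B"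
    by linarith
  have "(1 - 2 * e) * l\<^sup>2 / 2 * U = T * (1 - g\<^sup>2 / 8)"
    by (simp add: T_def e_def field_simps)
  note main = main[unfolded this]
  \<comment> \<open>The choice \<open>e = g\<^sup>2 / 16\<close> leaves a gap of
    \<open>5 / 8 * (T * g\<^sup>2)\<close>, at least 5, between the exponent of the whole mass and
    that of either tail. A factor 4 suffices for the two tails to take at most half.\<close>
  have "exp (T * (1 - g\<^sup>2 / 8)) = exp (T * (1 - 3 / 4 * g\<^sup>2)) * exp (5 / 8 * (T * g\<^sup>2))"
    by (simp add: algebra_simps flip: exp_add)
  also have "\<dots> \<ge> exp (T * (1 - 3 / 4 * g\<^sup>2)) * 4"
  proof (intro mult_left_mono)
    show "4 \<le> exp (5 / 8 * (T * g\<^sup>2))"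
      using Tg2 by (intro order_trans[OF _ exp_ge_add_one_self]) auto
  qed simp
  finally have "4 * (exp (T * (1 - 3 / 4 * g\<^sup>2)) * expectation Z) \<le> exp (T * (1 - g\<^sup>2 / 8)) * expectation Z"
    using EZ mult_right_mono by fastforce
  with main have half: "exp (T * (1 - g\<^sup>2 / 8)) * expectation Z \<le> 2 * exp (l * y2) * B"
    by linarith
  \<comment> \<open>So far the exponent is about \<open>- (1 + 2 * g) * T\<close>. One further
    \<open>T * g\<close>, at least 8, is spent on the factor 2; the rest of \<open>4 * g\<close>
    swallows \<open>g\<^sup>2 / 8\<close>.\<close>
  have "exp (- (1 + 4 * g) * l\<^sup>2 / 2 * U) * expectation Z
      \<le> exp (T * (1 - g\<^sup>2 / 8) - l * y2 - T * g) * expectation Z"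
  proof -
    have "l * y2 = 2 * (1 + g) * T" by (simp add: y2_def T_def power2_eq_square)
    then have "T * (1 - g\<^sup>2 / 8) - l * y2 - T * g = - (1 + 4 * g) * T + T * (g - g\<^sup>2 / 8)"
      by (simp add: algebra_simps)
    moreover have "0 \<le> T * (g - g\<^sup>2 / 8)" using T0 g2 g by (intro mult_nonneg_nonneg) auto
    moreover have "- (1 + 4 * g) * l\<^sup>2 / 2 * U = - (1 + 4 * g) * T" by (simp add: T_def)
    ultimately have "- (1 + 4 * g) * l\<^sup>2 / 2 * U \<le> T * (1 - g\<^sup>2 / 8) - l * y2 - T * g"
      by linarith
    then show ?thesis using EZ by (intro mult_right_mono exp_le_cancel_iff[THEN iffD2])
  qed
  also have "\<dots> = exp (- (T * g)) * exp (- l * y2) * (exp (T * (1 - g\<^sup>2 / 8)) * expectation Z)"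
    by (simp add: algebra_simps flip: exp_add)
  also have "\<dots> \<le> exp (- (T * g)) * exp (- l * y2) * (2 * exp (l * y2) * B)"
    using half by (intro mult_left_mono) auto
  also have "\<dots> = (2 * exp (- (T * g))) * B"
    by (simp add: exp_minus)
  also have "\<dots> \<le> 1 * B"
  proof (rule mult_right_mono)
    have "2 \<le> exp (T * g)" using Tg by (intro order_trans[OF _ exp_ge_add_one_self]) auto
    then show "2 * exp (- (T * g)) \<le> 1" by (simp add: exp_minus field_simps)
    show "0 \<le> B" unfolding B_def using Z(2) by (intro integral_nonneg_AE) auto
  qed
  finally show ?thesis by (simp add: B_def y1_def U_def Y_def)
qed

section \<open>A maximal inequality and the probabilities of small balls\<close>

lemma pred_W_less: "Measurable.pred (F n) (\<lambda>\<omega>. \<forall>j\<in>{0..n}. W j \<omega> < x)"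
proof -
  have "Measurable.pred (F n) (\<lambda>\<omega>. W j \<omega> < x)" if "j \<in> {0..n}" for j
  proof -
    have [measurable]: "W j \<in> borel_measurable (F n)"
      using that W_measurable_F[of j n] by auto
    show ?thesis by measurable
  qed
  then show ?thesis by (intro pred_intros_finite) auto
qed

lemma pred_W_diff_le: "Measurable.pred (F n) (\<lambda>\<omega>. \<forall>j\<in>{m..n}. \<bar>W j \<omega> - W m \<omega>\<bar> \<le> x)"
proof -
  have "Measurable.pred (F n) (\<lambda>\<omega>. \<bar>W j \<omega> - W m \<omega>\<bar> \<le> x)" if "j \<in> {m..n}" for j
  proof -
    have [measurable]: "W j \<in> borel_measurable (F n)" "W m \<in> borel_measurable (F n)"
      using that W_measurable_F[of j n] W_measurable_F[of m n] by auto
    show ?thesis by measurable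
  qed
  then show ?thesis by (intro pred_intros_finite) auto
qed

text \<open>Doob's argument for the supermartingale exp (l W - c V), with the stopping time replaced
  by bookkeeping: \<open>J n\<close> marks the paths still below \<open>x\<close>, and each path
  that has crossed is charged the constant \<kappa>, a lower bound for the supermartingale at the
  moment of crossing. The expectation of the total never increases.\<close>

lemma maximal_ineq:
  assumes l: "0 \<le> l" "l * d \<le> e" "0 \<le> e" "e \<le> 1" and "0 < x"
    and bD: "\<And>k \<omega>. k < N \<Longrightarrow> \<omega> \<in> space M \<Longrightarrow> \<bar>D k \<omega>\<bar> \<le> d"
  shows "\<P>(\<omega> in M. \<exists>j\<in>{0..N}. x \<le> W j \<omega>) \<le> exp (- l * x + (1 + e) * l\<^sup>2 / 2 * V N)"
proof -
  define c where "c = (1 + e) * l\<^sup>2 / 2"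
  \<comment> \<open>At the crossing index \<open>W\<close> is at least \<open>x\<close> and
    \<open>V\<close> is at most \<open>V N\<close>; using \<open>V N\<close> makes the charge the
    same for all crossing times.\<close>
  define \<kappa> where "\<kappa> = exp (l * x - c * V N)"
  define J :: "nat \<Rightarrow> 'a \<Rightarrow> real" where "J = (\<lambda>n \<omega>. of_bool (\<forall>j\<in>{0..n}. W j \<omega> < x))"
  have JF: "bdd_meas (F n) (J n)" for n unfolding J_def by (intro bdd_meas_of_bool pred_W_less)
  have JM: "bdd_meas M (J n)" for n using JF bdd_meas_F by blast
  have c: "0 \<le> c" using l by (simp add: c_def)
  have "expectation (\<lambda>\<omega>. J n \<omega> * exp (l * W n \<omega> - c * V n) + \<kappa> * (1 - J n \<omega>)) \<le> 1" if "n \<le> N" for n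
    using that
  proof (induction n)
    case 0
    then show ?case using \<open>0 < x\<close> by (simp add: J_def prob_space)
  next
    case (Suc n)
    define Y where "Y = (\<lambda>\<omega>. J n \<omega> * exp (l * W n \<omega> - c * V n))"
    have Y: "bdd_meas (F n) Y" unfolding Y_def
      by (intro bdd_meas_intros bdd_meas_W JF) auto
    have Y0: "0 \<le> Y \<omega>" for \<omega> by (simp add: Y_def J_def)
    have EY: "0 \<le> expectation Y" using Y0 by (intro integral_nonneg_AE) auto
    define r where "r = exp (- c * v n)"
    have "expectation (\<lambda>\<omega>. J (Suc n) \<omega> * exp (l * W (Suc n) \<omega> - c * V (Suc n)) + \<kappa> * (1 - J (Suc n) \<omega>))
        \<le> expectation (\<lambda>\<omega>. r * Y \<omega> + \<kappa> * (1 - J n \<omega>)) + v n * expectation (\<lambda>\<omega>. r * c * Y \<omega>)"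
    proof (rule one_step_le[where ?Z1.0 = "\<lambda>\<omega>. r * l * Y \<omega>"])
      show "bdd_meas M (\<lambda>\<omega>. J (Suc n) \<omega> * exp (l * W (Suc n) \<omega> - c * V (Suc n)) + \<kappa> * (1 - J (Suc n) \<omega>))"
        by (intro bdd_meas_intros bdd_meas_W_M JM)
      fix \<omega> assume \<omega>: "\<omega> \<in> space M"
      have "\<bar>l * D n \<omega>\<bar> \<le> e"
        unfolding abs_mult using bD[OF _ \<omega>, of n] l Suc.prems
        by (intro order_trans[OF _ l(2)]) (auto intro: mult_left_mono)
      then have ex: "exp (l * D n \<omega>) \<le> 1 + l * D n \<omega> + (1 + e) * (l * D n \<omega>)\<^sup>2 / 2"
        using exp_taylor2_bounds(1) l(4) by blast
      have "J (Suc n) \<omega> * exp (l * W (Suc n) \<omega> - c * V (Suc n)) + \<kappa> * (1 - J (Suc n) \<omega>)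
         \<le> J n \<omega> * exp (l * W (Suc n) \<omega> - c * V (Suc n)) + \<kappa> * (1 - J n \<omega>)"
      \<comment> \<open>Only a path that crosses exactly at \<open>Suc n\<close> changes its
        account, and it trades the exponential for a \<kappa> that is no larger.\<close>
      proof (cases "(\<forall>j\<in>{0..n}. W j \<omega> < x) \<and> x \<le> W (Suc n) \<omega>")
        case True
        then have J: "J n \<omega> = 1" "J (Suc n) \<omega> = 0"
          by (auto simp: J_def not_less intro!: bexI[of _ "Suc n"])
        have "l * x \<le> l * W (Suc n) \<omega>" using True l by (intro mult_left_mono) auto
        moreover have "c * V (Suc n) \<le> c * V N" using c V_mono[OF Suc.prems] by (intro mult_left_mono) auto
        ultimately show ?thesis by (simp add: J \<kappa>_def)
      next
        case False
        then have "J n \<omega> = J (Suc n) \<omega>" by (force simp: J_def atLeastAtMostSuc_conv)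
        then show ?thesis by simp
      qed
      also have "J n \<omega> * exp (l * W (Suc n) \<omega> - c * V (Suc n)) = r * Y \<omega> * exp (l * D n \<omega>)"
        by (simp add: Y_def r_def W_Suc V_Suc algebra_simps flip: exp_add)
      also have "\<dots> \<le> r * Y \<omega> * (1 + l * D n \<omega> + (1 + e) * (l * D n \<omega>)\<^sup>2 / 2)"
        using ex Y0[of \<omega>] by (intro mult_left_mono) (auto simp: r_def)
      also have "\<dots> = r * Y \<omega> + r * l * Y \<omega> * D n \<omega> + r * c * Y \<omega> * (D n \<omega>)\<^sup>2"
        by (simp add: c_def field_simps power2_eq_square)
      finally show "J (Suc n) \<omega> * exp (l * W (Suc n) \<omega> - c * V (Suc n)) + \<kappa> * (1 - J (Suc n) \<omega>)
        \<le> r * Y \<omega> + \<kappa> * (1 - J n \<omega>) + r * l * Y \<omega> * D n \<omega> + r * c * Y \<omega> * (D n \<omega>)\<^sup>2"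
        by simp
    qed (use Y JF in \<open>auto intro!: bdd_meas_intros\<close>)
    also have "expectation (\<lambda>\<omega>. r * Y \<omega> + \<kappa> * (1 - J n \<omega>)) = r * expectation Y + expectation (\<lambda>\<omega>. \<kappa> * (1 - J n \<omega>))"
      by (subst Bochner_Integration.integral_add)
         (auto intro!: bdd_meas_integrable bdd_meas_intros bdd_meas_F[OF Y] JM)
    also have "r * expectation Y + expectation (\<lambda>\<omega>. \<kappa> * (1 - J n \<omega>)) + v n * expectation (\<lambda>\<omega>. r * c * Y \<omega>)
        = r * (1 + c * v n) * expectation Y + expectation (\<lambda>\<omega>. \<kappa> * (1 - J n \<omega>))"
      by (simp add: algebra_simps)
    also have "\<dots> \<le> 1 * expectation Y + expectation (\<lambda>\<omega>. \<kappa> * (1 - J n \<omega>))"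
    proof (intro add_mono mult_right_mono order_refl EY)
      have "r * (1 + c * v n) \<le> r * exp (c * v n)" by (intro mult_left_mono) (auto simp: r_def)
      then show "r * (1 + c * v n) \<le> 1" by (simp add: r_def flip: exp_add)
    qed
    also have "\<dots> = expectation (\<lambda>\<omega>. Y \<omega> + \<kappa> * (1 - J n \<omega>))"
      by (subst Bochner_Integration.integral_add)
         (auto intro!: bdd_meas_integrable bdd_meas_intros bdd_meas_F[OF Y] JM)
    also have "\<dots> \<le> 1" using Suc unfolding Y_def by simp
    finally show ?case .
  qed
  from this[of N] have "expectation (\<lambda>\<omega>. J N \<omega> * exp (l * W N \<omega> - c * V N) + \<kappa> * (1 - J N \<omega>)) \<le> 1" by simp
  moreover have "expectation (\<lambda>\<omega>. \<kappa> * (1 - J N \<omega>))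
      \<le> expectation (\<lambda>\<omega>. J N \<omega> * exp (l * W N \<omega> - c * V N) + \<kappa> * (1 - J N \<omega>))"
    by (intro integral_mono bdd_meas_integrable bdd_meas_intros JM bdd_meas_W_M) (simp add: J_def)
  ultimately have "\<kappa> * expectation (\<lambda>\<omega>. 1 - J N \<omega>) \<le> 1" by simp
  moreover have "expectation (\<lambda>\<omega>. 1 - J N \<omega>) = \<P>(\<omega> in M. \<exists>j\<in>{0..N}. x \<le> W j \<omega>)"
  proof -
    have "expectation (\<lambda>\<omega>. 1 - J N \<omega>) = expectation (indicator {\<omega> \<in> space M. \<exists>j\<in>{0..N}. x \<le> W j \<omega>})"
      by (intro Bochner_Integration.integral_cong) (auto simp: J_def indicator_def not_less)
    then show ?thesis by simp
  qed
  ultimately have "\<P>(\<omega> in M. \<exists>j\<in>{0..N}. x \<le> W j \<omega>) \<le> 1 / \<kappa>"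
    by (simp add: \<kappa>_def field_simps)
  also have "1 / \<kappa> = exp (- l * x + (1 + e) * l\<^sup>2 / 2 * V N)"
    by (simp add: \<kappa>_def c_def exp_minus[symmetric] inverse_eq_divide[symmetric])
  finally show ?thesis .
qed

text \<open>Up to a small error each step multiplies the mean of \<open>cos (t * W n)\<close> by exp
  (- t^2 v / 2). Two margins are kept: \<open>t * (L + d) \<le> pi / 2\<close> leaves the cosine
  nonnegative even one jump beyond \<open>L\<close>, so forgetting the newest constraint only raises
  the expectation; and \<open>t * d \<le> 3 * e * cos (t * L)\<close> makes the cubic error a
  fraction \<open>e\<close> of the quadratic term throughout [-L, L].\<close>

lemma small_ball_upper:
  assumes t: "0 < t" "0 \<le> L" "0 \<le> d" "t * (L + d) \<le> pi / 2" "t * d \<le> 3 * e * cos (t * L)" "e \<le> 1"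
    and cos: "0 < cos (t * L)"
    and bD: "\<And>k \<omega>. k < N \<Longrightarrow> \<omega> \<in> space M \<Longrightarrow> \<bar>D k \<omega>\<bar> \<le> d"
  shows "\<P>(\<omega> in M. \<forall>j\<in>{0..N}. \<bar>W j \<omega>\<bar> \<le> L) * cos (t * L) \<le> exp (- (1 - e) * t\<^sup>2 / 2 * V N)"
proof -
  define u where "u = (1 - e) * t\<^sup>2 / 2"
  define J :: "nat \<Rightarrow> 'a \<Rightarrow> real" where "J = (\<lambda>n \<omega>. of_bool (\<forall>j\<in>{0..n}. \<bar>W j \<omega>\<bar> \<le> L))"
  have JF: "bdd_meas (F n) (J n)" for n
    unfolding J_def
    by (intro bdd_meas_of_bool pred_W_diff_le[where m = 0, unfolded W_0 diff_0_right])
  have JM: "bdd_meas M (J n)" for n using JF bdd_meas_F by blast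
  have tL: "t * L \<le> pi / 2" using t by (intro order_trans[OF _ t(4)] mult_left_mono) auto
  then have "t * L \<le> pi" using pi_gt_zero by linarith
  note tL = tL this
  have cosL: "cos (t * L) \<le> cos (t * w)" if "\<bar>w\<bar> \<le> L" for w
  proof -
    have "cos (t * L) \<le> cos (t * \<bar>w\<bar>)"
      using that t tL by (intro cos_monotone_0_pi_le) (auto intro: mult_left_mono)
    also have "cos (t * \<bar>w\<bar>) = cos (t * w)" using t(1) by (metis abs_mult abs_of_pos cos_abs_real)
    finally show ?thesis .
  qed
  have Jcos: "J n \<omega> * cos (t * L) \<le> J n \<omega> * cos (t * W n \<omega>)" for n \<omega>
    using cosL[of "W n \<omega>"] by (auto simp: J_def)
  have "expectation (\<lambda>\<omega>. J n \<omega> * cos (t * W n \<omega>)) \<le> exp (- u * V n)" if "n \<le> N" for n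
    using that
  proof (induction n)
    case 0
    then show ?case using t by (simp add: J_def prob_space)
  next
    case (Suc n)
    define Y where "Y = (\<lambda>\<omega>. J n \<omega> * cos (t * W n \<omega>))"
    have Y: "bdd_meas (F n) Y" unfolding Y_def
      by (intro bdd_meas_intros bdd_meas_W JF) auto
    have Y0: "0 \<le> Y \<omega>" for \<omega>
      using Jcos[of n \<omega>] cos by (auto simp: Y_def J_def split: if_splits)
    have EY: "0 \<le> expectation Y" using Y0 by (intro integral_nonneg_AE) auto
    have "expectation (\<lambda>\<omega>. J (Suc n) \<omega> * cos (t * W (Suc n) \<omega>))
        \<le> expectation Y + v n * expectation (\<lambda>\<omega>. - u * Y \<omega>)"
    proof (rule one_step_le[where ?Z1.0 = "\<lambda>\<omega>. - t * (J n \<omega> * sin (t * W n \<omega>))"])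
      show "bdd_meas M (\<lambda>\<omega>. J (Suc n) \<omega> * cos (t * W (Suc n) \<omega>))"
        by (intro bdd_meas_intros bdd_meas_W_M JM)
      show "bdd_meas (F n) (\<lambda>\<omega>. - t * (J n \<omega> * sin (t * W n \<omega>)))"
        by (intro bdd_meas_intros bdd_meas_W JF) auto
      fix \<omega> assume \<omega>: "\<omega> \<in> space M"
      have Dd: "\<bar>D n \<omega>\<bar> \<le> d" using bD \<omega> Suc.prems by simp
      show "J (Suc n) \<omega> * cos (t * W (Suc n) \<omega>)
          \<le> Y \<omega> + - t * (J n \<omega> * sin (t * W n \<omega>)) * D n \<omega> + - u * Y \<omega> * (D n \<omega>)\<^sup>2"
      proof (cases "\<forall>j\<in>{0..n}. \<bar>W j \<omega>\<bar> \<le> L")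
        case False
        then have "J n \<omega> = 0" "J (Suc n) \<omega> = 0" by (force simp: J_def)+
        then show ?thesis by (simp add: Y_def)
      next
        case True
        then have J: "J n \<omega> = 1" and Wn: "\<bar>W n \<omega>\<bar> \<le> L" by (auto simp: J_def)
        have "0 \<le> cos (t * W (Suc n) \<omega>)"
        proof -
          have "\<bar>W (Suc n) \<omega>\<bar> \<le> L + d" using Wn Dd by (simp add: W_Suc)
          then have "\<bar>t * W (Suc n) \<omega>\<bar> \<le> t * (L + d)"
            unfolding abs_mult using t by (auto intro: mult_left_mono)
          then show ?thesis using t(4) by (intro cos_ge_zero) auto
        qed
        then have "J (Suc n) \<omega> * cos (t * W (Suc n) \<omega>) \<le> cos (t * W n \<omega> + t * D n \<omega>)"
          by (simp add: J_def W_Suc algebra_simps)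
        also have "\<dots> \<le> cos (t * W n \<omega>) - t * D n \<omega> * sin (t * W n \<omega>)
            - (t * D n \<omega>)\<^sup>2 / 2 * cos (t * W n \<omega>) + \<bar>t * D n \<omega>\<bar> ^ 3 / 6"
          using cos_taylor2[of "t * W n \<omega>" "t * D n \<omega>"] by linarith
        also have "\<bar>t * D n \<omega>\<bar> ^ 3 / 6 \<le> e * (t * D n \<omega>)\<^sup>2 / 2 * cos (t * W n \<omega>)"
        proof -
          have e0: "0 \<le> e" using t(1,3,5) cos
            by (metis mult_nonneg_nonneg less_imp_le order_trans zero_le_mult_iff not_less zero_less_numeral)
          have "\<bar>t * D n \<omega>\<bar> \<le> t * d" unfolding abs_mult using Dd t by (auto intro: mult_left_mono)
          also have "\<dots> \<le> 3 * e * cos (t * W n \<omega>)"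
            using t(5) cosL[OF Wn] e0 by (smt (verit) mult_left_mono)
          finally have "\<bar>t * D n \<omega>\<bar> * (t * D n \<omega>)\<^sup>2 \<le> 3 * e * cos (t * W n \<omega>) * (t * D n \<omega>)\<^sup>2"
            by (intro mult_right_mono) auto
          then show ?thesis by (simp add: eval_nat_numeral abs_mult algebra_simps)
        qed
        finally show ?thesis by (simp add: J Y_def u_def field_simps power2_eq_square)
      qed
    qed (use Y in \<open>auto intro!: bdd_meas_intros\<close>)
    also have "\<dots> = (1 - u * v n) * expectation Y" by (simp add: algebra_simps)
    also have "\<dots> \<le> exp (- u * v n) * expectation Y"
      using EY exp_ge_add_one_self[of "- u * v n"] by (intro mult_right_mono) auto
    also have "\<dots> \<le> exp (- u * v n) * exp (- u * V n)"
      using Suc unfolding Y_def by (intro mult_left_mono) auto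
    also have "\<dots> = exp (- u * V (Suc n))" by (simp add: V_Suc algebra_simps flip: exp_add)
    finally show ?case .
  qed
  from this[of N] have "expectation (\<lambda>\<omega>. J N \<omega> * cos (t * W N \<omega>)) \<le> exp (- u * V N)" by simp
  moreover have "expectation (\<lambda>\<omega>. J N \<omega> * cos (t * L)) \<le> expectation (\<lambda>\<omega>. J N \<omega> * cos (t * W N \<omega>))"
    using Jcos by (intro integral_mono bdd_meas_integrable bdd_meas_intros JM bdd_meas_W_M)
  moreover have "expectation (J N) = \<P>(\<omega> in M. \<forall>j\<in>{0..N}. \<bar>W j \<omega>\<bar> \<le> L)"
  proof -
    have "expectation (J N) = expectation (indicator {\<omega> \<in> space M. \<forall>j\<in>{0..N}. \<bar>W j \<omega>\<bar> \<le> L})"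
      by (intro Bochner_Integration.integral_cong) (auto simp: J_def indicator_def)
    then show ?thesis by simp
  qed
  ultimately have "\<P>(\<omega> in M. \<forall>j\<in>{0..N}. \<bar>W j \<omega>\<bar> \<le> L) * cos (t * L) \<le> exp (- u * V N)" by simp
  moreover have "- u * V N = - (1 - e) * t\<^sup>2 / 2 * V N" by (simp add: u_def field_simps)
  ultimately show ?thesis by (simp only:)
qed

text \<open>Adding the constant \<open>- cos \<phi>\<close> to \<open>cos (t * x)\<close> keeps the third-order Taylor error dominated
  even where the cosine vanishes; the interval is correspondingly cut at \<open>\<phi> / t\<close>, slightly
  beyond \<open>pi / (2 * t)\<close>.\<close>

lemma small_ball_lower:
  assumes Z: "bdd_meas (F m) Z" "\<And>\<omega>. \<omega> \<in> space M \<Longrightarrow> 0 \<le> Z \<omega>"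
    and \<phi>: "pi / 2 < \<phi>" "\<phi> < pi"
    and t: "0 < t" "0 \<le> d" "t * d \<le> - 3 * cos \<phi>" "t * d \<le> 2 * pi - 2 * \<phi>" "(t * d)\<^sup>2 \<le> e" "e \<le> 1"
    and "m \<le> n" and bD: "\<And>k \<omega>. k < n \<Longrightarrow> \<omega> \<in> space M \<Longrightarrow> \<bar>D k \<omega>\<bar> \<le> d"
  shows "exp (- (1 + e) * t\<^sup>2 / 2 * (V n - V m)) * expectation Z
    \<le> expectation (\<lambda>\<omega>. Z \<omega> * of_bool (\<forall>j\<in>{m..n}. \<bar>W j \<omega> - W m \<omega>\<bar> \<le> \<phi> / t))"
proof -
  define \<kappa> where "\<kappa> = - cos \<phi>"
  define L where "L = \<phi> / t"
  define u where "u = (1 + e) * t\<^sup>2 / 2"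
  define f where "f = (\<lambda>x. cos (t * x) + \<kappa>)"
  define J :: "nat \<Rightarrow> 'a \<Rightarrow> real" where "J = (\<lambda>n \<omega>. of_bool (\<forall>j\<in>{m..n}. \<bar>W j \<omega> - W m \<omega>\<bar> \<le> L))"
  have \<kappa>: "0 < \<kappa>" using \<phi> cos_monotone_0_pi[of "pi / 2" \<phi>] by (simp add: \<kappa>_def)
  have e: "0 \<le> e" using t(5) by (rule order_trans[OF zero_le_power2])
  have JF: "bdd_meas (F n) (J n)" for n unfolding J_def by (intro bdd_meas_of_bool pred_W_diff_le)
  have JM: "bdd_meas M (J n)" for n using JF bdd_meas_F by blast
  have ZM: "bdd_meas M Z" using Z(1) by (rule bdd_meas_F)
  have fW: "bdd_meas (F n) (\<lambda>\<omega>. f (W n \<omega> - W m \<omega>))" if "m \<le> n" for n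
    unfolding f_def using that by (intro bdd_meas_intros bdd_meas_W) auto
  have fM: "bdd_meas M (\<lambda>\<omega>. f (W n \<omega> - W m \<omega>))" for n
    unfolding f_def by (intro bdd_meas_intros bdd_meas_W_M)
  have f_nonneg: "0 \<le> f x" if "\<bar>x\<bar> \<le> L" for x
  proof -
    have "t * \<bar>x\<bar> \<le> \<phi>" using that t(1) by (simp add: L_def field_simps)
    then have "cos \<phi> \<le> cos (t * \<bar>x\<bar>)" using \<phi> t(1) by (intro cos_monotone_0_pi_le) auto
    also have "cos (t * \<bar>x\<bar>) = cos (t * x)" using t(1) by (metis abs_mult abs_of_pos cos_abs_real)
    finally show ?thesis by (simp add: f_def \<kappa>_def)
  qed
  \<comment> \<open>Here \<open>f\<close> must not be positive where a path first lands outside, so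
    that dropping such paths can only raise the expectation. The landing point is at most
    \<open>d\<close> beyond \<open>L\<close>, hence by
    \<open>t * d \<le> 2 * pi - 2 * \<phi>\<close> its angle lies between \<phi> and
    \<open>2 * pi - \<phi>\<close>.\<close>
  have f_nonpos: "f x \<le> 0" if "L < \<bar>x\<bar>" "\<bar>x\<bar> \<le> L + d" for x
  proof -
    have 1: "\<phi> \<le> t * \<bar>x\<bar>" using that t(1) by (simp add: L_def field_simps)
    have "t * \<bar>x\<bar> \<le> t * (L + d)" using that t(1) by (intro mult_left_mono) auto
    also have "\<dots> = \<phi> + t * d" using t(1) by (simp add: L_def field_simps)
    finally have 2: "t * \<bar>x\<bar> \<le> 2 * pi - \<phi>" using t(4) by simp
    have "cos (t * \<bar>x\<bar>) \<le> cos \<phi>"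
    proof (cases "t * \<bar>x\<bar> \<le> pi")
      case True
      then show ?thesis using 1 \<phi> by (intro cos_monotone_0_pi_le) auto
    next
      case False
      have "cos (2 * pi - t * \<bar>x\<bar>) \<le> cos \<phi>" using 2 False \<phi> by (intro cos_monotone_0_pi_le) auto
      then show ?thesis by (simp add: cos_diff)
    qed
    also have "cos (t * \<bar>x\<bar>) = cos (t * x)" using t(1) by (metis abs_mult abs_of_pos cos_abs_real)
    finally show ?thesis by (simp add: f_def \<kappa>_def)
  qed
  \<comment> \<open>The factor \<open>1 + \<kappa>\<close> is the value of \<open>f\<close> at 0,
    where the induction starts. It is also the maximum of \<open>f\<close> and cancels when
    \<open>f\<close> is bounded by it at the end.\<close>
  have "exp (- u * (V n - V m)) * ((1 + \<kappa>) * expectation Z)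
      \<le> expectation (\<lambda>\<omega>. Z \<omega> * (J n \<omega> * f (W n \<omega> - W m \<omega>)))"
    using \<open>m \<le> n\<close> bD
  proof (induction n rule: dec_induct)
    case base
    have "0 \<le> L" using \<phi> t(1) by (simp add: L_def)
    then show ?case by (simp add: J_def f_def mult.commute)
  next
    case (step n)
    define Y where "Y = (\<lambda>\<omega>. Z \<omega> * (J n \<omega> * f (W n \<omega> - W m \<omega>)))"
    have Y: "bdd_meas (F n) Y" unfolding Y_def
      using step.hyps by (intro bdd_meas_intros fW JF bdd_meas_F_mono[OF Z(1)]) auto
    have Y0: "0 \<le> Y \<omega>" if "\<omega> \<in> space M" for \<omega>
      using Z(2)[OF that] f_nonneg[of "W n \<omega> - W m \<omega>"] step.hyps by (auto simp: Y_def J_def)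
    have EY: "0 \<le> expectation Y" using Y0 by (intro integral_nonneg_AE) auto
    have vd: "v n \<le> d\<^sup>2" using step.prems[of n] by (intro v_le) auto
    define x where "x = t\<^sup>2 / 2 * v n"
    have x0: "0 \<le> x" using v_nonneg by (simp add: x_def)
    have "2 * x \<le> (t * d)\<^sup>2" using vd by (simp add: x_def power_mult_distrib mult_left_mono)
    then have xe: "2 * x \<le> e" using t(5) by simp
    \<comment> \<open>The step factor \<open>1 - x\<close> lies below exp (- x); the surplus
      \<open>e\<close> in \<open>u\<close> pays for the conversion, through ln (1 - x) >= - x - 2
      x^2 and \<open>2 * x \<le> e\<close>.\<close>
    have ux: "exp (- u * v n) \<le> 1 - x"
    proof -
      have "- u * v n = - x - e * x" by (simp add: u_def x_def field_simps)
      also have "\<dots> \<le> - x - 2 * x\<^sup>2"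
        using mult_right_mono[OF xe x0] by (simp add: power2_eq_square)
      also have "\<dots> \<le> ln (1 - x)" using x0 xe t(6) by (intro ln_one_minus_pos_lower_bound) auto
      finally show ?thesis using xe t(6) by (subst (asm) ln_ge_iff) auto
    qed
    have "exp (- u * (V (Suc n) - V m)) * ((1 + \<kappa>) * expectation Z)
       = exp (- u * v n) * (exp (- u * (V n - V m)) * ((1 + \<kappa>) * expectation Z))"
    proof -
      have "- u * (V (Suc n) - V m) = - u * v n + - u * (V n - V m)"
        by (simp add: V_Suc algebra_simps)
      then show ?thesis by (simp only: exp_add mult.assoc)
    qed
    also have "\<dots> \<le> exp (- u * v n) * expectation Y"
      using step unfolding Y_def by (intro mult_left_mono) auto
    also have "\<dots> \<le> (1 - x) * expectation Y" using ux EY by (intro mult_right_mono)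
    also have "\<dots> = expectation Y + v n * expectation (\<lambda>\<omega>. - t\<^sup>2 / 2 * Y \<omega>)"
      by (simp add: x_def algebra_simps)
    also have "\<dots> \<le> expectation (\<lambda>\<omega>. Z \<omega> * (J (Suc n) \<omega> * f (W (Suc n) \<omega> - W m \<omega>)))"
    proof (rule one_step_ge[where ?Z1.0 = "\<lambda>\<omega>. - t * (Z \<omega> * (J n \<omega> * sin (t * (W n \<omega> - W m \<omega>))))"])
      show "bdd_meas M (\<lambda>\<omega>. Z \<omega> * (J (Suc n) \<omega> * f (W (Suc n) \<omega> - W m \<omega>)))"
        by (intro bdd_meas_intros fM JM ZM)
      show "bdd_meas (F n) (\<lambda>\<omega>. - t * (Z \<omega> * (J n \<omega> * sin (t * (W n \<omega> - W m \<omega>)))))"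
        using step.hyps by (intro bdd_meas_intros bdd_meas_W JF bdd_meas_F_mono[OF Z(1)]) auto
      show "bdd_meas (F n) (\<lambda>\<omega>. - t\<^sup>2 / 2 * Y \<omega>)" using Y by (intro bdd_meas_intros)
      fix \<omega> assume \<omega>: "\<omega> \<in> space M"
      define w where "w = W n \<omega> - W m \<omega>"
      have Dd: "\<bar>D n \<omega>\<bar> \<le> d" using step.prems \<omega> by simp
      have "J n \<omega> * (f w - t * sin (t * w) * D n \<omega> - t\<^sup>2 / 2 * f w * (D n \<omega>)\<^sup>2)
          \<le> J (Suc n) \<omega> * f (w + D n \<omega>)"
      proof (cases "\<forall>j\<in>{m..n}. \<bar>W j \<omega> - W m \<omega>\<bar> \<le> L")
        case False
        then have "J n \<omega> = 0" "J (Suc n) \<omega> = 0" by (force simp: J_def)+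
        then show ?thesis by simp
      next
        case True
        then have J: "J n \<omega> = 1" and w: "\<bar>w\<bar> \<le> L" using step.hyps by (auto simp: J_def w_def)
        \<comment> \<open>The second derivative of \<open>f\<close> is
          \<open>- t\<^sup>2 * (f - \<kappa>)\<close>; working with \<open>- t\<^sup>2 * f\<close>
          instead leaves a spare \<kappa> (t D)^2 / 2, independent of the position, into which the
          cubic error fits.\<close>
        have "\<bar>t * D n \<omega>\<bar> ^ 3 / 6 \<le> \<kappa> * (t * D n \<omega>)\<^sup>2 / 2"
        proof -
          have "\<bar>t * D n \<omega>\<bar> \<le> t * d" unfolding abs_mult using Dd t by (auto intro: mult_left_mono)
          then have "\<bar>t * D n \<omega>\<bar> \<le> 3 * \<kappa>" using t(3) by (simp add: \<kappa>_def)
          then have "\<bar>t * D n \<omega>\<bar> * (t * D n \<omega>)\<^sup>2 \<le> 3 * \<kappa> * (t * D n \<omega>)\<^sup>2"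
            by (intro mult_right_mono) auto
          then show ?thesis by (simp add: eval_nat_numeral abs_mult algebra_simps)
        qed
        then have "cos (t * w) - t * D n \<omega> * sin (t * w) - (t * D n \<omega>)\<^sup>2 / 2 * cos (t * w)
            - \<kappa> * (t * D n \<omega>)\<^sup>2 / 2 \<le> cos (t * w + t * D n \<omega>)"
          using cos_taylor2[of "t * w" "t * D n \<omega>"] by linarith
        then have "f w - t * sin (t * w) * D n \<omega> - t\<^sup>2 / 2 * f w * (D n \<omega>)\<^sup>2 \<le> f (w + D n \<omega>)"
          by (simp add: f_def field_simps power2_eq_square)
        also have "\<dots> \<le> J (Suc n) \<omega> * f (w + D n \<omega>)"
        proof (cases "\<bar>w + D n \<omega>\<bar> \<le> L")
          case True': True
          then have "J (Suc n) \<omega> = 1"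
            using True by (auto simp: J_def w_def W_Suc le_Suc_eq algebra_simps)
          then show ?thesis by simp
        next
          case False
          then have "f (w + D n \<omega>) \<le> 0" using w Dd by (intro f_nonpos) auto
          moreover have "J (Suc n) \<omega> = 0"
            using False step.hyps
            by (auto simp: J_def w_def W_Suc algebra_simps intro!: bexI[of _ "Suc n"])
          ultimately show ?thesis by simp
        qed
        finally show ?thesis by (simp add: J)
      qed
      from mult_left_mono[OF this Z(2)[OF \<omega>]]
      show "Y \<omega> + - t * (Z \<omega> * (J n \<omega> * sin (t * (W n \<omega> - W m \<omega>)))) * D n \<omega>
          + - t\<^sup>2 / 2 * Y \<omega> * (D n \<omega>)\<^sup>2 \<le> Z \<omega> * (J (Suc n) \<omega> * f (W (Suc n) \<omega> - W m \<omega>))"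
        by (simp add: Y_def w_def W_Suc algebra_simps)
    qed (use Y in \<open>auto intro!: bdd_meas_intros\<close>)
    finally show ?case .
  qed
  also have "\<dots> \<le> expectation (\<lambda>\<omega>. (1 + \<kappa>) * (Z \<omega> * J n \<omega>))"
  proof (intro integral_mono bdd_meas_integrable bdd_meas_intros ZM JM fM)
    fix \<omega> assume "\<omega> \<in> space M"
    then have "Z \<omega> * J n \<omega> * f (W n \<omega> - W m \<omega>) \<le> Z \<omega> * J n \<omega> * (1 + \<kappa>)"
      using Z(2) by (intro mult_left_mono) (auto simp: f_def J_def)
    then show "Z \<omega> * (J n \<omega> * f (W n \<omega> - W m \<omega>)) \<le> (1 + \<kappa>) * (Z \<omega> * J n \<omega>)"
      by (simp add: algebra_simps)
  qed
  also have "\<dots> = (1 + \<kappa>) * expectation (\<lambda>\<omega>. Z \<omega> * J n \<omega>)"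
    by (rule integral_mult_right_zero)
  finally have "(1 + \<kappa>) * (exp (- u * (V n - V m)) * expectation Z)
      \<le> (1 + \<kappa>) * expectation (\<lambda>\<omega>. Z \<omega> * J n \<omega>)"
    by (simp only: mult.left_commute)
  then have "exp (- u * (V n - V m)) * expectation Z \<le> expectation (\<lambda>\<omega>. Z \<omega> * J n \<omega>)"
    using \<kappa> by (simp only: mult_le_cancel_left_pos add_pos_pos zero_less_one)
  then show ?thesis unfolding u_def J_def L_def by (simp only: mult_minus_left divide_minus_left)
qed

end

section \<open>Probabilities at variance levels\<close>

text \<open>The jump bound is a function of the accumulated variance, taken at
  \<open>V (Suc k)\<close> so that the step's own variance counts. \<open>h_small\<close> makes
  \<open>h x\<close> negligible against sqrt (x / ln (ln x)), the smallest of the three scales; the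
  scales of the central limit theorem and of the iterated logarithm law are larger.\<close>

locale growing_mds = det_var_mds M F D v
  for M :: "'a measure" and F :: "nat \<Rightarrow> 'a measure" and D :: "nat \<Rightarrow> 'a \<Rightarrow> real" and v :: "nat \<Rightarrow> real" +
  fixes h :: "real \<Rightarrow> real"
  assumes V_lim: "filterlim V at_top sequentially"
    and D_le: "\<omega> \<in> space M \<Longrightarrow> \<bar>D k \<omega>\<bar> \<le> h (V (Suc k))"
    and h_mono: "0 \<le> x \<Longrightarrow> x \<le> y \<Longrightarrow> h x \<le> h y"
    and h_nonneg: "0 \<le> x \<Longrightarrow> 0 \<le> h x"
    and h_small: "((\<lambda>x. h x * sqrt (ln (ln x) / x)) \<longlongrightarrow> 0) at_top"
begin

text \<open>A deterministic clock: as the conditional variances are numbers, the time at which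
  variance \<open>x\<close> is used up is not random. For negative \<open>x\<close> the set is empty
  and \<open>Max\<close> gives no information, hence the condition \<open>0 \<le> x\<close>
  below.\<close>

definition N :: "real \<Rightarrow> nat" where "N x = Max {n. V n \<le> x}"

lemma uminus_growing: "growing_mds M F (\<lambda>k \<omega>. - D k \<omega>) v h"
  using V_lim D_le h_mono h_nonneg h_small
  by (intro growing_mds.intro uminus_mds growing_mds_axioms.intro) auto

lemma le_N_iff: "n \<le> N x \<longleftrightarrow> V n \<le> x" if "0 \<le> x"
proof -
  obtain m where m: "\<And>n. m \<le> n \<Longrightarrow> x + 1 \<le> V n"
    using V_lim unfolding filterlim_at_top eventually_sequentially by blast
  have "{n. V n \<le> x} \<subseteq> {..m}"
  proof
    fix n assume "n \<in> {n. V n \<le> x}"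
    with m[of n] show "n \<in> {..m}" by (cases "m \<le> n") auto
  qed
  then have fin: "finite {n. V n \<le> x}" by (rule finite_subset) simp
  have "V 0 \<le> x" using that by simp
  then have "{n. V n \<le> x} \<noteq> {}" by blast
  then have "N x \<in> {n. V n \<le> x}" unfolding N_def using fin by (intro Max_in) auto
  then have "V (N x) \<le> x" by simp
  moreover have "n \<le> N x" if "V n \<le> x" using that fin unfolding N_def by (intro Max_ge) auto
  ultimately show ?thesis using V_mono[of n "N x"] by force
qed

lemma V_N_le: "0 \<le> x \<Longrightarrow> V (N x) \<le> x"
  using le_N_iff by blast

lemma N_mono: "0 \<le> x \<Longrightarrow> x \<le> y \<Longrightarrow> N x \<le> N y"
  using V_N_le[of x] by (subst le_N_iff) auto

lemma D_le_N: "0 \<le> x \<Longrightarrow> k < N x \<Longrightarrow> \<omega> \<in> space M \<Longrightarrow> \<bar>D k \<omega>\<bar> \<le> h x"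
  using D_le[of \<omega> k] h_mono[of "V (Suc k)" x] le_N_iff[of x "Suc k"] V_nonneg by (auto simp: Suc_le_eq)

lemma eventually_h_le:
  assumes "0 < c"
  shows "\<forall>\<^sub>F x in at_top. h x * sqrt (ln (ln x) / x) \<le> c"
  using order_tendstoD(2)[OF h_small assms] by (rule eventually_mono) simp

lemma eventually_h_sq_le:
  assumes "0 < c"
  shows "\<forall>\<^sub>F x in at_top. (h x)\<^sup>2 \<le> c * x"
proof -
  have "\<forall>\<^sub>F x::real in at_top. 1 \<le> ln (ln x)" by real_asymp
  moreover have "\<forall>\<^sub>F x in at_top. h x * sqrt (ln (ln x) / x) \<le> sqrt c"
    using assms by (intro eventually_h_le) auto
  moreover have "\<forall>\<^sub>F x::real in at_top. 0 < x" by (rule eventually_gt_at_top)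
  ultimately show ?thesis
  proof eventually_elim
    case (elim x)
    have "(h x)\<^sup>2 * 1 \<le> (h x)\<^sup>2 * ln (ln x)" using elim by (intro mult_left_mono) auto
    also have "\<dots> = (h x * sqrt (ln (ln x) / x))\<^sup>2 * x"
      using elim by (simp add: power_mult_distrib)
    also have "\<dots> \<le> (sqrt c)\<^sup>2 * x"
      using elim h_nonneg[of x] by (intro mult_right_mono power_mono) auto
    finally show ?case using assms by simp
  qed
qed

text \<open>The clock stops short of \<open>x\<close> by less than one step variance, which is at
  most (h y)^2 at the next level y > x and so a small fraction of y.\<close>

lemma eventually_V_N_ge:
  assumes "0 < e"
  shows "\<forall>\<^sub>F x in at_top. (1 - e) * x \<le> V (N x)"
proof -
  obtain X where X: "\<And>y. X \<le> y \<Longrightarrow> (h y)\<^sup>2 \<le> e * y"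
    using eventually_h_sq_le[OF assms] unfolding eventually_at_top_linorder by blast
  show ?thesis
    using eventually_ge_at_top[of X] eventually_ge_at_top[of 0]
  proof eventually_elim
    case (elim x)
    define y where "y = V (Suc (N x))"
    have "\<not> Suc (N x) \<le> N x" by simp
    then have xy: "x < y" using le_N_iff[OF elim(2)] by (simp add: y_def not_le del: not_less_eq_eq)
    have "v (N x) \<le> (h y)\<^sup>2" unfolding y_def by (rule v_le) (rule D_le)
    also have "\<dots> \<le> e * y" using X xy elim by auto
    finally have "y - e * y \<le> V (N x)" by (simp add: y_def V_Suc)
    show ?case
    proof (cases "e \<le> 1")
      case True
      then have "(1 - e) * x \<le> (1 - e) * y" using xy by (intro mult_left_mono) auto
      with \<open>y - e * y \<le> V (N x)\<close> show ?thesis by (simp add: algebra_simps)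
    next
      case False
      then have "(1 - e) * x \<le> 0" using elim by (intro mult_nonpos_nonneg) auto
      then show ?thesis using V_nonneg[of "N x"] by linarith
    qed
  qed
qed

text \<open>\<open>maximal_ineq\<close> with the optimal parameter: for this threshold y the
  exponent - l y + (1 + e) l^2 x / 2 is minimal at l = sqrt (2 ln (ln x) / x), where it equals - (1
  + e) ln (ln x).\<close>

lemma level_upper:
  assumes e: "0 < e" "e \<le> 1"
  shows "\<forall>\<^sub>F x in at_top. \<P>(\<omega> in M. \<exists>j\<in>{0..N x}. (1 + e) * sqrt (2 * x * ln (ln x)) \<le> W j \<omega>)
    \<le> exp (- (1 + e) * ln (ln x))"
proof -
  have "\<forall>\<^sub>F x in at_top. h x * sqrt (ln (ln x) / x) \<le> e / sqrt 2"
    using e by (intro eventually_h_le) auto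
  moreover have "\<forall>\<^sub>F x::real in at_top. 1 \<le> ln (ln x)" by real_asymp
  moreover have "\<forall>\<^sub>F x::real in at_top. 0 < x" by (rule eventually_gt_at_top)
  ultimately show ?thesis
  proof eventually_elim
    case (elim x)
    define l where "l = sqrt (2 * ln (ln x) / x)"
    define y where "y = (1 + e) * sqrt (2 * x * ln (ln x))"
    have lx: "l * x = sqrt (2 * x * ln (ln x))"
    proof -
      have "l * x = sqrt (2 * ln (ln x) / x) * sqrt (x\<^sup>2)" using elim by (simp add: l_def)
      also have "\<dots> = sqrt (2 * x * ln (ln x))"
        unfolding real_sqrt_mult[symmetric] using elim by (simp add: power2_eq_square)
      finally show ?thesis .
    qed
    have l2: "l\<^sup>2 * x = 2 * ln (ln x)" using elim by (simp add: l_def)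
    have "l * h x = sqrt 2 * (h x * sqrt (ln (ln x) / x))"
      by (simp add: l_def real_sqrt_mult real_sqrt_divide)
    also have "\<dots> \<le> sqrt 2 * (e / sqrt 2)" using elim by (intro mult_left_mono) auto
    finally have lh: "l * h x \<le> e" by simp
    have "\<P>(\<omega> in M. \<exists>j\<in>{0..N x}. y \<le> W j \<omega>) \<le> exp (- l * y + (1 + e) * l\<^sup>2 / 2 * V (N x))"
      using elim e lh by (intro maximal_ineq[where d = "h x"] D_le_N) (auto simp: l_def y_def)
    also have "\<dots> \<le> exp (- (1 + e) * ln (ln x))"
    proof -
      have "(1 + e) * l\<^sup>2 / 2 * V (N x) \<le> (1 + e) * l\<^sup>2 / 2 * x"
        using e elim V_N_le[of x] by (intro mult_left_mono) auto
      also have "\<dots> = (1 + e) * ln (ln x)" using l2 by (simp add: field_simps)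
      finally have 1: "(1 + e) * l\<^sup>2 / 2 * V (N x) \<le> (1 + e) * ln (ln x)" .
      have "l * y = (1 + e) * (l\<^sup>2 * x)" by (simp add: y_def lx[symmetric] power2_eq_square)
      then have "l * y = 2 * ((1 + e) * ln (ln x))" by (simp add: l2)
      with 1 have "- l * y + (1 + e) * l\<^sup>2 / 2 * V (N x) \<le> - ((1 + e) * ln (ln x))" by simp
      then show ?thesis by (simp only: mult_minus_left exp_le_cancel_iff)
    qed
    finally show ?case by (simp add: y_def)
  qed
qed

text \<open>The frequency is chosen with \<open>t * L = (1 - e / 4) * (pi / 2)\<close>: near enough
  to the zero of the cosine for an almost optimal rate, far enough for \<open>cos (t * L)\<close> to
  be a positive constant, whose inverse is \<open>C\<close>. Shrinking the ball by
  \<open>1 - e\<close> pushes the exponent beyond 1, which gives summability along geometric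
  levels.\<close>

lemma level_small_ball_upper:
  assumes e: "0 < e" "e < 1"
  shows "\<exists>C. \<forall>\<^sub>F x in at_top.
    \<P>(\<omega> in M. \<forall>j\<in>{0..N x}. \<bar>W j \<omega>\<bar> \<le> (1 - e) * (pi / sqrt 8) * sqrt (x / ln (ln x)))
    \<le> C * exp (- (1 + e) * ln (ln x))"
proof -
  define c where "c = cos ((1 - e / 4) * (pi / 2))"
  define q where "q = (1 - e / 4) / (1 - e)"
  have q: "0 < q" using e by (simp add: q_def)
  have c: "0 < c" unfolding c_def using e by (intro cos_gt_zero_pi) (auto intro: less_le_trans[of _ 0] mult_pos_pos)
  \<comment> \<open>The two bounds that \<open>small_ball_upper\<close> puts on
    \<open>t * d\<close>: room up to pi / 2, and domination of the cubic error.\<close>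
  define b where "b = min (e / 4 * (pi / 2)) (3 * (e / 4) * c)"
  have b: "0 < b" using c e by (simp add: b_def)
  have "\<forall>\<^sub>F x in at_top. h x * sqrt (ln (ln x) / x) \<le> b / (q * sqrt 2)"
    using b q by (intro eventually_h_le) auto
  moreover have "\<forall>\<^sub>F x in at_top. (1 - e / 4) * x \<le> V (N x)"
    using e by (intro eventually_V_N_ge) auto
  moreover have "\<forall>\<^sub>F x::real in at_top. 1 \<le> ln (ln x)" by real_asymp
  moreover have "\<forall>\<^sub>F x::real in at_top. 0 < x" by (rule eventually_gt_at_top)
  ultimately have "\<forall>\<^sub>F x in at_top.
    \<P>(\<omega> in M. \<forall>j\<in>{0..N x}. \<bar>W j \<omega>\<bar> \<le> (1 - e) * (pi / sqrt 8) * sqrt (x / ln (ln x)))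
    \<le> 1 / c * exp (- (1 + e) * ln (ln x))"
  proof eventually_elim
    case (elim x)
    define t where "t = q * sqrt 2 * sqrt (ln (ln x) / x)"
    define L where "L = (1 - e) * (pi / sqrt 8) * sqrt (x / ln (ln x))"
    have t0: "0 < t" using elim q by (simp add: t_def)
    have L0: "0 \<le> L" using elim e by (simp add: L_def)
    have h0: "0 \<le> h x" using h_nonneg elim by auto
    have tL: "t * L = (1 - e / 4) * (pi / 2)"
    proof -
      have "sqrt (ln (ln x) / x) * sqrt (x / ln (ln x)) = 1"
        unfolding real_sqrt_mult[symmetric] using elim by simp
      moreover have "sqrt 8 = 2 * sqrt (2::real)" using real_sqrt_mult[of 4 2] by simp
      ultimately show ?thesis using e by (simp add: t_def L_def q_def field_simps)
    qed
    have "t * h x = q * sqrt 2 * (h x * sqrt (ln (ln x) / x))" by (simp add: t_def)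
    also have "\<dots> \<le> q * sqrt 2 * (b / (q * sqrt 2))" using elim q by (intro mult_left_mono) auto
    also have "\<dots> = b" using q by simp
    finally have th: "t * h x \<le> b" .
    have "\<P>(\<omega> in M. \<forall>j\<in>{0..N x}. \<bar>W j \<omega>\<bar> \<le> L) * cos (t * L)
        \<le> exp (- (1 - e / 4) * t\<^sup>2 / 2 * V (N x))"
    proof (rule small_ball_upper[where d = "h x", OF t0 L0 h0])
      show "t * (L + h x) \<le> pi / 2" using th unfolding b_def distrib_left tL by (simp add: algebra_simps)
      show "t * h x \<le> 3 * (e / 4) * cos (t * L)" using th by (simp add: tL b_def c_def)
      show "0 < cos (t * L)" using c by (simp add: tL c_def)
    qed (use e elim in \<open>auto intro: D_le_N\<close>)
    also have "\<dots> \<le> exp (- (1 + e) * ln (ln x))"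
    proof -
      have t2: "t\<^sup>2 / 2 * x = q\<^sup>2 * ln (ln x)" using elim by (simp add: t_def power_mult_distrib)
      have "(1 - e / 4) * t\<^sup>2 / 2 * ((1 - e / 4) * x) \<le> (1 - e / 4) * t\<^sup>2 / 2 * V (N x)"
        using elim e by (intro mult_left_mono) auto
      also have "(1 - e / 4) * t\<^sup>2 / 2 * ((1 - e / 4) * x) = (1 - e / 4)\<^sup>2 * (t\<^sup>2 / 2 * x)"
        by (simp add: power2_eq_square)
      also have "\<dots> = ((1 - e / 4)\<^sup>2 * q\<^sup>2) * ln (ln x)" by (simp only: t2 mult.assoc)
      finally have 1: "((1 - e / 4)\<^sup>2 * q\<^sup>2) * ln (ln x) \<le> (1 - e / 4) * t\<^sup>2 / 2 * V (N x)" .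
      have "1 + e \<le> (1 - e / 4)\<^sup>2 * q\<^sup>2"
      proof -
        \<comment> \<open>Bernoulli explains the quarter: \<open>q\<^sup>2\<close> and the two
          losses \<open>1 - e / 4\<close>, one from the Taylor error and one from
          \<open>V (N x)\<close> against \<open>x\<close>, combine to the fourth power of
          \<open>1 - e / 4\<close> over \<open>(1 - e)\<^sup>2\<close>.\<close>
        have "1 - e \<le> (1 - e / 4) ^ 4" using Bernoulli_inequality[of "- (e / 4)" 4] e by simp
        then have "(1 - e) * (1 + e) \<le> (1 - e / 4) ^ 4 * (1 / (1 - e))"
        proof -
          have "(1 - e) * (1 + e) \<le> 1" by (simp add: algebra_simps)
          also have "1 \<le> (1 - e / 4) ^ 4 * (1 / (1 - e))"
            using \<open>1 - e \<le> (1 - e / 4) ^ 4\<close> e by (simp add: field_simps)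
          finally show ?thesis .
        qed
        also have "\<dots> = (1 - e) * ((1 - e / 4)\<^sup>2 * q\<^sup>2)"
          using e by (simp add: q_def power_divide eval_nat_numeral)
        finally show ?thesis using e by simp
      qed
      from mult_right_mono[OF this, of "ln (ln x)"] elim 1
      have "(1 + e) * ln (ln x) \<le> (1 - e / 4) * t\<^sup>2 / 2 * V (N x)" by linarith
      then show ?thesis by (simp only: mult_minus_left divide_minus_left neg_le_iff_le exp_le_cancel_iff)
    qed
    finally show ?case
      using c unfolding tL c_def[symmetric] L_def[symmetric] by (simp add: pos_le_divide_eq)
  qed
  then show ?thesis by blast
qed

lemma prob_Int_expectation:
  assumes "A \<in> events" "Measurable.pred M P"
  shows "prob {\<omega> \<in> A. P \<omega>} = expectation (\<lambda>\<omega>. indicator A \<omega> * of_bool (P \<omega>))"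
proof -
  have [measurable]: "A \<in> events" "Measurable.pred M P" using assms by auto
  have "expectation (\<lambda>\<omega>. indicat_real A \<omega> * of_bool (P \<omega>)) = expectation (indicator {\<omega> \<in> A. P \<omega>})"
    by (intro Bochner_Integration.integral_cong) (auto simp: indicator_def)
  also have "\<dots> = prob {\<omega> \<in> A. P \<omega>}"
  proof -
    have "{\<omega> \<in> A. P \<omega>} = {\<omega> \<in> space M. \<omega> \<in> A \<and> P \<omega>}" using sets.sets_into_space[OF assms(1)] by auto
    then have "{\<omega> \<in> A. P \<omega>} \<in> events" by simp
    then show ?thesis by simp
  qed
  finally show ?thesis by simp
qed

text \<open>Quantifying over all past events \<open>A\<close> is what the conditional Borel-Cantelli
  argument needs. The tilt is shortened by \<open>c = 1 - 4 * g\<close>, so that the cost (1 + 4 g)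
  c^2 ln (ln x) is at most (1 - 4 g) ln (ln x), with a factor below 1; the threshold pays with (1 -
  g) (1 - 2 g) (1 - 4 g), which is at least 1 - 7 g.\<close>

lemma level_lower:
  assumes g: "0 < g" "g < 1 / 8"
  shows "\<forall>\<^sub>F x in at_top. \<forall>y A. 0 \<le> y \<longrightarrow> y \<le> g * x \<longrightarrow> A \<in> sets (F (N y)) \<longrightarrow>
    exp (- (1 - 4 * g) * ln (ln x)) * prob A
    \<le> prob {\<omega> \<in> A. (1 - 7 * g) * sqrt (2 * x * ln (ln x)) \<le> W (N x) \<omega> - W (N y) \<omega>}"
proof -
  define c where "c = 1 - 4 * g"
  have c: "0 < c" "c < 1" using g by (auto simp: c_def)
  have "\<forall>\<^sub>F x in at_top. h x * sqrt (ln (ln x) / x) \<le> g\<^sup>2 / 16 / (2 * c * sqrt 2)"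
    using g c by (intro eventually_h_le) auto
  moreover have "\<forall>\<^sub>F x in at_top. (1 - g) * x \<le> V (N x)"
    using g by (intro eventually_V_N_ge) auto
  moreover have "\<forall>\<^sub>F x::real in at_top. 16 / (g\<^sup>2 * c\<^sup>2 * 2 * (1 - 2 * g)) \<le> ln (ln x)" by real_asymp
  moreover have "\<forall>\<^sub>F x::real in at_top. 1 \<le> ln (ln x)" by real_asymp
  moreover have "\<forall>\<^sub>F x::real in at_top. 0 < x" by (rule eventually_gt_at_top)
  ultimately show ?thesis
  proof eventually_elim
    case (elim x)
    show ?case
    proof (intro allI impI)
      fix y A assume y: "0 \<le> y" "y \<le> g * x" and A: "A \<in> sets (F (N y))"
      define l where "l = c * sqrt 2 * sqrt (ln (ln x) / x)"
      define U where "U = V (N x) - V (N y)"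
      have AM: "A \<in> events" using A by (rule sets_F)
      have "g * x \<le> 1 * x" using g elim by (intro mult_right_mono) auto
      then have NN: "N y \<le> N x" using y by (intro N_mono) auto
      have l0: "0 \<le> l" using c elim by (simp add: l_def)
      have U1: "U \<le> x" using V_N_le[of x] V_nonneg[of "N y"] elim by (simp add: U_def)
      \<comment> \<open>One \<open>g\<close> is lost because \<open>V (N x)\<close> may fall short
        of \<open>x\<close>, the other because the block starts at variance up to
        \<open>g * x\<close>.\<close>
      have U2: "(1 - 2 * g) * x \<le> U" using elim y V_N_le[of y] by (simp add: U_def algebra_simps)
      have l2: "l\<^sup>2 * x = 2 * c\<^sup>2 * ln (ln x)" using elim by (simp add: l_def power_mult_distrib)
      have lx: "l * x = c * sqrt (2 * x * ln (ln x))"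
      proof -
        have "l * x = c * (sqrt 2 * sqrt (ln (ln x) / x) * sqrt (x\<^sup>2))"
          using elim by (simp add: l_def)
        also have "\<dots> = c * sqrt (2 * x * ln (ln x))"
          unfolding real_sqrt_mult[symmetric] using elim by (simp add: power2_eq_square)
        finally show ?thesis .
      qed
      define P where "P = (\<lambda>\<omega>. (1 - g) * l * U \<le> W (N x) \<omega> - W (N y) \<omega>)"
      have P: "Measurable.pred M P" unfolding P_def by measurable
      have "exp (- (1 - 4 * g) * ln (ln x)) * prob A \<le> exp (- (1 + 4 * g) * l\<^sup>2 / 2 * U) * prob A"
      proof (intro mult_right_mono exp_le_cancel_iff[THEN iffD2])
        have "(1 + 4 * g) * l\<^sup>2 / 2 * U \<le> (1 + 4 * g) * l\<^sup>2 / 2 * x"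
          using U1 g by (intro mult_left_mono) auto
        also have "\<dots> = (1 + 4 * g) / 2 * (l\<^sup>2 * x)" by simp
        also have "\<dots> = (1 + 4 * g) * (1 - 4 * g) * ((1 - 4 * g) * ln (ln x))"
          unfolding l2 by (simp add: c_def power2_eq_square)
        also have "\<dots> \<le> 1 * ((1 - 4 * g) * ln (ln x))"
          using g elim by (intro mult_right_mono) (auto simp: algebra_simps)
        finally show "- (1 - 4 * g) * ln (ln x) \<le> - (1 + 4 * g) * l\<^sup>2 / 2 * U"
          by linarith
      qed simp
      also have "\<dots> = exp (- (1 + 4 * g) * l\<^sup>2 / 2 * U) * expectation (indicator A)"
        using AM by simp
      also have "\<dots> \<le> expectation (\<lambda>\<omega>. indicator A \<omega> * of_bool (P \<omega>))"
        unfolding U_def P_def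
      proof (rule lower_tail[where d = "h x"])
        show "bdd_meas (F (N y)) (indicator A)" using A by (rule bdd_meas_indicator)
        have "2 * l * h x = 2 * c * sqrt 2 * (h x * sqrt (ln (ln x) / x))" by (simp add: l_def)
        also have "\<dots> \<le> 2 * c * sqrt 2 * (g\<^sup>2 / 16 / (2 * c * sqrt 2))"
          using elim c by (intro mult_left_mono) auto
        also have "\<dots> = g\<^sup>2 / 16" using c by simp
        finally show "2 * l * h x \<le> g\<^sup>2 / 16" .
        have "16 = (g\<^sup>2 * c\<^sup>2 * 2 * (1 - 2 * g)) * (16 / (g\<^sup>2 * c\<^sup>2 * 2 * (1 - 2 * g)))"
          using g c by simp
        also have "\<dots> \<le> (g\<^sup>2 * c\<^sup>2 * 2 * (1 - 2 * g)) * ln (ln x)"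
          using elim g by (intro mult_left_mono) auto
        also have "\<dots> = g\<^sup>2 * l\<^sup>2 * ((1 - 2 * g) * x)" using l2 by (simp add: algebra_simps)
        also have "\<dots> \<le> g\<^sup>2 * l\<^sup>2 * U" using U2 by (intro mult_left_mono) auto
        finally show "16 \<le> g\<^sup>2 * l\<^sup>2 * (V (N x) - V (N y))" by (simp add: U_def)
      qed (use g l0 NN elim h_nonneg[of x] in \<open>auto intro: D_le_N\<close>)
      also have "\<dots> = prob {\<omega> \<in> A. P \<omega>}" using AM P by (simp add: prob_Int_expectation)
      also have "\<dots> \<le> prob {\<omega> \<in> A. (1 - 7 * g) * sqrt (2 * x * ln (ln x)) \<le> W (N x) \<omega> - W (N y) \<omega>}"
      proof (rule finite_measure_mono)
        have "(1 - 7 * g) * sqrt (2 * x * ln (ln x)) \<le> ((1 - g) * (1 - 2 * g) * c) * sqrt (2 * x * ln (ln x))"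
        proof (rule mult_right_mono)
          have "(1 - g) * (1 - 2 * g) * c = 1 - 7 * g + 2 * g * g * (7 - 4 * g)"
            by (simp add: c_def algebra_simps)
          moreover have "0 \<le> 2 * g * g * (7 - 4 * g)" using g by (intro mult_nonneg_nonneg) auto
          ultimately show "1 - 7 * g \<le> (1 - g) * (1 - 2 * g) * c" by linarith
        qed (use elim in auto)
        also have "\<dots> = (1 - g) * (1 - 2 * g) * (l * x)" by (simp add: lx)
        also have "\<dots> = (1 - g) * l * ((1 - 2 * g) * x)" by (simp only: mult_ac)
        also have "\<dots> \<le> (1 - g) * l * U" using U2 g l0 by (intro mult_left_mono) auto
        finally show "{\<omega> \<in> A. P \<omega>}
            \<subseteq> {\<omega> \<in> A. (1 - 7 * g) * sqrt (2 * x * ln (ln x)) \<le> W (N x) \<omega> - W (N y) \<omega>}"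
          by (auto simp: P_def)
        have "{\<omega> \<in> A. (1 - 7 * g) * sqrt (2 * x * ln (ln x)) \<le> W (N x) \<omega> - W (N y) \<omega>}
            = A \<inter> {\<omega> \<in> space M. (1 - 7 * g) * sqrt (2 * x * ln (ln x)) \<le> W (N x) \<omega> - W (N y) \<omega>}"
          using sets.sets_into_space[OF AM] by auto
        also have "\<dots> \<in> events" using AM by measurable
        finally show "{\<omega> \<in> A. (1 - 7 * g) * sqrt (2 * x * ln (ln x)) \<le> W (N x) \<omega> - W (N y) \<omega>} \<in> events" .
      qed
      finally show "exp (- (1 - 4 * g) * ln (ln x)) * prob A
        \<le> prob {\<omega> \<in> A. (1 - 7 * g) * sqrt (2 * x * ln (ln x)) \<le> W (N x) \<omega> - W (N y) \<omega>}" .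
    qed
  qed
qed

text \<open>The frequency now satisfies \<open>t * L = \<phi>\<close>, slightly beyond pi / 2 as
  \<open>small_ball_lower\<close> requires. The block may start anywhere up to \<open>x\<close>,
  since a shorter block only makes it easier to stay in the ball. Enlarging the radius by
  \<open>1 + g\<close> brings the exponent down to \<open>1 - g / 2\<close>.\<close>

lemma level_small_ball_lower:
  assumes g: "0 < g" "g \<le> 1"
  shows "\<forall>\<^sub>F x in at_top. \<forall>y A. 0 \<le> y \<longrightarrow> y \<le> x \<longrightarrow> A \<in> sets (F (N y)) \<longrightarrow>
    exp (- (1 - g / 2) * ln (ln x)) * prob A
    \<le> prob {\<omega> \<in> A. \<forall>j\<in>{N y..N x}. \<bar>W j \<omega> - W (N y) \<omega>\<bar> \<le> (1 + g) * (pi / sqrt 8) * sqrt (x / ln (ln x))}"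
proof -
  define \<phi> where "\<phi> = (1 + g / 4) * (pi / 2)"
  define q where "q = (1 + g / 4) / (1 + g)"
  have q: "0 < q" using g by (simp add: q_def)
  have \<phi>: "pi / 2 < \<phi>" "\<phi> < pi" using g by (simp_all add: \<phi>_def)
  have c: "cos \<phi> < 0" using \<phi> cos_monotone_0_pi[of "pi / 2" \<phi>] by simp
  define b where "b = min (min (- 3 * cos \<phi>) (2 * pi - 2 * \<phi>)) (sqrt (g / 4))"
  have b: "0 < b" using c g \<phi> by (simp add: b_def)
  have "\<forall>\<^sub>F x in at_top. h x * sqrt (ln (ln x) / x) \<le> b / (q * sqrt 2)"
    using b q by (intro eventually_h_le) auto
  moreover have "\<forall>\<^sub>F x::real in at_top. 1 \<le> ln (ln x)" by real_asymp
  moreover have "\<forall>\<^sub>F x::real in at_top. 0 < x" by (rule eventually_gt_at_top)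
  ultimately show ?thesis
  proof eventually_elim
    case (elim x)
    show ?case
    proof (intro allI impI)
      fix y A assume y: "0 \<le> y" "y \<le> x" and A: "A \<in> sets (F (N y))"
      define t where "t = q * sqrt 2 * sqrt (ln (ln x) / x)"
      define U where "U = V (N x) - V (N y)"
      define L where "L = (1 + g) * (pi / sqrt 8) * sqrt (x / ln (ln x))"
      have AM: "A \<in> events" using A by (rule sets_F)
      have NN: "N y \<le> N x" using y by (intro N_mono) auto
      have t0: "0 < t" using elim q by (simp add: t_def)
      have h0: "0 \<le> h x" using h_nonneg elim by auto
      have U1: "U \<le> x" using V_N_le[of x] V_nonneg[of "N y"] elim by (simp add: U_def)
      have t2: "t\<^sup>2 / 2 * x = q\<^sup>2 * ln (ln x)" using elim by (simp add: t_def power_mult_distrib)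
      have tL: "t * L = \<phi>"
      proof -
        have "sqrt (ln (ln x) / x) * sqrt (x / ln (ln x)) = 1"
          unfolding real_sqrt_mult[symmetric] using elim by simp
        moreover have "sqrt 8 = 2 * sqrt (2::real)" using real_sqrt_mult[of 4 2] by simp
        then have "sqrt 2 * (pi / sqrt 8) = pi / 2" by simp
        moreover have "q * (1 + g) = 1 + g / 4" using g by (simp add: q_def)
        moreover have "t * L = (q * (1 + g)) * (sqrt 2 * (pi / sqrt 8))
            * (sqrt (ln (ln x) / x) * sqrt (x / ln (ln x)))"
          by (simp only: t_def L_def mult.assoc mult.left_commute mult.commute)
        ultimately show ?thesis by (simp only: \<phi>_def mult_1_right)
      qed
      then have L: "\<phi> / t = L" using t0 by (simp add: field_simps)
      have "t * h x = q * sqrt 2 * (h x * sqrt (ln (ln x) / x))" by (simp add: t_def)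
      also have "\<dots> \<le> q * sqrt 2 * (b / (q * sqrt 2))" using elim q by (intro mult_left_mono) auto
      also have "\<dots> = b" using q by simp
      finally have th: "t * h x \<le> b" .
      define P where "P = (\<lambda>\<omega>. \<forall>j\<in>{N y..N x}. \<bar>W j \<omega> - W (N y) \<omega>\<bar> \<le> L)"
      have P: "Measurable.pred M P" unfolding P_def by measurable
      have "exp (- (1 - g / 2) * ln (ln x)) * prob A \<le> exp (- (1 + g / 4) * t\<^sup>2 / 2 * U) * prob A"
      proof (intro mult_right_mono exp_le_cancel_iff[THEN iffD2])
        have "(1 + g / 4) * t\<^sup>2 / 2 * U \<le> (1 + g / 4) * t\<^sup>2 / 2 * x"
          using U1 g by (intro mult_left_mono) auto
        also have "\<dots> = (1 + g / 4) * (t\<^sup>2 / 2 * x)" by simp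
        also have "\<dots> = ((1 + g / 4) * q\<^sup>2) * ln (ln x)" by (simp only: t2 mult.assoc)
        also have "\<dots> \<le> (1 - g / 2) * ln (ln x)"
        proof (rule mult_right_mono)
          have "(1 + g / 4) ^ 3 \<le> 1 + g"
          proof -
            define r where "r = g / 4"
            have r: "0 \<le> r" "r \<le> 1 / 4" using g by (auto simp: r_def)
            have r2: "r * r \<le> r * (1 / 4)" using r by (intro mult_left_mono)
            have "r * (r * r) \<le> r * (1 / 4)" using r r2 by (intro mult_left_mono) auto
            moreover have "(1 + r) ^ 3 = 1 + 3 * r + 3 * (r * r) + r * (r * r)"
              by (simp add: power3_eq_cube algebra_simps)
            ultimately have "(1 + r) ^ 3 \<le> 1 + 4 * r" using r r2 by linarith
            then show ?thesis by (simp add: r_def)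
          qed
          moreover have "1 + g \<le> (1 - g / 2) * (1 + g)\<^sup>2"
          proof -
            have "(1 - g / 2) * (1 + g)\<^sup>2 - (1 + g) = (1 + g) * (g / 2 * (1 - g))"
              by (simp add: power2_eq_square field_simps)
            moreover have "0 \<le> (1 + g) * (g / 2 * (1 - g))" using g by (intro mult_nonneg_nonneg) auto
            ultimately show ?thesis by linarith
          qed
          ultimately have "(1 + g / 4) ^ 3 \<le> (1 - g / 2) * (1 + g)\<^sup>2" by linarith
          moreover have "(1 + g / 4) * q\<^sup>2 = (1 + g / 4) ^ 3 / (1 + g)\<^sup>2"
            by (simp add: q_def power_divide eval_nat_numeral)
          ultimately show "(1 + g / 4) * q\<^sup>2 \<le> 1 - g / 2" using g by (simp add: divide_le_eq)
        qed (use elim in auto)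
        finally show "- (1 - g / 2) * ln (ln x) \<le> - (1 + g / 4) * t\<^sup>2 / 2 * U"
          by linarith
      qed simp
      also have "\<dots> = exp (- (1 + g / 4) * t\<^sup>2 / 2 * U) * expectation (indicator A)"
        using AM by simp
      also have "\<dots> \<le> expectation (\<lambda>\<omega>. indicator A \<omega> * of_bool (P \<omega>))"
        unfolding U_def P_def L[symmetric]
      proof (rule small_ball_lower[where d = "h x"])
        show "bdd_meas (F (N y)) (indicator A)" using A by (rule bdd_meas_indicator)
        have "(t * h x)\<^sup>2 \<le> (sqrt (g / 4))\<^sup>2" using th t0 h0 by (intro power_mono) (auto simp: b_def)
        then show "(t * h x)\<^sup>2 \<le> g / 4" using g by simp
      qed (use g t0 h0 NN elim \<phi> th in \<open>auto simp: b_def intro: D_le_N\<close>)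
      also have "\<dots> = prob {\<omega> \<in> A. P \<omega>}" using AM P by (simp add: prob_Int_expectation)
      finally show "exp (- (1 - g / 2) * ln (ln x)) * prob A
        \<le> prob {\<omega> \<in> A. \<forall>j\<in>{N y..N x}. \<bar>W j \<omega> - W (N y) \<omega>\<bar> \<le> (1 + g) * (pi / sqrt 8) * sqrt (x / ln (ln x))}"
        by (simp add: P_def L_def)
    qed
  qed
qed

end

section \<open>Borel-Cantelli arguments\<close>

definition lil_norm :: "real \<Rightarrow> real" where "lil_norm x = sqrt (2 * x * ln (ln x))"
definition chung_norm :: "real \<Rightarrow> real" where "chung_norm x = sqrt (x / ln (ln x))"

lemma eventually_lnln_ge: "\<forall>\<^sub>F x::real in at_top. c \<le> ln (ln x)"
  by real_asymp

lemma filterlim_eventually: "filterlim f G E \<Longrightarrow> eventually P G \<Longrightarrow> eventually (\<lambda>x. P (f x)) E"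
  by (auto simp: filterlim_iff)

lemma frequently_filterlim:
  assumes "\<exists>\<^sub>F x in E. P (f x)" "filterlim f G E"
  shows "\<exists>\<^sub>F y in G. P y"
  using assms filterlim_eventually[of f G E "\<lambda>y. \<not> P y"] unfolding frequently_def by blast

lemma lil_norm_nonneg: "0 \<le> x \<Longrightarrow> 0 \<le> ln (ln x) \<Longrightarrow> 0 \<le> lil_norm x"
  by (simp add: lil_norm_def)

lemma chung_norm_nonneg: "0 \<le> x \<Longrightarrow> 0 \<le> ln (ln x) \<Longrightarrow> 0 \<le> chung_norm x"
  by (simp add: chung_norm_def)

lemma lnln_mono: "1 < x \<Longrightarrow> x \<le> y \<Longrightarrow> ln (ln x) \<le> ln (ln (y::real))"
  by (simp add: ln_mono)

lemma lil_norm_mono: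
  assumes "1 < x" "x \<le> y" "0 \<le> ln (ln x)"
  shows "lil_norm x \<le> lil_norm y"
proof -
  have "2 * x * ln (ln x) \<le> 2 * y * ln (ln y)"
    using assms lnln_mono[of x y] by (intro mult_mono) auto
  then show ?thesis by (simp add: lil_norm_def)
qed

lemma eventually_lil_norm_scale:
  assumes "1 < q"
  shows "\<forall>\<^sub>F x in at_top. lil_norm (q * x) \<le> q * lil_norm x"
proof -
  have "\<forall>\<^sub>F x in at_top. ln (ln (q * x)) \<le> q * ln (ln x)" using assms by real_asymp
  then show ?thesis using eventually_ge_at_top[of 0]
  proof eventually_elim
    case (elim x)
    have "2 * (q * x) * ln (ln (q * x)) \<le> 2 * (q * x) * (q * ln (ln x))"
      using elim assms by (intro mult_left_mono) auto
    also have "\<dots> = q\<^sup>2 * (2 * x * ln (ln x))" by (simp add: power2_eq_square)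
    finally have "lil_norm (q * x) \<le> sqrt (q\<^sup>2 * (2 * x * ln (ln x)))"
      unfolding lil_norm_def by (rule real_sqrt_le_mono)
    then show ?case using assms by (simp add: lil_norm_def real_sqrt_mult)
  qed
qed

text \<open>The sequence k^k; the ratio of consecutive terms grows like exp 1 times k.\<close>

definition super_level :: "nat \<Rightarrow> real" where "super_level k = exp (real k * ln (real k))"

lemma super_level_lim: "filterlim super_level at_top sequentially"
  unfolding super_level_def by real_asymp

lemma super_level_mono: "super_level k \<le> super_level (Suc k)"
proof (cases "k = 0")
  case False
  then have "real k * ln (real k) \<le> real (Suc k) * ln (real (Suc k))"
    by (intro mult_mono) auto
  then show ?thesis by (simp add: super_level_def)
qed (simp add: super_level_def)

lemma super_level_ratio: "0 < g \<Longrightarrow> \<forall>\<^sub>F k in sequentially. super_level k \<le> g * super_level (Suc k)"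
proof -
  assume "0 < g"
  have "(\<lambda>k. super_level k / super_level (Suc k)) \<longlonglongrightarrow> 0"
    unfolding super_level_def by real_asymp
  from order_tendstoD(2)[OF this \<open>0 < g\<close>] show ?thesis
    by eventually_elim (simp add: super_level_def divide_less_eq)
qed

text \<open>Up to a constant the quotient behaves like ln k / sqrt k. Along geometric levels the
  same quotient would tend to infinity, so they cannot serve for bounds attained infinitely
  often.\<close>

lemma super_level_lil_chung:
  "0 < g \<Longrightarrow> \<forall>\<^sub>F k in sequentially. lil_norm (super_level k) \<le> g * chung_norm (super_level (Suc k))"
proof -
  assume "0 < g"
  have lim: "(\<lambda>k. lil_norm (super_level k) / chung_norm (super_level (Suc k))) \<longlonglongrightarrow> 0"
    unfolding super_level_def lil_norm_def chung_norm_def by real_asymp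
  have "\<forall>\<^sub>F k in sequentially. 0 < chung_norm (super_level (Suc k))"
    unfolding super_level_def chung_norm_def by real_asymp
  then show ?thesis
    using order_tendstoD(2)[OF lim \<open>0 < g\<close>] by eventually_elim (simp add: divide_less_eq)
qed

lemma super_level_lil_lil:
  "0 < g \<Longrightarrow> \<forall>\<^sub>F k in sequentially. lil_norm (super_level k) \<le> g * lil_norm (super_level (Suc k))"
proof -
  assume "0 < g"
  have lim: "(\<lambda>k. lil_norm (super_level k) / lil_norm (super_level (Suc k))) \<longlonglongrightarrow> 0"
    unfolding super_level_def lil_norm_def by real_asymp
  have "\<forall>\<^sub>F k in sequentially. 0 < lil_norm (super_level (Suc k))"
    unfolding super_level_def lil_norm_def by real_asymp
  then show ?thesis
    using order_tendstoD(2)[OF lim \<open>0 < g\<close>] by eventually_elim (simp add: divide_less_eq)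
qed

text \<open>The terms are (k ln k)^(-2); the exponent is written as 1 + 1 to fit
  \<open>level_upper\<close> at \<open>e = 1\<close>.\<close>

lemma summable_super_level: "summable (\<lambda>k. exp (- (1 + 1) * ln (ln (super_level k))))"
proof (rule summable_comparison_test_ev)
  have "\<forall>\<^sub>F k in sequentially. exp (- (1 + 1) * ln (ln (super_level k))) \<le> real k powr (-2)"
    unfolding super_level_def by real_asymp
  then show "\<forall>\<^sub>F k in sequentially. norm (exp (- (1 + 1) * ln (ln (super_level k)))) \<le> real k powr (-2)"
    by simp
  show "summable (\<lambda>k. real k powr (-2))" by (subst summable_real_powr_iff) simp
qed

text \<open>Up to the shift, the terms are k ln k to the power - (1 - a). For every positive
  \<open>a\<close> the power k^a outgrows the logarithmic factor, so the harmonic series is a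
  minorant.\<close>

lemma not_summable_super_level:
  assumes "0 < a"
  shows "\<not> summable (\<lambda>k. exp (- (1 - a) * ln (ln (super_level (Suc k)))))"
proof
  assume "summable (\<lambda>k. exp (- (1 - a) * ln (ln (super_level (Suc k)))))"
  then have "summable (\<lambda>k. exp (- (1 - a) * ln (ln (super_level k))))" by (subst (asm) summable_Suc_iff)
  moreover have "\<forall>\<^sub>F k in sequentially. 1 / real k \<le> exp (- (1 - a) * ln (ln (super_level k)))"
    using assms unfolding super_level_def by real_asymp
  then have "\<forall>\<^sub>F k in sequentially. norm (inverse (real k)) \<le> exp (- (1 - a) * ln (ln (super_level k)))"
    by (auto simp: inverse_eq_divide elim: eventually_mono)
  ultimately have "summable (\<lambda>k. inverse (real k))" by (rule summable_comparison_test_ev[rotated])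
  then show False using not_summable_harmonic[where ?'a = real] by simp
qed

text \<open>The terms are c k to the power - (1 + e); comparison with the exponent
  \<open>1 + e / 2\<close> absorbs the constant \<open>c\<close>.\<close>

lemma summable_geometric_level:
  assumes "0 < c" "0 < e"
  shows "summable (\<lambda>k. exp (- (1 + e) * ln (ln (exp (c * real k)))))"
proof (rule summable_comparison_test_ev)
  have "\<forall>\<^sub>F k in sequentially. exp (- (1 + e) * ln (ln (exp (c * real k)))) \<le> real k powr (- (1 + e / 2))"
    using assms by real_asymp
  then show "\<forall>\<^sub>F k in sequentially. norm (exp (- (1 + e) * ln (ln (exp (c * real k))))) \<le> real k powr (- (1 + e / 2))"
    by simp
  show "summable (\<lambda>k. real k powr (- (1 + e / 2)))" using assms by (subst summable_real_powr_iff) simp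
qed

lemma (in prob_space) borel_cantelli_le:
  assumes "\<And>k. {\<omega> \<in> space M. P k \<omega>} \<in> events"
    and "\<forall>\<^sub>F k in sequentially. \<P>(\<omega> in M. P k \<omega>) \<le> p k" and "summable p"
  shows "AE \<omega> in M. \<forall>\<^sub>F k in sequentially. \<not> P k \<omega>"
proof -
  have sm: "summable (\<lambda>k. \<P>(\<omega> in M. P k \<omega>))"
    by (rule summable_comparison_test_ev[OF _ assms(3)]) (use assms(2) in simp)
  have "AE \<omega> in M. \<forall>\<^sub>F k in sequentially. \<omega> \<in> space M - {\<omega> \<in> space M. P k \<omega>}"
    by (rule borel_cantelli_AE1[OF assms(1) _ sm])
       (simp only: emeasure_eq_measure infinity_ennreal_def ennreal_less_top)
  then show ?thesis
  proof eventually_elim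
    case (elim \<omega>)
    then show ?case by (rule eventually_mono) simp
  qed
qed

text \<open>Independence is replaced by a lower bound on the conditional probability of
  \<open>B k\<close> that holds for every event known before the block. Applied to the event that
  nothing has happened so far, it multiplies the survival probability by at most exp (- p k), and
  the divergent sum drives it to 0.\<close>

lemma (in det_var_mds) conditional_borel_cantelli:
  assumes m: "\<And>k. m k \<le> m (Suc k)" and B: "\<And>k. B k \<in> sets (F (m (Suc k)))"
    and p: "\<And>k A. K \<le> k \<Longrightarrow> A \<in> sets (F (m k)) \<Longrightarrow> p k * prob A \<le> prob (A \<inter> B k)"
    and p0: "\<And>k. 0 \<le> p k" and div: "\<not> summable p"
  shows "AE \<omega> in M. \<exists>\<^sub>F k in sequentially. \<omega> \<in> B k"
proof -
  have BM: "B k \<in> events" for k using B by (rule sets_F)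
  have "AE \<omega> in M. \<exists>k\<ge>K'. \<omega> \<in> B k" for K'
  proof -
    define J where "J = max K K'"
    define C where "C = (\<lambda>n. {\<omega> \<in> space M. \<forall>k\<in>{J..<J + n}. \<omega> \<notin> B k})"
    have C: "C n \<in> sets (F (m (J + n)))" for n
    proof (induction n)
      case 0
      have "space (F (m J)) \<in> sets (F (m J))" by (rule sets.top)
      then show ?case by (simp add: C_def)
    next
      case (Suc n)
      have "C (Suc n) = C n - B (J + n)" by (auto simp: C_def less_Suc_eq)
      moreover have "C n \<in> sets (F (m (Suc (J + n))))"
        using Suc sets_F_mono[OF m[of "J + n"]] by auto
      ultimately show ?case using B[of "J + n"] by (auto intro: sets.Diff)
    qed
    have CM: "C n \<in> events" for n using C by (rule sets_F)
    have Cp: "prob (C n) \<le> exp (- (\<Sum>k<n. p (J + k)))" for n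
    proof (induction n)
      case (Suc n)
      have "prob (C (Suc n)) = prob (C n - (C n \<inter> B (J + n)))"
        by (rule arg_cong[of _ _ prob]) (auto simp: C_def less_Suc_eq)
      also have "\<dots> = prob (C n) - prob (C n \<inter> B (J + n))"
        using CM BM by (intro finite_measure_Diff) auto
      also have "\<dots> \<le> (1 - p (J + n)) * prob (C n)"
        using p[OF _ C[of n]] by (simp add: J_def algebra_simps)
      also have "\<dots> \<le> exp (- p (J + n)) * prob (C n)"
        using exp_ge_add_one_self[of "- p (J + n)"] by (intro mult_right_mono) auto
      also have "\<dots> \<le> exp (- p (J + n)) * exp (- (\<Sum>k<n. p (J + k)))"
        using Suc by (intro mult_left_mono) auto
      finally show ?case by (simp add: algebra_simps flip: exp_add)
    qed simp
    define E where "E = {\<omega> \<in> space M. \<forall>k\<ge>J. \<omega> \<notin> B k}"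
    have EM: "E \<in> events"
    proof -
      have "E = space M - (\<Union>k\<in>{J..}. B k)" by (auto simp: E_def)
      then show ?thesis using BM by auto
    qed
    have "prob E = 0"
    proof (rule ccontr)
      assume "prob E \<noteq> 0"
      then have E0: "0 < prob E" using zero_less_measure_iff by blast
      \<comment> \<open>A positive probability of never meeting any \<open>B k\<close> from
        \<open>J\<close> on would bound all partial sums.\<close>
      have "(\<Sum>k<n. p (J + k)) \<le> - ln (prob E)" for n
      proof -
        have "prob E \<le> prob (C n)" using CM by (intro finite_measure_mono) (auto simp: E_def C_def)
        then have "prob E \<le> exp (- (\<Sum>k<n. p (J + k)))" using Cp[of n] by linarith
        then have "ln (prob E) \<le> - (\<Sum>k<n. p (J + k))" using E0 by (metis ln_exp ln_mono exp_gt_zero)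
        then show ?thesis by simp
      qed
      then have "summable (\<lambda>k. p (k + J))"
        using p0 by (intro summableI_nonneg_bounded) (auto simp: add.commute)
      then show False using div unfolding summable_iff_shift by contradiction
    qed
    then have "AE \<omega> in M. \<omega> \<notin> E"
      using EM by (simp add: prob_eq_0)
    then show ?thesis
      using AE_space by eventually_elim (auto simp: E_def J_def)
  qed
  then have "AE \<omega> in M. \<forall>K'. \<exists>k\<ge>K'. \<omega> \<in> B k" by (simp add: AE_all_countable)
  then show ?thesis by (simp add: frequently_sequentially)
qed

text \<open>Monotonicity reduces the uncountable quantifier to the values 1 / (i + 1), whose null
  sets can be collected. These values are at most 1, so estimates for small \<open>e\<close>
  suffice.\<close>

lemma AE_all_positive:
  fixes P :: "real \<Rightarrow> 'a \<Rightarrow> bool"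
  assumes "\<And>e. 0 < e \<Longrightarrow> e \<le> 1 \<Longrightarrow> AE \<omega> in M. P e \<omega>"
    and mono: "\<And>e e' \<omega>. 0 < e \<Longrightarrow> e \<le> e' \<Longrightarrow> P e \<omega> \<Longrightarrow> P e' \<omega>"
  shows "AE \<omega> in M. \<forall>e>0. P e \<omega>"
proof -
  have "AE \<omega> in M. \<forall>i. P (1 / real (Suc i)) \<omega>"
    unfolding AE_all_countable by (intro allI assms(1)) auto
  then show ?thesis
  proof eventually_elim
    case (elim \<omega>)
    show ?case
    proof (intro allI impI)
      fix e :: real assume "0 < e"
      then obtain i where "1 / real (Suc i) < e" using nat_approx_posE by blast
      then show "P e \<omega>" using elim mono[of "1 / real (Suc i)" e \<omega>] by auto
    qed
  qed
qed

section \<open>Almost sure statements along variance levels\<close>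

context growing_mds
begin

lemma N_lim: "filterlim N at_top at_top"
  unfolding filterlim_at_top
proof
  fix n
  show "\<forall>\<^sub>F x in at_top. n \<le> N x"
    using eventually_ge_at_top[of "V n"]
    by eventually_elim (use V_nonneg[of n] in \<open>simp add: le_N_iff\<close>)
qed

lemma AE_upper_levels:
  assumes "0 < e" "e \<le> 1" "filterlim x at_top sequentially"
    and "summable (\<lambda>k. exp (- (1 + e) * ln (ln (x k))))"
  shows "AE \<omega> in M. \<forall>\<^sub>F k in sequentially. \<forall>j\<in>{0..N (x k)}. W j \<omega> < (1 + e) * lil_norm (x k)"
proof -
  have "AE \<omega> in M. \<forall>\<^sub>F k in sequentially. \<not> (\<exists>j\<in>{0..N (x k)}. (1 + e) * lil_norm (x k) \<le> W j \<omega>)"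
    using filterlim_eventually[OF assms(3) level_upper[OF assms(1,2)]]
    by (intro borel_cantelli_le[OF _ _ assms(4)]) (auto simp: lil_norm_def)
  then show ?thesis by (simp add: not_le)
qed

lemma AE_small_ball_levels:
  assumes "0 < e" "e < 1" "filterlim x at_top sequentially"
    and "summable (\<lambda>k. exp (- (1 + e) * ln (ln (x k))))"
  shows "AE \<omega> in M. \<forall>\<^sub>F k in sequentially. \<exists>j\<in>{0..N (x k)}. (1 - e) * (pi / sqrt 8) * chung_norm (x k) < \<bar>W j \<omega>\<bar>"
proof -
  obtain C where C: "\<forall>\<^sub>F x in at_top.
    \<P>(\<omega> in M. \<forall>j\<in>{0..N x}. \<bar>W j \<omega>\<bar> \<le> (1 - e) * (pi / sqrt 8) * sqrt (x / ln (ln x)))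
    \<le> C * exp (- (1 + e) * ln (ln x))"
    using level_small_ball_upper[OF assms(1,2)] by blast
  have "AE \<omega> in M. \<forall>\<^sub>F k in sequentially.
      \<not> (\<forall>j\<in>{0..N (x k)}. \<bar>W j \<omega>\<bar> \<le> (1 - e) * (pi / sqrt 8) * chung_norm (x k))"
    using filterlim_eventually[OF assms(3) C]
    by (intro borel_cantelli_le[OF _ _ summable_mult[OF assms(4), of C]]) (auto simp: chung_norm_def)
  then show ?thesis by (simp add: not_le)
qed

lemma super_level_nonneg: "0 \<le> super_level k"
  by (simp add: super_level_def)

lemma N_super_level_mono: "N (super_level k) \<le> N (super_level (Suc k))"
  by (intro N_mono super_level_nonneg super_level_mono)

text \<open>Bridge to \<open>conditional_borel_cantelli\<close>: block \<open>k\<close> runs from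
  level \<open>k\<close> to level \<open>Suc k\<close>, its event is known at the end, and the lower
  bound is conditional on the beginning.\<close>

lemma AE_frequently_super_level:
  assumes a: "0 < a" and P: "\<And>k. Measurable.pred (F (N (super_level (Suc k)))) (P k)"
    and p: "\<forall>\<^sub>F k in sequentially. \<forall>A\<in>sets (F (N (super_level k))).
      exp (- (1 - a) * ln (ln (super_level (Suc k)))) * prob A \<le> prob {\<omega> \<in> A. P k \<omega>}"
  shows "AE \<omega> in M. \<exists>\<^sub>F k in sequentially. P k \<omega>"
proof -
  define B where "B = (\<lambda>k. {\<omega> \<in> space M. P k \<omega>})"
  have AB: "A \<inter> B k = {\<omega> \<in> A. P k \<omega>}" if "A \<in> sets (F (N (super_level k)))" for A k
    using sets.sets_into_space[OF sets_F[OF that]] by (auto simp: B_def)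
  obtain K where K: "\<And>k A. K \<le> k \<Longrightarrow> A \<in> sets (F (N (super_level k))) \<Longrightarrow>
    exp (- (1 - a) * ln (ln (super_level (Suc k)))) * prob A \<le> prob (A \<inter> B k)"
    using p AB unfolding eventually_sequentially by metis
  have "AE \<omega> in M. \<exists>\<^sub>F k in sequentially. \<omega> \<in> B k"
  proof (rule conditional_borel_cantelli[where m = "\<lambda>k. N (super_level k)" and K = K
        and p = "\<lambda>k. exp (- (1 - a) * ln (ln (super_level (Suc k))))", OF N_super_level_mono _ K])
    show "B k \<in> sets (F (N (super_level (Suc k))))" for k
      using P[of k] unfolding B_def pred_def by simp
    show "\<not> summable (\<lambda>k. exp (- (1 - a) * ln (ln (super_level (Suc k)))))"
      using a by (rule not_summable_super_level)
  qed auto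
  then show ?thesis
  proof eventually_elim
    case (elim \<omega>)
    then show ?case by (rule frequently_elim1) (simp add: B_def)
  qed
qed

lemma super_level_Suc_lim: "filterlim (\<lambda>k. super_level (Suc k)) at_top sequentially"
  by (rule filterlim_compose[OF super_level_lim filterlim_Suc])

lemma AE_lower_levels:
  assumes g: "0 < g" "g < 1 / 8"
  shows "AE \<omega> in M. \<exists>\<^sub>F k in sequentially. (1 - 7 * g) * lil_norm (super_level (Suc k))
    \<le> W (N (super_level (Suc k))) \<omega> - W (N (super_level k)) \<omega>"
proof (rule AE_frequently_super_level)
  show "0 < 4 * g" using g by simp
  fix k
  have [measurable]: "W (N (super_level (Suc k))) \<in> borel_measurable (F (N (super_level (Suc k))))"
    "W (N (super_level k)) \<in> borel_measurable (F (N (super_level (Suc k))))"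
    using N_super_level_mono by (auto intro: W_measurable_F)
  show "Measurable.pred (F (N (super_level (Suc k)))) (\<lambda>\<omega>. (1 - 7 * g) * lil_norm (super_level (Suc k))
      \<le> W (N (super_level (Suc k))) \<omega> - W (N (super_level k)) \<omega>)"
    by measurable
next
  from filterlim_eventually[OF super_level_Suc_lim level_lower[OF g]] super_level_ratio[OF g(1)]
  show "\<forall>\<^sub>F k in sequentially. \<forall>A\<in>sets (F (N (super_level k))).
    exp (- (1 - 4 * g) * ln (ln (super_level (Suc k)))) * prob A
    \<le> prob {\<omega> \<in> A. (1 - 7 * g) * lil_norm (super_level (Suc k))
      \<le> W (N (super_level (Suc k))) \<omega> - W (N (super_level k)) \<omega>}"
    by eventually_elim (use super_level_nonneg in \<open>simp add: lil_norm_def\<close>)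
qed

lemma AE_small_ball_lower_levels:
  assumes g: "0 < g" "g \<le> 1"
  shows "AE \<omega> in M. \<exists>\<^sub>F k in sequentially. \<forall>j\<in>{N (super_level k)..N (super_level (Suc k))}.
    \<bar>W j \<omega> - W (N (super_level k)) \<omega>\<bar> \<le> (1 + g) * (pi / sqrt 8) * chung_norm (super_level (Suc k))"
proof (rule AE_frequently_super_level[OF _ pred_W_diff_le])
  show "0 < g / 2" using g by simp
  from filterlim_eventually[OF super_level_Suc_lim level_small_ball_lower[OF g]]
  show "\<forall>\<^sub>F k in sequentially. \<forall>A\<in>sets (F (N (super_level k))).
    exp (- (1 - g / 2) * ln (ln (super_level (Suc k)))) * prob A
    \<le> prob {\<omega> \<in> A. \<forall>j\<in>{N (super_level k)..N (super_level (Suc k))}.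
      \<bar>W j \<omega> - W (N (super_level k)) \<omega>\<bar> \<le> (1 + g) * (pi / sqrt 8) * chung_norm (super_level (Suc k))}"
    by eventually_elim (use super_level_nonneg super_level_mono in \<open>simp add: chung_norm_def\<close>)
qed

text \<open>A crude bound for the past of each block, with constant 2 in place of
  \<open>1 + e\<close>; the lower side is the upper side for the differences with reversed
  sign.\<close>

lemma AE_super_level_upper:
  "AE \<omega> in M. \<forall>\<^sub>F k in sequentially. \<forall>j\<in>{0..N (super_level k)}. \<bar>W j \<omega>\<bar> < 2 * lil_norm (super_level k)"
proof -
  interpret neg: growing_mds M F "\<lambda>k \<omega>. - D k \<omega>" v h by (rule uminus_growing)
  have W: "neg.W j \<omega> = - W j \<omega>" for j \<omega> by (simp add: neg.W_def W_def sum_negf)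
  have "AE \<omega> in M. \<forall>\<^sub>F k in sequentially. \<forall>j\<in>{0..N (super_level k)}. W j \<omega> < (1 + 1) * lil_norm (super_level k)"
    by (intro AE_upper_levels super_level_lim summable_super_level) auto
  moreover have "AE \<omega> in M. \<forall>\<^sub>F k in sequentially. \<forall>j\<in>{0..N (super_level k)}. - W j \<omega> < (1 + 1) * lil_norm (super_level k)"
    unfolding W[symmetric] by (intro neg.AE_upper_levels super_level_lim summable_super_level) auto
  ultimately show ?thesis
  proof eventually_elim
    case (elim \<omega>)
    then show ?case by eventually_elim (auto simp: abs_less_iff)
  qed
qed

section \<open>Iterated logarithm laws for the martingale\<close>

text \<open>The power of \<open>q\<close> above \<open>x\<close> serves upper bounds for
  \<open>W\<close>, the one below serves lower bounds for the running maximum. Since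
  \<open>ln x\<close> is positive, \<open>k\<close> is at least 1 and the subtraction
  \<open>k - 1\<close> does not truncate.\<close>

lemma geometric_level:
  assumes "1 < q" "1 < x"
  defines "c \<equiv> ln q"
  defines "k \<equiv> nat \<lceil>ln x / c\<rceil>"
  shows "x \<le> exp (c * real k)" "exp (c * real k) \<le> q * x"
    and "exp (c * real (k - 1)) < x" "x \<le> q * exp (c * real (k - 1))"
proof -
  have c: "0 < c" using assms by simp
  have pos: "0 < ln x / c" using assms(2) c by simp
  then have k: "real k = of_int \<lceil>ln x / c\<rceil>" unfolding k_def by simp
  have le: "ln x / c \<le> real k" "real k < ln x / c + 1" unfolding k by linarith+
  then have le': "ln x \<le> c * real k" "c * real k < ln x + c" using c by (auto simp: field_simps)
  show "x \<le> exp (c * real k)" using le' assms(2) by (metis exp_le_cancel_iff exp_ln less_trans zero_less_one)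
  have "exp (c * real k) \<le> exp (c + ln x)" using le' by simp
  also have "\<dots> = q * x" using assms by (simp add: exp_add)
  finally show "exp (c * real k) \<le> q * x" .
  have "1 \<le> k" using pos le by (cases k) auto
  then have k1: "c * real (k - 1) = c * real k - c" by (simp add: algebra_simps)
  have "exp (c * real (k - 1)) < exp (ln x)" using le' unfolding k1 by simp
  then show "exp (c * real (k - 1)) < x" using assms(2) by simp
  have "q * exp (c * real (k - 1)) = exp (c * real k)" unfolding k1 exp_diff using assms(1) by (simp add: c_def)
  with \<open>x \<le> exp (c * real k)\<close> show "x \<le> q * exp (c * real (k - 1))" by simp
qed

lemma geometric_level_lim:
  assumes "1 < q"
  shows "filterlim (\<lambda>n. nat \<lceil>ln (V n) / ln q\<rceil>) at_top sequentially"
    and "filterlim (\<lambda>n. nat \<lceil>ln (V n) / ln q\<rceil> - 1) at_top sequentially"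
proof -
  have c: "0 < ln q" using assms by simp
  have 1: "filterlim (\<lambda>x. nat \<lceil>ln x / ln q\<rceil>) at_top at_top" using c by real_asymp
  show 2: "filterlim (\<lambda>n. nat \<lceil>ln (V n) / ln q\<rceil>) at_top sequentially"
    using filterlim_compose[OF 1 V_lim] .
  show "filterlim (\<lambda>n. nat \<lceil>ln (V n) / ln q\<rceil> - 1) at_top sequentially"
    using filterlim_compose[OF filterlim_minus_const_nat_at_top 2] .
qed

text \<open>Between levels nothing new has to be estimated: \<open>n\<close> lies within the clock
  of the next power of \<open>q\<close>, where the maximum is already controlled, and the norm there
  is at most \<open>q\<close> times the norm at \<open>V n\<close>. The two factors
  \<open>1 + e / 3\<close> multiply to at most \<open>1 + e\<close> for
  \<open>e \<le> 1\<close>.\<close>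

theorem lil_upper: "AE \<omega> in M. \<forall>e>0. \<forall>\<^sub>F n in sequentially. W n \<omega> \<le> (1 + e) * lil_norm (V n)"
proof (rule AE_all_positive)
  fix e :: real assume e: "0 < e" "e \<le> 1"
  define q where "q = 1 + e / 3"
  have q: "1 < q" using e by (simp add: q_def)
  have "AE \<omega> in M. \<forall>\<^sub>F k in sequentially. \<forall>j\<in>{0..N (exp (ln q * real k))}.
      W j \<omega> < (1 + e / 3) * lil_norm (exp (ln q * real k))"
  proof (rule AE_upper_levels)
    show "filterlim (\<lambda>k. exp (ln q * real k)) at_top sequentially"
      using ln_gt_zero[OF q] by real_asymp
  qed (use e q in \<open>auto intro!: summable_geometric_level[simplified]\<close>)
  then show "AE \<omega> in M. \<forall>\<^sub>F n in sequentially. W n \<omega> \<le> (1 + e) * lil_norm (V n)"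
  proof eventually_elim
    case (elim \<omega>)
    from filterlim_eventually[OF geometric_level_lim(1)[OF q] elim]
      filterlim_eventually[OF V_lim eventually_lil_norm_scale[OF q]]
      filterlim_eventually[OF V_lim eventually_lnln_ge[of 0]]
      filterlim_eventually[OF V_lim eventually_gt_at_top[of 1]]
    show ?case
    proof eventually_elim
      case (elim n)
      define x where "x = exp (ln q * real (nat \<lceil>ln (V n) / ln q\<rceil>))"
      have x: "V n \<le> x" "x \<le> q * V n"
        using geometric_level(1,2)[OF q elim(4)] by (simp_all add: x_def)
      have "n \<le> N x" using x V_nonneg[of n] by (subst le_N_iff) auto
      then have "W n \<omega> < (1 + e / 3) * lil_norm x" using elim(1) by (simp add: x_def)
      also have "lil_norm x \<le> lil_norm (q * V n)"
      proof (rule lil_norm_mono)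
        show "0 \<le> ln (ln x)" using x elim lnln_mono[of "V n" x] by linarith
      qed (use x elim in auto)
      also have "\<dots> \<le> q * lil_norm (V n)" using elim by simp
      finally have "W n \<omega> \<le> (1 + e / 3) * (q * lil_norm (V n))"
        using e by (simp add: mult_left_mono)
      also have "\<dots> = ((1 + e / 3) * (1 + e / 3)) * lil_norm (V n)" by (simp add: q_def)
      also have "\<dots> \<le> (1 + e) * lil_norm (V n)"
      proof (rule mult_right_mono)
        have "e * e \<le> e * 1" using e by (intro mult_left_mono) auto
        moreover have "(1 + e / 3) * (1 + e / 3) = 1 + 2 / 3 * e + 1 / 9 * (e * e)"
          by (simp add: algebra_simps)
        ultimately show "(1 + e / 3) * (1 + e / 3) \<le> 1 + e" using e by linarith
        show "0 \<le> lil_norm (V n)" using elim by (intro lil_norm_nonneg) auto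
      qed
      finally show ?case .
    qed
  qed
next
  fix e e' :: real and \<omega>
  assume "0 < e" "e \<le> e'" and *: "\<forall>\<^sub>F n in sequentially. W n \<omega> \<le> (1 + e) * lil_norm (V n)"
  from * filterlim_eventually[OF V_lim eventually_lnln_ge[of 0]]
  show "\<forall>\<^sub>F n in sequentially. W n \<omega> \<le> (1 + e') * lil_norm (V n)"
  proof eventually_elim
    case (elim n)
    have "(1 + e) * lil_norm (V n) \<le> (1 + e') * lil_norm (V n)"
      using elim \<open>e \<le> e'\<close> V_nonneg by (intro mult_right_mono lil_norm_nonneg) auto
    with elim show ?case by linarith
  qed
qed

lemma N_super_level_lim: "filterlim (\<lambda>k. N (super_level (Suc k))) at_top sequentially"
  by (rule filterlim_compose[OF N_lim super_level_Suc_lim])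

text \<open>At the end of a good block \<open>W\<close> is the increment plus the value at its
  beginning. The increment misses the norm by a fraction \<open>7 * g\<close>, the past removes at
  most \<open>2 * g\<close> more; hence \<open>g = e / 9\<close>.\<close>

theorem lil_lower: "AE \<omega> in M. \<forall>e>0. \<exists>\<^sub>F n in sequentially. (1 - e) * lil_norm (V n) \<le> W n \<omega>"
proof (rule AE_all_positive)
  fix e :: real assume e: "0 < e" "e \<le> 1"
  define g where "g = e / 9"
  have g: "0 < g" "g < 1 / 8" using e by (auto simp: g_def)
  from AE_lower_levels[OF g] AE_super_level_upper
  show "AE \<omega> in M. \<exists>\<^sub>F n in sequentially. (1 - e) * lil_norm (V n) \<le> W n \<omega>"
  proof eventually_elim
    case (elim \<omega>)
    have "\<forall>\<^sub>F k in sequentially. lil_norm (super_level k) \<le> g * lil_norm (super_level (Suc k))"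
      using g by (intro super_level_lil_lil)
    moreover have "\<forall>\<^sub>F k in sequentially. 2 < V (N (super_level (Suc k)))"
      by (rule filterlim_eventually[OF filterlim_compose[OF V_lim N_super_level_lim] eventually_gt_at_top])
    moreover have "\<forall>\<^sub>F k in sequentially. 0 \<le> ln (ln (V (N (super_level (Suc k)))))"
      by (rule filterlim_eventually[OF filterlim_compose[OF V_lim N_super_level_lim] eventually_lnln_ge])
    ultimately have "\<forall>\<^sub>F k in sequentially.
        (1 - 7 * g) * lil_norm (super_level (Suc k)) \<le> W (N (super_level (Suc k))) \<omega> - W (N (super_level k)) \<omega> \<longrightarrow>
        (1 - e) * lil_norm (V (N (super_level (Suc k)))) \<le> W (N (super_level (Suc k))) \<omega>"
      using elim(2)
    proof eventually_elim
      case (elim k)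
      define x where "x = super_level (Suc k)"
      have x0: "0 \<le> x" by (simp add: x_def super_level_def)
      have xV: "V (N x) \<le> x" using x0 by (rule V_N_le)
      have lx: "lil_norm (V (N x)) \<le> lil_norm x"
        using elim xV by (intro lil_norm_mono) (auto simp: x_def)
      have l0: "0 \<le> lil_norm (V (N x))" using elim by (intro lil_norm_nonneg) (auto simp: x_def)
      show ?case unfolding x_def[symmetric]
      proof
        assume *: "(1 - 7 * g) * lil_norm x \<le> W (N x) \<omega> - W (N (super_level k)) \<omega>"
        have "\<bar>W (N (super_level k)) \<omega>\<bar> < 2 * lil_norm (super_level k)" using elim by auto
        also have "\<dots> \<le> 2 * (g * lil_norm x)" using elim by (simp add: x_def)
        finally have "(1 - 9 * g) * lil_norm x \<le> W (N x) \<omega>" using * by (simp add: algebra_simps)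
        moreover have "(1 - 9 * g) * lil_norm (V (N x)) \<le> (1 - 9 * g) * lil_norm x"
          using lx e by (intro mult_left_mono) (auto simp: g_def)
        ultimately show "(1 - e) * lil_norm (V (N x)) \<le> W (N x) \<omega>" by (simp add: g_def)
      qed
    qed
    then have "\<exists>\<^sub>F k in sequentially. (1 - e) * lil_norm (V (N (super_level (Suc k)))) \<le> W (N (super_level (Suc k))) \<omega>"
      by (rule frequently_rev_mp[OF elim(1)])
    then show ?case by (rule frequently_filterlim[OF _ N_super_level_lim])
  qed
next
  fix e e' :: real and \<omega>
  assume "0 < e" "e \<le> e'" and *: "\<exists>\<^sub>F n in sequentially. (1 - e) * lil_norm (V n) \<le> W n \<omega>"
  from filterlim_eventually[OF V_lim eventually_lnln_ge[of 0]]
  have "\<forall>\<^sub>F n in sequentially. (1 - e) * lil_norm (V n) \<le> W n \<omega> \<longrightarrow> (1 - e') * lil_norm (V n) \<le> W n \<omega>"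
  proof eventually_elim
    case (elim n)
    have "(1 - e') * lil_norm (V n) \<le> (1 - e) * lil_norm (V n)"
      using elim \<open>e \<le> e'\<close> V_nonneg by (intro mult_right_mono lil_norm_nonneg) auto
    then show ?case by linarith
  qed
  then show "\<exists>\<^sub>F n in sequentially. (1 - e') * lil_norm (V n) \<le> W n \<omega>"
    by (rule frequently_rev_mp[OF *])
qed

text \<open>The running maximum grows with \<open>n\<close>, so the excursion found at the power of
  \<open>q\<close> just below \<open>V n\<close> still counts. By the choice
  \<open>q = 1 / r\<^sup>2\<close> the norm at that power is at least \<open>r\<close> times the
  norm at \<open>V n\<close>, and \<open>r * r\<close> is at least \<open>1 - e\<close>.\<close>

theorem chung_lower: "AE \<omega> in M. \<forall>e>0. \<forall>\<^sub>F n in sequentially.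
  \<exists>j\<in>{0..n}. (1 - e) * (pi / sqrt 8) * chung_norm (V n) \<le> \<bar>W j \<omega>\<bar>"
proof (rule AE_all_positive)
  fix e :: real assume e: "0 < e" "e \<le> 1"
  define r where "r = 1 - e / 2"
  define q where "q = 1 / r\<^sup>2"
  have r: "0 < r" "r < 1" using e by (auto simp: r_def)
  then have q: "1 < q" unfolding q_def by (simp add: power_less_one_iff less_divide_eq)
  have "AE \<omega> in M. \<forall>\<^sub>F k in sequentially. \<exists>j\<in>{0..N (exp (ln q * real k))}.
      (1 - e / 2) * (pi / sqrt 8) * chung_norm (exp (ln q * real k)) < \<bar>W j \<omega>\<bar>"
  proof (rule AE_small_ball_levels)
    show "filterlim (\<lambda>k. exp (ln q * real k)) at_top sequentially"
      using ln_gt_zero[OF q] by real_asymp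
  qed (use e q in \<open>auto intro!: summable_geometric_level[simplified]\<close>)
  then show "AE \<omega> in M. \<forall>\<^sub>F n in sequentially.
      \<exists>j\<in>{0..n}. (1 - e) * (pi / sqrt 8) * chung_norm (V n) \<le> \<bar>W j \<omega>\<bar>"
  proof eventually_elim
    case (elim \<omega>)
    have "filterlim (\<lambda>n. 1 / q * V n) at_top sequentially"
      using q by (intro filterlim_tendsto_pos_mult_at_top[OF tendsto_const _ V_lim]) auto
    from filterlim_eventually[OF geometric_level_lim(2)[OF q] elim]
      filterlim_eventually[OF this eventually_lnln_ge[of 1]]
      filterlim_eventually[OF this eventually_gt_at_top[of 1]]
      filterlim_eventually[OF V_lim eventually_gt_at_top[of 1]]
    show ?case
    proof eventually_elim
      case (elim n)
      define x where "x = exp (ln q * real (nat \<lceil>ln (V n) / ln q\<rceil> - 1))"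
      have x: "x < V n" "V n \<le> q * x"
        using geometric_level(3,4)[OF q elim(4)] by (simp_all add: x_def)
      then have x': "1 / q * V n \<le> x" using q by (simp add: field_simps)
      have ll: "1 \<le> ln (ln x)" "ln (ln x) \<le> ln (ln (V n))"
        using x x' elim lnln_mono[of "1 / q * V n" x] lnln_mono[of x "V n"] by linarith+
      have ll0: "0 \<le> ln (ln (V n))" using ll by linarith
      have x0: "0 < x" by (simp add: x_def)
      have "N x \<le> n" using le_N_iff[of x n] x by (auto simp: x_def)
      moreover obtain j where j: "j \<in> {0..N x}" "r * (pi / sqrt 8) * chung_norm x < \<bar>W j \<omega>\<bar>"
        using elim(1) unfolding x_def r_def by blast
      moreover have "(1 - e) * (pi / sqrt 8) * chung_norm (V n) \<le> r * (pi / sqrt 8) * chung_norm x"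
      proof -
        have "(r\<^sup>2 * V n) / ln (ln (V n)) \<le> x / ln (ln x)"
          using ll x' x x0 r q by (intro frac_le) (auto simp: q_def)
        from real_sqrt_le_mono[OF this] have "r * chung_norm (V n) \<le> chung_norm x"
          using r by (simp add: chung_norm_def real_sqrt_divide real_sqrt_mult)
        then have "r * (pi / sqrt 8) * (r * chung_norm (V n)) \<le> r * (pi / sqrt 8) * chung_norm x"
          using r by (intro mult_left_mono) auto
        moreover have "(1 - e) * ((pi / sqrt 8) * chung_norm (V n)) \<le> (r * r) * ((pi / sqrt 8) * chung_norm (V n))"
        proof (rule mult_right_mono)
          show "1 - e \<le> r * r" by (simp add: r_def algebra_simps)
          show "0 \<le> pi / sqrt 8 * chung_norm (V n)"
            using ll0 elim by (intro mult_nonneg_nonneg chung_norm_nonneg) auto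
        qed
        ultimately show ?thesis by (simp only: mult_ac)
      qed
      ultimately show ?case by (intro bexI[of _ j]) auto
    qed
  qed
next
  fix e e' :: real and \<omega>
  assume "0 < e" "e \<le> e'" and *: "\<forall>\<^sub>F n in sequentially.
    \<exists>j\<in>{0..n}. (1 - e) * (pi / sqrt 8) * chung_norm (V n) \<le> \<bar>W j \<omega>\<bar>"
  from * filterlim_eventually[OF V_lim eventually_lnln_ge[of 0]]
  show "\<forall>\<^sub>F n in sequentially. \<exists>j\<in>{0..n}. (1 - e') * (pi / sqrt 8) * chung_norm (V n) \<le> \<bar>W j \<omega>\<bar>"
  proof eventually_elim
    case (elim n)
    have "(1 - e') * (pi / sqrt 8) * chung_norm (V n) \<le> (1 - e) * (pi / sqrt 8) * chung_norm (V n)"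
      using elim \<open>e \<le> e'\<close> V_nonneg by (intro mult_right_mono chung_norm_nonneg) auto
    with elim show ?case by (meson order_trans)
  qed
qed

text \<open>In units of the norm, the path stays on a good block within
  \<open>(1 + g) * \<kappa>\<close> of its starting point, and the past including that point is
  within \<open>g * \<kappa>\<close> of 0. A last loss \<open>1 - g\<close> comes from
  \<open>V (N x)\<close> falling short of \<open>x\<close>; with \<open>g = e / 8\<close> the ratio
  \<open>(1 + 2 * g) / (1 - g)\<close> is at most \<open>1 + e\<close>.\<close>

theorem chung_upper: "AE \<omega> in M. \<forall>e>0. \<exists>\<^sub>F n in sequentially.
  \<forall>j\<in>{0..n}. \<bar>W j \<omega>\<bar> \<le> (1 + e) * (pi / sqrt 8) * chung_norm (V n)"
proof (rule AE_all_positive)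
  fix e :: real assume e: "0 < e" "e \<le> 1"
  define g where "g = e / 8"
  define \<kappa> where "\<kappa> = pi / sqrt 8"
  have \<kappa>: "0 < \<kappa>" by (simp add: \<kappa>_def)
  have g: "0 < g" "g \<le> 1" using e by (auto simp: g_def)
  from AE_small_ball_lower_levels[OF g] AE_super_level_upper
  show "AE \<omega> in M. \<exists>\<^sub>F n in sequentially. \<forall>j\<in>{0..n}. \<bar>W j \<omega>\<bar> \<le> (1 + e) * (pi / sqrt 8) * chung_norm (V n)"
    unfolding \<kappa>_def[symmetric]
  proof eventually_elim
    case (elim \<omega>)
    \<comment> \<open>The past is bounded on the scale of the iterated logarithm law but must be
      small on the finer scale; the division by 2 cancels the constant of
      \<open>AE_super_level_upper\<close>.\<close>
    have "\<forall>\<^sub>F k in sequentially. lil_norm (super_level k) \<le> (g * \<kappa> / 2) * chung_norm (super_level (Suc k))"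
      using g \<kappa> by (intro super_level_lil_chung) auto
    moreover have "\<forall>\<^sub>F k in sequentially. 2 < V (N (super_level (Suc k)))"
      by (rule filterlim_eventually[OF filterlim_compose[OF V_lim N_super_level_lim] eventually_gt_at_top])
    moreover have "\<forall>\<^sub>F k in sequentially. 1 \<le> ln (ln (V (N (super_level (Suc k)))))"
      by (rule filterlim_eventually[OF filterlim_compose[OF V_lim N_super_level_lim] eventually_lnln_ge])
    moreover have "\<forall>\<^sub>F k in sequentially. (1 - g) * super_level (Suc k) \<le> V (N (super_level (Suc k)))"
      by (rule filterlim_eventually[OF super_level_Suc_lim eventually_V_N_ge[OF g(1)]])
    ultimately have "\<forall>\<^sub>F k in sequentially.
        (\<forall>j\<in>{N (super_level k)..N (super_level (Suc k))}.
          \<bar>W j \<omega> - W (N (super_level k)) \<omega>\<bar> \<le> (1 + g) * \<kappa> * chung_norm (super_level (Suc k))) \<longrightarrow>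
        (\<forall>j\<in>{0..N (super_level (Suc k))}. \<bar>W j \<omega>\<bar> \<le> (1 + e) * \<kappa> * chung_norm (V (N (super_level (Suc k)))))"
      using elim(2)
    proof eventually_elim
      case (elim k)
      define x where "x = super_level (Suc k)"
      define m where "m = N (super_level k)"
      have x0: "0 \<le> x" by (simp add: x_def super_level_def)
      have xV: "V (N x) \<le> x" using x0 by (rule V_N_le)
      have ll: "1 \<le> ln (ln (V (N x)))" "ln (ln (V (N x))) \<le> ln (ln x)"
        using elim xV lnln_mono[of "V (N x)" x] by (auto simp: x_def)
      have c0: "0 \<le> chung_norm x" using ll x0 by (intro chung_norm_nonneg) auto
      have cV: "(1 - g) * chung_norm x \<le> chung_norm (V (N x))"
      proof -
        have "(1 - g)\<^sup>2 * x \<le> (1 - g) * x"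
          using g x0 by (intro mult_right_mono) (auto simp: power2_eq_square mult_left_le)
        also have "\<dots> \<le> V (N x)" using elim by (simp add: x_def)
        finally have "((1 - g)\<^sup>2 * x) / ln (ln x) \<le> V (N x) / ln (ln (V (N x)))"
          using ll V_nonneg by (intro frac_le) auto
        from real_sqrt_le_mono[OF this] show ?thesis
          using g by (simp add: chung_norm_def real_sqrt_divide real_sqrt_mult)
      qed
      have key: "(1 + 2 * g) * \<kappa> * chung_norm x \<le> (1 + e) * \<kappa> * chung_norm (V (N x))"
      proof -
        have "1 + 2 * g \<le> (1 + e) * (1 - g)"
        proof -
          have "e * e \<le> e * 1" using e by (intro mult_left_mono) auto
          moreover have "(1 + e) * (1 - e / 8) = 1 + 7 / 8 * e - 1 / 8 * (e * e)"
            by (simp add: field_simps)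
          ultimately show ?thesis unfolding g_def using e by linarith
        qed
        then have "(1 + 2 * g) * (\<kappa> * chung_norm x) \<le> ((1 + e) * (1 - g)) * (\<kappa> * chung_norm x)"
          using \<kappa> c0 by (intro mult_right_mono) auto
        also have "\<dots> = (1 + e) * \<kappa> * ((1 - g) * chung_norm x)" by (simp only: mult_ac)
        also have "\<dots> \<le> (1 + e) * \<kappa> * chung_norm (V (N x))"
          using cV \<kappa> e by (intro mult_left_mono) auto
        finally show ?thesis by (simp only: mult_ac)
      qed
      have small: "\<bar>W j \<omega>\<bar> \<le> g * \<kappa> * chung_norm x" if "j \<in> {0..m}" for j
      proof -
        have "\<bar>W j \<omega>\<bar> \<le> 2 * lil_norm (super_level k)"
          using bspec[OF elim(5), of j] that by (simp add: m_def)
        also have "\<dots> \<le> 2 * ((g * \<kappa> / 2) * chung_norm x)" using elim by (simp add: x_def)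
        finally show ?thesis by simp
      qed
      show ?case unfolding x_def[symmetric] m_def[symmetric]
      proof (intro impI ballI)
        fix j assume *: "\<forall>j\<in>{m..N x}. \<bar>W j \<omega> - W m \<omega>\<bar> \<le> (1 + g) * \<kappa> * chung_norm x"
          and j: "j \<in> {0..N x}"
        have "\<bar>W j \<omega>\<bar> \<le> (1 + 2 * g) * \<kappa> * chung_norm x"
        proof (cases "j \<le> m")
          case True
          have "g * (\<kappa> * chung_norm x) \<le> (1 + 2 * g) * (\<kappa> * chung_norm x)"
            using g \<kappa> c0 by (intro mult_right_mono) auto
          then show ?thesis using small[of j] True by simp
        next
          case False
          then have "\<bar>W j \<omega> - W m \<omega>\<bar> \<le> (1 + g) * \<kappa> * chung_norm x" using * j by auto
          then show ?thesis using small[of m] by (simp add: algebra_simps)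
        qed
        then show "\<bar>W j \<omega>\<bar> \<le> (1 + e) * \<kappa> * chung_norm (V (N x))" using key by linarith
      qed
    qed
    then have "\<exists>\<^sub>F k in sequentially. \<forall>j\<in>{0..N (super_level (Suc k))}.
        \<bar>W j \<omega>\<bar> \<le> (1 + e) * \<kappa> * chung_norm (V (N (super_level (Suc k))))"
      by (rule frequently_rev_mp[OF elim(1)])
    then show ?case by (rule frequently_filterlim[OF _ N_super_level_lim])
  qed
next
  fix e e' :: real and \<omega>
  assume "0 < e" "e \<le> e'" and *: "\<exists>\<^sub>F n in sequentially.
    \<forall>j\<in>{0..n}. \<bar>W j \<omega>\<bar> \<le> (1 + e) * (pi / sqrt 8) * chung_norm (V n)"
  from filterlim_eventually[OF V_lim eventually_lnln_ge[of 0]]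
  have "\<forall>\<^sub>F n in sequentially. (\<forall>j\<in>{0..n}. \<bar>W j \<omega>\<bar> \<le> (1 + e) * (pi / sqrt 8) * chung_norm (V n)) \<longrightarrow>
    (\<forall>j\<in>{0..n}. \<bar>W j \<omega>\<bar> \<le> (1 + e') * (pi / sqrt 8) * chung_norm (V n))"
  proof eventually_elim
    case (elim n)
    have "(1 + e) * (pi / sqrt 8) * chung_norm (V n) \<le> (1 + e') * (pi / sqrt 8) * chung_norm (V n)"
      using elim \<open>e \<le> e'\<close> V_nonneg by (intro mult_right_mono chung_norm_nonneg) auto
    then show ?case by (meson order_trans)
  qed
  then show "\<exists>\<^sub>F n in sequentially. \<forall>j\<in>{0..n}. \<bar>W j \<omega>\<bar> \<le> (1 + e') * (pi / sqrt 8) * chung_norm (V n)"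
    by (rule frequently_rev_mp[OF *])
qed

end

section \<open>Limit points and characteristic functions\<close>

lemma seq_limit_pointsI:
  assumes "\<And>e. 0 < e \<Longrightarrow> \<exists>\<^sub>F n in sequentially. \<bar>u n - l\<bar> < e"
  shows "l \<in> seq_limit_points u"
proof -
  have ex: "\<exists>n>m. \<bar>u n - l\<bar> < 1 / real (Suc k)" for m k :: nat
  proof -
    have "\<exists>\<^sub>F n in sequentially. \<bar>u n - l\<bar> < 1 / real (Suc k)" by (rule assms) simp
    then obtain n where "Suc m \<le> n" "\<bar>u n - l\<bar> < 1 / real (Suc k)"
      unfolding frequently_sequentially by blast
    then show ?thesis by (intro exI[of _ n]) auto
  qed
  have "\<exists>r. \<forall>k. \<bar>u (r k) - l\<bar> < 1 / real (Suc k) \<and> r k < r (Suc k)"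
    by (rule dependent_nat_choice) (use ex in blast)+
  then obtain r where r: "\<And>k. \<bar>u (r k) - l\<bar> < 1 / real (Suc k)" "\<And>k. r k < r (Suc k)" by blast
  have "strict_mono r" using r(2) by (simp add: strict_mono_Suc_iff)
  moreover have "(\<lambda>k. u (r k) - l) \<longlonglongrightarrow> 0"
  proof (rule tendsto_rabs_zero_cancel, rule tendsto_sandwich[OF _ _ tendsto_const])
    show "(\<lambda>k. 1 / real (Suc k)) \<longlonglongrightarrow> 0" by real_asymp
    show "\<forall>\<^sub>F k in sequentially. \<bar>u (r k) - l\<bar> \<le> 1 / real (Suc k)"
      by (intro always_eventually allI less_imp_le r(1))
  qed simp
  then have "(u \<circ> r) \<longlonglongrightarrow> l" by (simp add: LIM_zero_iff o_def)
  ultimately show ?thesis by (auto simp: seq_limit_points_def)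
qed

lemma seq_limit_points_cong:
  assumes "(\<lambda>n. u n - w n) \<longlonglongrightarrow> 0"
  shows "seq_limit_points u = seq_limit_points w"
proof -
  have "(u \<circ> r) \<longlonglongrightarrow> l \<longleftrightarrow> (w \<circ> r) \<longlonglongrightarrow> l" if "strict_mono r" for r l
  proof -
    have "(\<lambda>k. u (r k) - w (r k)) \<longlonglongrightarrow> 0"
      using LIMSEQ_subseq_LIMSEQ[OF assms that] by (simp add: o_def)
    then show ?thesis unfolding o_def by (rule Lim_transform_eq)
  qed
  then show ?thesis by (auto simp: seq_limit_points_def)
qed

text \<open>A real sequence with vanishing increments cannot jump over a point of
  \<open>[liminf, limsup]\<close>.\<close>

lemma seq_limit_points_interval:
  fixes u :: "nat \<Rightarrow> real"
  assumes up: "\<And>e. 0 < e \<Longrightarrow> \<forall>\<^sub>F n in sequentially. \<bar>u n\<bar> \<le> 1 + e"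
    and hi: "\<And>e. 0 < e \<Longrightarrow> \<exists>\<^sub>F n in sequentially. 1 - e \<le> u n"
    and lo: "\<And>e. 0 < e \<Longrightarrow> \<exists>\<^sub>F n in sequentially. u n \<le> - (1 - e)"
    and inc: "(\<lambda>n. u (Suc n) - u n) \<longlonglongrightarrow> 0"
  shows "seq_limit_points u = {-1..1}"
proof (intro equalityI subsetI)
  fix l assume "l \<in> seq_limit_points u"
  then obtain r where r: "strict_mono r" "(u \<circ> r) \<longlonglongrightarrow> l" by (auto simp: seq_limit_points_def)
  have "\<bar>l\<bar> \<le> 1 + e" if "0 < e" for e
  proof -
    have "\<forall>\<^sub>F k in sequentially. \<bar>(u \<circ> r) k\<bar> \<le> 1 + e"
      using filterlim_eventually[OF filterlim_subseq[OF r(1)] up[OF that]] by (simp add: o_def)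
    then show ?thesis using tendsto_upperbound[OF tendsto_rabs[OF r(2)]] by simp
  qed
  then have "\<bar>l\<bar> \<le> 1" by (rule field_le_epsilon)
  then show "l \<in> {-1..1}" by auto
next
  fix l :: real assume l: "l \<in> {-1..1}"
  show "l \<in> seq_limit_points u"
  proof (rule seq_limit_pointsI)
    fix e :: real assume e: "0 < e"
    show "\<exists>\<^sub>F n in sequentially. \<bar>u n - l\<bar> < e"
      unfolding frequently_sequentially
    proof
      fix N0
      obtain N1 where N1: "\<And>n. N1 \<le> n \<Longrightarrow> \<bar>u (Suc n) - u n\<bar> < e"
        using LIMSEQ_D[OF inc e] by auto
      define K where "K = max N0 N1"
      obtain a where a: "K \<le> a" "u a \<le> - (1 - e / 2)"
        using lo[of "e / 2"] e unfolding frequently_sequentially by auto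
      obtain b where b: "a \<le> b" "1 - e / 2 \<le> u b"
        using hi[of "e / 2"] e unfolding frequently_sequentially by auto
      \<comment> \<open>The first index from \<open>a\<close> on at which \<open>u\<close> exceeds
        \<open>l - e\<close>. Unless it is \<open>a\<close> itself, its predecessor is still at or
        below \<open>l - e\<close>, and one increment, smaller than \<open>e\<close>, cannot carry
        the sequence to \<open>l + e\<close>.\<close>
      define n where "n = (LEAST n. a \<le> n \<and> l - e < u n)"
      have "a \<le> b \<and> l - e < u b" using b e l by auto
      then have n: "a \<le> n" "l - e < u n" unfolding n_def by (metis (mono_tags, lifting) LeastI)+
      have "u n < l + e"
      proof (cases "n = a")
        case True
        then show ?thesis using a e l by auto
      next
        case False
        then obtain m where m: "n = Suc m" "a \<le> m" using n by (cases n) auto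
        have "\<not> l - e < u m"
          using not_less_Least[of m "\<lambda>n. a \<le> n \<and> l - e < u n"] m unfolding n_def[symmetric] by simp
        moreover have "\<bar>u (Suc m) - u m\<bar> < e" using m a by (intro N1) (simp add: K_def)
        ultimately show ?thesis using e by (simp add: m abs_less_iff)
      qed
      then have "\<bar>u n - l\<bar> < e" using n by (simp add: abs_less_iff)
      moreover have "N0 \<le> n" using n a by (simp add: K_def)
      ultimately show "\<exists>n\<ge>N0. \<bar>u n - l\<bar> < e" by blast
    qed
  qed
qed

lemma liminf_ereal_eqI:
  fixes x :: "nat \<Rightarrow> real"
  assumes lo: "\<And>e. 0 < e \<Longrightarrow> \<forall>\<^sub>F n in sequentially. l - e \<le> x n"
    and hi: "\<And>e. 0 < e \<Longrightarrow> \<exists>\<^sub>F n in sequentially. x n \<le> l + e"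
  shows "liminf (\<lambda>n. ereal (x n)) = ereal l"
proof (rule antisym)
  show "ereal l \<le> liminf (\<lambda>n. ereal (x n))"
    unfolding le_Liminf_iff
  proof (intro allI impI)
    fix y assume "y < ereal l"
    then obtain r where r: "y < ereal r" "r < l" using ereal_dense2[of y "ereal l"] by auto
    from lo[of "l - r"] r(2) have "\<forall>\<^sub>F n in sequentially. r \<le> x n" by simp
    then show "\<forall>\<^sub>F n in sequentially. y < ereal (x n)"
      by (rule eventually_mono) (use r(1) in \<open>auto intro: less_le_trans\<close>)
  qed
  show "liminf (\<lambda>n. ereal (x n)) \<le> ereal l"
  proof (rule ccontr)
    assume "\<not> liminf (\<lambda>n. ereal (x n)) \<le> ereal l"
    then have "ereal l < liminf (\<lambda>n. ereal (x n))" by (simp only: not_le)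
    from ereal_dense2[OF this] obtain r where r: "l < r" "ereal r < liminf (\<lambda>n. ereal (x n))"
      by auto
    from less_LiminfD[OF r(2)] have "\<forall>\<^sub>F n in sequentially. r < x n" by simp
    then have "\<forall>\<^sub>F n in sequentially. x n \<le> l + (r - l) \<longrightarrow> False" by (rule eventually_mono) simp
    moreover have "\<exists>\<^sub>F n in sequentially. x n \<le> l + (r - l)" using r by (intro hi) simp
    ultimately have "\<exists>\<^sub>F n::nat in sequentially. False" by (rule frequently_rev_mp[rotated])
    then show False by simp
  qed
qed

text \<open>Slutsky's argument for deterministic sequences: an additive o(1) and a factor 1 + o(1)
  do not matter for an eventually bounded sequence. It covers both the step from one index to the
  next and the passage from the martingale with its variance to \<open>S\<close> and
  \<open>s2\<close>.\<close>

lemma tendsto_perturbed_diff: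
  fixes w \<epsilon> q :: "nat \<Rightarrow> real"
  assumes "\<forall>\<^sub>F n in sequentially. \<bar>w n\<bar> \<le> B" "\<epsilon> \<longlonglongrightarrow> 0" "q \<longlonglongrightarrow> 1"
  shows "(\<lambda>n. (w n + \<epsilon> n) * q n - w n) \<longlonglongrightarrow> 0"
proof -
  have "(\<lambda>n. w n * (q n - 1)) \<longlonglongrightarrow> 0"
  proof (rule tendsto_rabs_zero_cancel, rule tendsto_sandwich[OF _ _ tendsto_const])
    show "(\<lambda>n. B * \<bar>q n - 1\<bar>) \<longlonglongrightarrow> 0"
      using assms(3) by (auto intro!: tendsto_eq_intros)
    show "\<forall>\<^sub>F n in sequentially. \<bar>w n * (q n - 1)\<bar> \<le> B * \<bar>q n - 1\<bar>"
      using assms(1) by eventually_elim (simp add: abs_mult mult_right_mono)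
  qed simp
  from tendsto_add[OF this tendsto_mult[OF assms(2,3)]] show ?thesis
    by (simp add: algebra_simps)
qed

section \<open>Stability of the norms under asymptotically equal variances\<close>

context
  fixes f g :: "nat \<Rightarrow> real"
  assumes fg: "(\<lambda>n. f n / g n) \<longlonglongrightarrow> 1" and g: "filterlim g at_top sequentially"
begin

text \<open>Eventually \<open>f n\<close> lies between half and twice \<open>g n\<close>, and the
  iterated logarithm is insensitive to constant factors.\<close>

lemma lnln_ratio: "(\<lambda>n. ln (ln (f n)) / ln (ln (g n))) \<longlonglongrightarrow> 1"
proof (rule tendsto_sandwich)
  have lnln_pos: "\<forall>\<^sub>F x::real in at_top. 0 < ln (ln x)" by real_asymp
  have lo: "((\<lambda>x::real. ln (ln (1 / 2 * x)) / ln (ln x)) \<longlongrightarrow> 1) at_top" by real_asymp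
  have hi: "((\<lambda>x::real. ln (ln (2 * x)) / ln (ln x)) \<longlongrightarrow> 1) at_top" by real_asymp
  show "(\<lambda>n. ln (ln (1 / 2 * g n)) / ln (ln (g n))) \<longlonglongrightarrow> 1" using filterlim_compose[OF lo g] .
  show "(\<lambda>n. ln (ln (2 * g n)) / ln (ln (g n))) \<longlonglongrightarrow> 1" using filterlim_compose[OF hi g] .
  have 1: "\<forall>\<^sub>F n in sequentially. 1 / 2 < f n / g n" "\<forall>\<^sub>F n in sequentially. f n / g n < 2"
    by (rule order_tendstoD[OF fg]; simp)+
  have 2: "\<forall>\<^sub>F n in sequentially. 2 < g n" "\<forall>\<^sub>F n in sequentially. 0 < ln (ln (g n))"
    using filterlim_eventually[OF g eventually_gt_at_top] filterlim_eventually[OF g lnln_pos]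
    by blast+
  show "\<forall>\<^sub>F n in sequentially. ln (ln (1 / 2 * g n)) / ln (ln (g n)) \<le> ln (ln (f n)) / ln (ln (g n))"
    using 1(1) 2
  proof eventually_elim
    case (elim n)
    then have "1 / 2 * g n \<le> f n" by (simp add: field_simps)
    then have "ln (ln (1 / 2 * g n)) \<le> ln (ln (f n))" using elim by (intro lnln_mono) auto
    then show ?case using elim by (intro divide_right_mono) auto
  qed
  show "\<forall>\<^sub>F n in sequentially. ln (ln (f n)) / ln (ln (g n)) \<le> ln (ln (2 * g n)) / ln (ln (g n))"
    using 1 2
  proof eventually_elim
    case (elim n)
    then have "f n \<le> 2 * g n" "1 < f n" by (auto simp: field_simps)
    then have "ln (ln (f n)) \<le> ln (ln (2 * g n))" by (intro lnln_mono)
    then show ?case using elim by (intro divide_right_mono) auto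
  qed
qed

lemma lil_norm_ratio: "(\<lambda>n. lil_norm (f n) / lil_norm (g n)) \<longlonglongrightarrow> 1"
proof -
  have "(\<lambda>n. sqrt ((f n / g n) * (ln (ln (f n)) / ln (ln (g n))))) \<longlonglongrightarrow> sqrt (1 * 1)"
    by (intro tendsto_intros fg lnln_ratio)
  then show ?thesis by (simp add: lil_norm_def real_sqrt_mult real_sqrt_divide)
qed

lemma chung_norm_ratio: "(\<lambda>n. chung_norm (f n) / chung_norm (g n)) \<longlonglongrightarrow> 1"
proof -
  have "(\<lambda>n. sqrt ((f n / g n) / (ln (ln (f n)) / ln (ln (g n))))) \<longlonglongrightarrow> sqrt (1 / 1)"
    by (intro tendsto_intros fg lnln_ratio) auto
  then show ?thesis by (simp add: chung_norm_def real_sqrt_mult real_sqrt_divide mult.commute)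
qed

end

context det_var_mds
begin

text \<open>The phase \<open>\<phi>\<close> treats cosine and sine simultaneously.\<close>

lemma char_bound:
  assumes bD: "\<And>k \<omega>. k < N \<Longrightarrow> \<omega> \<in> space M \<Longrightarrow> \<bar>D k \<omega>\<bar> \<le> d" and "0 \<le> d" and "n \<le> N"
  shows "\<bar>expectation (\<lambda>\<omega>. cos (t * W n \<omega> + \<phi>)) - exp (- t\<^sup>2 / 2 * V n) * cos \<phi>\<bar>
    \<le> (\<bar>t\<bar> ^ 3 * d + t ^ 4 * d\<^sup>2) * V n"
  using \<open>n \<le> N\<close>
proof (induction n)
  case 0
  then show ?case by (simp add: prob_space)
next
  case (Suc n)
  define c where "c = expectation (\<lambda>\<omega>. cos (t * W n \<omega> + \<phi>))"
  define c' where "c' = expectation (\<lambda>\<omega>. cos (t * W (Suc n) \<omega> + \<phi>))"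
  define x where "x = t\<^sup>2 / 2 * v n"
  have Dd: "\<bar>D n \<omega>\<bar> \<le> d" if "\<omega> \<in> space M" for \<omega> using bD that Suc.prems by simp
  have vd: "v n \<le> d\<^sup>2" using Dd by (rule v_le)
  have x0: "0 \<le> x" using v_nonneg by (simp add: x_def)
  have cM: "bdd_meas M (\<lambda>\<omega>. cos (t * W (Suc n) \<omega> + \<phi>))"
    by (intro bdd_meas_intros bdd_meas_W_M)
  \<comment> \<open>The free constant \<open>a\<close> lets the same facts serve both one-step
    estimates, with \<open>a = \<delta>\<close> and \<open>a = - \<delta>\<close>.\<close>
  have F: "bdd_meas (F n) (\<lambda>\<omega>. cos (t * W n \<omega> + \<phi>))"
    "bdd_meas (F n) (\<lambda>\<omega>. - t * sin (t * W n \<omega> + \<phi>))"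
    "bdd_meas (F n) (\<lambda>\<omega>. - (t\<^sup>2 / 2) * cos (t * W n \<omega> + \<phi>) + a)" for a
    by (intro bdd_meas_intros bdd_meas_W order_refl)+
  define \<delta> where "\<delta> = \<bar>t\<bar> ^ 3 * d / 6"
  have tay: "\<bar>cos (t * W (Suc n) \<omega> + \<phi>) - (cos (t * W n \<omega> + \<phi>) + - t * sin (t * W n \<omega> + \<phi>) * D n \<omega>
      + - (t\<^sup>2 / 2) * cos (t * W n \<omega> + \<phi>) * (D n \<omega>)\<^sup>2)\<bar> \<le> \<delta> * (D n \<omega>)\<^sup>2" if "\<omega> \<in> space M" for \<omega>
  proof -
    have "\<bar>t * D n \<omega>\<bar> ^ 3 = \<bar>t\<bar> ^ 3 * (\<bar>D n \<omega>\<bar> * \<bar>D n \<omega>\<bar>\<^sup>2)"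
      by (simp only: abs_mult power3_eq_cube power2_eq_square mult_ac)
    also have "\<bar>D n \<omega>\<bar>\<^sup>2 = (D n \<omega>)\<^sup>2" by simp
    also have "\<bar>t\<bar> ^ 3 * (\<bar>D n \<omega>\<bar> * (D n \<omega>)\<^sup>2) \<le> \<bar>t\<bar> ^ 3 * (d * (D n \<omega>)\<^sup>2)"
      using Dd[OF that] by (intro mult_left_mono mult_right_mono) auto
    finally have "\<bar>t * D n \<omega>\<bar> ^ 3 / 6 \<le> \<bar>t\<bar> ^ 3 * (d * (D n \<omega>)\<^sup>2) / 6"
      by (rule divide_right_mono) simp
    also have "\<dots> = \<delta> * (D n \<omega>)\<^sup>2" by (simp add: \<delta>_def)
    finally have "\<bar>t * D n \<omega>\<bar> ^ 3 / 6 \<le> \<delta> * (D n \<omega>)\<^sup>2" .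
    moreover have "t * W (Suc n) \<omega> + \<phi> = (t * W n \<omega> + \<phi>) + t * D n \<omega>" by (simp add: W_Suc algebra_simps)
    ultimately show ?thesis
      using cos_taylor2[of "t * W n \<omega> + \<phi>" "t * D n \<omega>"] by (simp add: power_mult_distrib algebra_simps)
  qed
  have split: "expectation (\<lambda>\<omega>. - (t\<^sup>2 / 2) * cos (t * W n \<omega> + \<phi>) + a) = - (t\<^sup>2 / 2) * c + a" for a
  proof -
    have "integrable M (\<lambda>\<omega>. - (t\<^sup>2 / 2) * cos (t * W n \<omega> + \<phi>))"
      by (intro bdd_meas_integrable bdd_meas_intros bdd_meas_W_M)
    from Bochner_Integration.integral_add[OF this integrable_const[of a]] show ?thesis
      unfolding integral_mult_right_zero c_def[symmetric] by (simp add: prob_space)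
  qed
  have "c' \<le> c + v n * expectation (\<lambda>\<omega>. - (t\<^sup>2 / 2) * cos (t * W n \<omega> + \<phi>) + \<delta>)"
    unfolding c'_def c_def
  proof (rule one_step_le[OF cM F(1) F(2) F(3)])
    fix \<omega> assume "\<omega> \<in> space M"
    from tay[OF this] show "cos (t * W (Suc n) \<omega> + \<phi>) \<le> cos (t * W n \<omega> + \<phi>) + - t * sin (t * W n \<omega> + \<phi>) * D n \<omega>
        + (- (t\<^sup>2 / 2) * cos (t * W n \<omega> + \<phi>) + \<delta>) * (D n \<omega>)\<^sup>2"
      unfolding distrib_right by linarith
  qed
  moreover have "c + v n * expectation (\<lambda>\<omega>. - (t\<^sup>2 / 2) * cos (t * W n \<omega> + \<phi>) + - \<delta>) \<le> c'"
    unfolding c'_def c_def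
  proof (rule one_step_ge[OF cM F(1) F(2) F(3)])
    fix \<omega> assume "\<omega> \<in> space M"
    from tay[OF this] show "cos (t * W n \<omega> + \<phi>) + - t * sin (t * W n \<omega> + \<phi>) * D n \<omega>
        + (- (t\<^sup>2 / 2) * cos (t * W n \<omega> + \<phi>) + - \<delta>) * (D n \<omega>)\<^sup>2 \<le> cos (t * W (Suc n) \<omega> + \<phi>)"
      unfolding distrib_right by linarith
  qed
  ultimately have 1: "\<bar>c' - (1 - x) * c\<bar> \<le> \<delta> * v n"
    unfolding split by (simp add: x_def abs_le_iff algebra_simps)
  \<comment> \<open>Up to the Taylor error the one-step factor is \<open>1 - x\<close>, while the
    Gaussian one is \<open>exp (- x)\<close>. They differ to second order in the step variance;
    summed over all steps this costs at most \<open>t ^ 4 * d\<^sup>2 * V n\<close>.\<close>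
  have 2: "\<bar>((1 - x) - exp (- x)) * c\<bar> \<le> x\<^sup>2"
  proof -
    have "\<bar>c\<bar> \<le> 1"
    proof -
      have "\<bar>c\<bar> \<le> expectation (\<lambda>\<omega>. \<bar>cos (t * W n \<omega> + \<phi>)\<bar>)" unfolding c_def by (rule integral_abs_bound)
      also have "\<dots> \<le> expectation (\<lambda>_. 1)"
      proof (rule integral_mono)
        show "integrable M (\<lambda>\<omega>. \<bar>cos (t * W n \<omega> + \<phi>)\<bar>)"
          by (intro integrable_abs bdd_meas_integrable bdd_meas_intros bdd_meas_W_M)
      qed auto
      finally show ?thesis by (simp add: prob_space)
    qed
    moreover have "\<bar>(1 - x) - exp (- x)\<bar> \<le> x\<^sup>2"
    proof (cases "x \<le> 1")
      case True
      have "exp (- x) \<le> 1 + (- x) + (1 + 1) * (- x)\<^sup>2 / 2"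
        using True x0 by (intro exp_taylor2_bounds(1)) auto
      moreover have "1 - x \<le> exp (- x)" using exp_ge_add_one_self[of "- x"] by simp
      ultimately show ?thesis by (simp add: abs_le_iff)
    next
      case False
      then have "x * 1 \<le> x * x" by (intro mult_left_mono) auto
      moreover have "exp (- x) \<le> 1" "0 < exp (- x)" using x0 by auto
      moreover have "1 - x \<le> exp (- x)" using exp_ge_add_one_self[of "- x"] by simp
      ultimately show ?thesis unfolding abs_le_iff power2_eq_square by linarith
    qed
    ultimately show ?thesis unfolding abs_mult using mult_mono[of "\<bar>(1 - x) - exp (- x)\<bar>" "x\<^sup>2" "\<bar>c\<bar>" 1] by simp
  qed
  have 3: "x\<^sup>2 \<le> t ^ 4 * d\<^sup>2 * v n"
  proof -
    have "x\<^sup>2 = (t ^ 4 * v n) * (v n / 4)" by (simp add: x_def eval_nat_numeral)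
    also have "\<dots> \<le> (t ^ 4 * v n) * d\<^sup>2"
    proof (rule mult_left_mono)
      show "v n / 4 \<le> d\<^sup>2" using vd v_nonneg[of n] by linarith
    qed (use v_nonneg[of n] in auto)
    finally show ?thesis by (simp add: mult_ac)
  qed
  have 4: "\<delta> * v n \<le> \<bar>t\<bar> ^ 3 * d * v n"
    using v_nonneg[of n] \<open>0 \<le> d\<close> by (intro mult_right_mono) (auto simp: \<delta>_def)
  define E where "E = c - exp (- t\<^sup>2 / 2 * V n) * cos \<phi>"
  have 5: "\<bar>exp (- x) * E\<bar> \<le> \<bar>E\<bar>" unfolding abs_mult using x0 by (simp add: mult_left_le_one_le)
  have IH: "\<bar>E\<bar> \<le> (\<bar>t\<bar> ^ 3 * d + t ^ 4 * d\<^sup>2) * V n" using Suc unfolding E_def c_def by simp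
  have "exp (- t\<^sup>2 / 2 * V (Suc n)) = exp (- x) * exp (- t\<^sup>2 / 2 * V n)"
    by (simp add: x_def V_Suc algebra_simps flip: exp_add)
  \<comment> \<open>Telescoping: the new error is the Taylor error, plus the replacement of the
    factor, plus the old error contracted by \<open>exp (- x)\<close>.\<close>
  then have "c' - exp (- t\<^sup>2 / 2 * V (Suc n)) * cos \<phi>
      = (c' - (1 - x) * c) + ((1 - x) - exp (- x)) * c + exp (- x) * E"
    by (simp add: E_def algebra_simps)
  then have "\<bar>c' - exp (- t\<^sup>2 / 2 * V (Suc n)) * cos \<phi>\<bar> \<le> \<bar>c' - (1 - x) * c\<bar> + \<bar>((1 - x) - exp (- x)) * c\<bar> + \<bar>exp (- x) * E\<bar>"
    by linarith
  also have "\<dots> \<le> \<bar>t\<bar> ^ 3 * d * v n + t ^ 4 * d\<^sup>2 * v n + (\<bar>t\<bar> ^ 3 * d + t ^ 4 * d\<^sup>2) * V n"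
    using 1 2 3 4 5 IH by linarith
  also have "\<dots> = (\<bar>t\<bar> ^ 3 * d + t ^ 4 * d\<^sup>2) * V (Suc n)" by (simp add: V_Suc algebra_simps)
  finally show ?case unfolding c'_def .
qed

end

section \<open>Transfer to perturbed martingales\<close>

text \<open>One function \<open>h\<close> bounds both the jumps and the distance to the martingale,
  because in the application both are governed by the same weight \<open>b (Suc n)\<close>.\<close>

locale perturbed_mds = growing_mds M F D v h
  for M :: "'a measure" and F :: "nat \<Rightarrow> 'a measure" and D :: "nat \<Rightarrow> 'a \<Rightarrow> real"
    and v :: "nat \<Rightarrow> real" and h :: "real \<Rightarrow> real" +
  fixes S :: "nat \<Rightarrow> 'a \<Rightarrow> real"
  assumes S_measurable [measurable]: "S n \<in> borel_measurable M"
    and S_close: "\<omega> \<in> space M \<Longrightarrow> \<bar>S n \<omega> - W n \<omega>\<bar> \<le> h (V (Suc n))"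
begin

definition s2 :: "nat \<Rightarrow> real" where "s2 n = expectation (\<lambda>\<omega>. (S n \<omega>)\<^sup>2)"
definition \<rho> :: "nat \<Rightarrow> real" where "\<rho> n = h (V (Suc n))"

lemma \<rho>_nonneg: "0 \<le> \<rho> n" and \<rho>_mono: "m \<le> n \<Longrightarrow> \<rho> m \<le> \<rho> n"
  unfolding \<rho>_def using h_nonneg V_nonneg h_mono V_mono by auto

lemma D_le_\<rho>: "\<omega> \<in> space M \<Longrightarrow> k \<le> n \<Longrightarrow> \<bar>D k \<omega>\<bar> \<le> \<rho> n"
  using D_le[of \<omega> k] \<rho>_mono[of k n] by (simp add: \<rho>_def)

lemma V_Suc_lim: "filterlim (\<lambda>n. V (Suc n)) at_top sequentially"
  by (rule filterlim_compose[OF V_lim filterlim_Suc])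

text \<open>A step variance is at most the square of the jump bound, hence negligible against the
  total. This allows the shifted argument \<open>V (Suc n)\<close> of \<open>h\<close> to be traded
  for \<open>V n\<close>.\<close>

lemma V_Suc_ratio: "(\<lambda>n. V (Suc n) / V n) \<longlonglongrightarrow> 1"
proof -
  have pos: "\<forall>\<^sub>F n in sequentially. 0 < V (Suc n)"
    by (rule filterlim_eventually[OF V_Suc_lim eventually_gt_at_top])
  have "(\<lambda>n. v n / V (Suc n)) \<longlonglongrightarrow> 0"
  proof (rule tendstoI)
    fix e :: real assume "0 < e"
    then have "\<forall>\<^sub>F n in sequentially. (h (V (Suc n)))\<^sup>2 \<le> e / 2 * V (Suc n)"
      by (intro filterlim_eventually[OF V_Suc_lim eventually_h_sq_le]) auto
    then show "\<forall>\<^sub>F n in sequentially. dist (v n / V (Suc n)) 0 < e" using pos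
    proof eventually_elim
      case (elim n)
      have "v n \<le> (h (V (Suc n)))\<^sup>2" using D_le by (rule v_le)
      also have "\<dots> \<le> e / 2 * V (Suc n)" using elim by simp
      also have "\<dots> < e * V (Suc n)" using elim \<open>0 < e\<close> by simp
      finally show ?case using elim v_nonneg[of n] by (simp add: divide_less_eq)
    qed
  qed
  then have "(\<lambda>n. inverse (1 - v n / V (Suc n))) \<longlonglongrightarrow> inverse (1 - 0)"
    by (intro tendsto_intros) auto
  then have "(\<lambda>n. inverse (1 - v n / V (Suc n))) \<longlonglongrightarrow> 1" by simp
  moreover have "\<forall>\<^sub>F n in sequentially. inverse (1 - v n / V (Suc n)) = V (Suc n) / V n"
    using pos
  proof eventually_elim
    case (elim n)
    then have "1 - v n / V (Suc n) = V n / V (Suc n)" by (simp add: V_Suc field_simps)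
    then show ?case by simp
  qed
  ultimately show ?thesis by (rule Lim_transform_eventually)
qed

lemma \<rho>_chung: "(\<lambda>n. \<rho> n / chung_norm (V n)) \<longlonglongrightarrow> 0"
proof -
  have "(\<lambda>n. h (V (Suc n)) * sqrt (ln (ln (V (Suc n))) / V (Suc n))) \<longlonglongrightarrow> 0"
    using filterlim_compose[OF h_small V_Suc_lim] .
  then have "(\<lambda>n. \<rho> n / chung_norm (V (Suc n))) \<longlonglongrightarrow> 0"
    by (simp add: \<rho>_def chung_norm_def real_sqrt_divide)
  from tendsto_mult[OF this chung_norm_ratio[OF V_Suc_ratio V_lim]]
  have "(\<lambda>n. \<rho> n / chung_norm (V (Suc n)) * (chung_norm (V (Suc n)) / chung_norm (V n))) \<longlonglongrightarrow> 0" by simp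
  moreover have "\<forall>\<^sub>F x in at_top. 0 < chung_norm x" unfolding chung_norm_def by real_asymp
  from filterlim_eventually[OF V_Suc_lim this]
  have "\<forall>\<^sub>F n in sequentially. \<rho> n / chung_norm (V (Suc n)) * (chung_norm (V (Suc n)) / chung_norm (V n))
      = \<rho> n / chung_norm (V n)"
    by eventually_elim simp
  ultimately show ?thesis by (rule Lim_transform_eventually)
qed

lemma \<rho>_over:
  assumes "((\<lambda>x. chung_norm x / g x) \<longlongrightarrow> 0) at_top"
  shows "(\<lambda>n. \<rho> n / g (V n)) \<longlonglongrightarrow> 0"
proof -
  from tendsto_mult[OF \<rho>_chung filterlim_compose[OF assms V_lim]]
  have "(\<lambda>n. \<rho> n / chung_norm (V n) * (chung_norm (V n) / g (V n))) \<longlonglongrightarrow> 0" by simp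
  moreover have "\<forall>\<^sub>F x in at_top. 0 < chung_norm x" unfolding chung_norm_def by real_asymp
  from filterlim_eventually[OF V_lim this]
  have "\<forall>\<^sub>F n in sequentially. \<rho> n / chung_norm (V n) * (chung_norm (V n) / g (V n)) = \<rho> n / g (V n)"
    by eventually_elim simp
  ultimately show ?thesis by (rule Lim_transform_eventually)
qed

lemma \<rho>_lil: "(\<lambda>n. \<rho> n / lil_norm (V n)) \<longlonglongrightarrow> 0"
  by (rule \<rho>_over) (unfold chung_norm_def lil_norm_def, real_asymp)

lemma \<rho>_sqrt: "(\<lambda>n. \<rho> n / sqrt (V n)) \<longlonglongrightarrow> 0"
  by (rule \<rho>_over) (unfold chung_norm_def, real_asymp)

lemma bdd_meas_S: "bdd_meas M (S n)"
proof -
  have "bdd_meas M (\<lambda>\<omega>. S n \<omega> - W n \<omega>)"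
    using S_close by (intro bdd_measI) auto
  from bdd_meas_add[OF this bdd_meas_W_M[of n]] show ?thesis by simp
qed

text \<open>The cross term 2 W r, with r the difference of \<open>S\<close> and \<open>W\<close>, is
  split by Young's inequality into e W^2 + r^2 / e. No correlation has to be computed;
  \<open>e\<close> stays free and is fixed before \<open>n\<close> grows.\<close>

lemma s2_close:
  assumes "0 < e"
  shows "\<bar>s2 n - V n\<bar> \<le> e * V n + (1 + 1 / e) * (\<rho> n)\<^sup>2"
proof -
  have pw: "\<bar>(S n \<omega>)\<^sup>2 - (W n \<omega>)\<^sup>2\<bar> \<le> e * (W n \<omega>)\<^sup>2 + (1 + 1 / e) * (\<rho> n)\<^sup>2" if "\<omega> \<in> space M" for \<omega>
  proof -
    define r where "r = S n \<omega> - W n \<omega>"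
    have r: "\<bar>r\<bar> \<le> \<rho> n" using S_close[OF that] by (simp add: r_def \<rho>_def)
    then have r2: "r\<^sup>2 \<le> (\<rho> n)\<^sup>2" using \<rho>_nonneg by (simp add: abs_le_square_iff[symmetric])
    have "(S n \<omega>)\<^sup>2 - (W n \<omega>)\<^sup>2 = 2 * (W n \<omega> * r) + r\<^sup>2"
      by (simp add: r_def power2_eq_square algebra_simps)
    moreover have "2 * \<bar>W n \<omega> * r\<bar> \<le> e * (W n \<omega>)\<^sup>2 + r\<^sup>2 / e"
    proof -
      have "0 \<le> (e * \<bar>W n \<omega>\<bar> - \<bar>r\<bar>)\<^sup>2 / e" using assms by simp
      also have "\<dots> = e * (W n \<omega>)\<^sup>2 + r\<^sup>2 / e - 2 * \<bar>W n \<omega> * r\<bar>"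
        using assms by (simp add: power2_diff abs_mult field_simps power2_eq_square)
      finally show ?thesis by simp
    qed
    moreover have "r\<^sup>2 / e \<le> (\<rho> n)\<^sup>2 / e" using r2 assms by (simp add: divide_right_mono)
    ultimately have "\<bar>(S n \<omega>)\<^sup>2 - (W n \<omega>)\<^sup>2\<bar> \<le> e * (W n \<omega>)\<^sup>2 + (\<rho> n)\<^sup>2 / e + (\<rho> n)\<^sup>2"
      using r2 zero_le_power2[of r] by linarith
    then show ?thesis by (simp add: algebra_simps)
  qed
  have "s2 n - V n = expectation (\<lambda>\<omega>. (S n \<omega>)\<^sup>2 - (W n \<omega>)\<^sup>2)"
    unfolding s2_def expectation_W_sq[symmetric]
    by (rule Bochner_Integration.integral_diff[symmetric])
       (intro bdd_meas_integrable bdd_meas_intros bdd_meas_S bdd_meas_W_M)+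
  also have "\<bar>\<dots>\<bar> \<le> expectation (\<lambda>\<omega>. \<bar>(S n \<omega>)\<^sup>2 - (W n \<omega>)\<^sup>2\<bar>)" by (rule integral_abs_bound)
  also have "\<dots> \<le> expectation (\<lambda>\<omega>. e * (W n \<omega>)\<^sup>2 + (1 + 1 / e) * (\<rho> n)\<^sup>2)"
    using pw by (intro integral_mono integrable_abs)
      (auto intro!: bdd_meas_integrable bdd_meas_intros bdd_meas_S bdd_meas_W_M)
  also have "\<dots> = e * V n + (1 + 1 / e) * (\<rho> n)\<^sup>2"
  proof -
    have "integrable M (\<lambda>\<omega>. e * (W n \<omega>)\<^sup>2)"
      by (intro bdd_meas_integrable bdd_meas_intros bdd_meas_W_M)
    from Bochner_Integration.integral_add[OF this integrable_const[of "(1 + 1 / e) * (\<rho> n)\<^sup>2"]]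
    show ?thesis unfolding integral_mult_right_zero expectation_W_sq by (simp add: prob_space)
  qed
  finally show ?thesis .
qed

lemma s2_ratio: "(\<lambda>n. s2 n / V n) \<longlonglongrightarrow> 1"
proof -
  have pos: "\<forall>\<^sub>F n in sequentially. 0 < V n"
    by (rule filterlim_eventually[OF V_lim eventually_gt_at_top])
  have "(\<lambda>n. s2 n / V n - 1) \<longlonglongrightarrow> 0"
  proof (rule tendstoI)
    fix e :: real assume e: "0 < e"
    define e' where "e' = e / 3"
    define c where "c = 1 + 1 / e'"
    have c: "0 < c" and e': "0 < e'" using e by (auto simp: c_def e'_def intro: add_pos_pos)
    have sq: "(\<lambda>n. (\<rho> n / sqrt (V n))\<^sup>2) \<longlonglongrightarrow> 0\<^sup>2" by (intro tendsto_intros \<rho>_sqrt)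
    have "\<forall>\<^sub>F n in sequentially. (\<rho> n / sqrt (V n))\<^sup>2 < e' / c"
      using c e' by (intro order_tendstoD(2)[OF sq]) auto
    then show "\<forall>\<^sub>F n in sequentially. dist (s2 n / V n - 1) 0 < e" using pos
    proof eventually_elim
      case (elim n)
      then have "(\<rho> n)\<^sup>2 < e' / c * V n" by (simp add: power_divide divide_less_eq)
      then have "c * (\<rho> n)\<^sup>2 < c * (e' / c * V n)" using c by (rule mult_strict_left_mono)
      then have "\<bar>s2 n - V n\<bar> < e' * V n + e' * V n"
        using s2_close[OF e', of n] c by (simp add: c_def[symmetric])
      also have "\<dots> \<le> e * V n" using elim e by (simp add: e'_def)
      finally have "\<bar>s2 n - V n\<bar> / V n < e" using elim by (simp add: divide_less_eq)
      moreover have "s2 n / V n - 1 = (s2 n - V n) / V n" using elim by (simp add: field_simps)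
      ultimately show ?case using elim by simp
    qed
  qed
  then show ?thesis by (simp add: LIM_zero_iff)
qed

lemma s2_pos: "\<forall>\<^sub>F n in sequentially. 0 < s2 n"
proof -
  have "\<forall>\<^sub>F n in sequentially. 0 < s2 n / V n" by (rule order_tendstoD(1)[OF s2_ratio]) simp
  then show ?thesis using filterlim_eventually[OF V_lim eventually_gt_at_top[of 0]]
    by eventually_elim (simp add: zero_less_divide_iff)
qed

lemma inverse_ratio:
  assumes "(\<lambda>n. g (s2 n) / g (V n)) \<longlonglongrightarrow> (1::real)"
  shows "(\<lambda>n. g (V n) / g (s2 n)) \<longlonglongrightarrow> 1"
  using tendsto_inverse[OF assms] by simp

text \<open>The interval lemma is applied to \<open>w\<close>, the martingale divided by its own
  norm; its increments vanish because a single jump and the change of the norm are both negligible.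
  Passing to \<open>S\<close> and \<open>s2\<close> only adds a null sequence, which keeps the limit
  points.\<close>

theorem perturbed_lil:
  "AE \<omega> in M. seq_limit_points (\<lambda>n. S n \<omega> / lil_norm (s2 n)) = {-1..1}"
proof -
  interpret neg: growing_mds M F "\<lambda>k \<omega>. - D k \<omega>" v h by (rule uminus_growing)
  have negW: "neg.W j \<omega> = - W j \<omega>" for j \<omega> by (simp add: neg.W_def W_def sum_negf)
  have "\<forall>\<^sub>F x in at_top. 0 < lil_norm x" unfolding lil_norm_def by real_asymp
  from filterlim_eventually[OF V_lim this]
  have lpos: "\<forall>\<^sub>F n in sequentially. 0 < lil_norm (V n)" .
  show ?thesis
    using lil_upper lil_lower neg.lil_upper[unfolded negW] neg.lil_lower[unfolded negW] AE_space
  proof eventually_elim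
    case (elim \<omega>)
    define w where "w = (\<lambda>n. W n \<omega> / lil_norm (V n))"
    have up: "\<forall>\<^sub>F n in sequentially. \<bar>w n\<bar> \<le> 1 + e" if "0 < e" for e
    proof -
      from elim(1,3) that
      have "\<forall>\<^sub>F n in sequentially. W n \<omega> \<le> (1 + e) * lil_norm (V n)"
        "\<forall>\<^sub>F n in sequentially. - W n \<omega> \<le> (1 + e) * lil_norm (V n)" by blast+
      then show ?thesis using lpos
        by eventually_elim (simp add: w_def divide_le_eq abs_le_iff minus_divide_left)
    qed
    have "\<exists>\<^sub>F n in sequentially. 1 - e \<le> w n" if "0 < e" for e
    proof -
      from lpos have "\<forall>\<^sub>F n in sequentially. (1 - e) * lil_norm (V n) \<le> W n \<omega> \<longrightarrow> 1 - e \<le> w n"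
        by eventually_elim (simp add: w_def le_divide_eq)
      then show ?thesis by (rule frequently_rev_mp[OF elim(2)[rule_format, OF that]])
    qed
    moreover have "\<exists>\<^sub>F n in sequentially. w n \<le> - (1 - e)" if "0 < e" for e
    proof -
      from lpos have "\<forall>\<^sub>F n in sequentially. (1 - e) * lil_norm (V n) \<le> - W n \<omega> \<longrightarrow> w n \<le> - (1 - e)"
      proof eventually_elim
        case (elim n)
        have "w n \<le> - (1 - e) \<longleftrightarrow> W n \<omega> \<le> - (1 - e) * lil_norm (V n)"
          unfolding w_def using elim by (rule pos_divide_le_eq)
        moreover have "- (1 - e) * lil_norm (V n) = - ((1 - e) * lil_norm (V n))" by (rule mult_minus_left)
        ultimately show ?case by linarith
      qed
      then show ?thesis by (rule frequently_rev_mp[OF elim(4)[rule_format, OF that]])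
    qed
    moreover have bd: "\<forall>\<^sub>F n in sequentially. \<bar>w n\<bar> \<le> 2" using up[of 1] by simp
    moreover have "(\<lambda>n. w (Suc n) - w n) \<longlonglongrightarrow> 0"
    proof -
      have "(\<lambda>n. D n \<omega> / lil_norm (V n)) \<longlonglongrightarrow> 0"
      proof (rule tendsto_rabs_zero_cancel, rule tendsto_sandwich[OF _ _ tendsto_const \<rho>_lil])
        show "\<forall>\<^sub>F n in sequentially. \<bar>D n \<omega> / lil_norm (V n)\<bar> \<le> \<rho> n / lil_norm (V n)"
          using lpos by eventually_elim (simp add: D_le_\<rho> elim(5) divide_right_mono)
      qed simp
      moreover have "(\<lambda>n. lil_norm (V n) / lil_norm (V (Suc n))) \<longlonglongrightarrow> 1"
        using tendsto_inverse[OF lil_norm_ratio[OF V_Suc_ratio V_lim]] by simp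
      ultimately have "(\<lambda>n. (w n + D n \<omega> / lil_norm (V n)) * (lil_norm (V n) / lil_norm (V (Suc n))) - w n) \<longlonglongrightarrow> 0"
        by (rule tendsto_perturbed_diff[OF bd])
      moreover have "\<forall>\<^sub>F n in sequentially.
          (w n + D n \<omega> / lil_norm (V n)) * (lil_norm (V n) / lil_norm (V (Suc n))) - w n = w (Suc n) - w n"
        using lpos by eventually_elim (simp add: w_def W_Suc add_divide_distrib[symmetric])
      ultimately show ?thesis by (rule Lim_transform_eventually)
    qed
    ultimately have "seq_limit_points w = {-1..1}" using up by (intro seq_limit_points_interval)
    moreover have "(\<lambda>n. S n \<omega> / lil_norm (s2 n) - w n) \<longlonglongrightarrow> 0"
    proof -
      have "(\<lambda>n. (S n \<omega> - W n \<omega>) / lil_norm (V n)) \<longlonglongrightarrow> 0"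
      proof (rule tendsto_rabs_zero_cancel, rule tendsto_sandwich[OF _ _ tendsto_const \<rho>_lil])
        show "\<forall>\<^sub>F n in sequentially. \<bar>(S n \<omega> - W n \<omega>) / lil_norm (V n)\<bar> \<le> \<rho> n / lil_norm (V n)"
          using lpos
          by eventually_elim (use S_close[OF elim(5)] in \<open>simp add: \<rho>_def divide_right_mono\<close>)
      qed simp
      from tendsto_perturbed_diff[OF bd this inverse_ratio[OF lil_norm_ratio[OF s2_ratio V_lim]]]
      have "(\<lambda>n. (w n + (S n \<omega> - W n \<omega>) / lil_norm (V n)) * (lil_norm (V n) / lil_norm (s2 n)) - w n) \<longlonglongrightarrow> 0" .
      moreover have "\<forall>\<^sub>F n in sequentially. (w n + (S n \<omega> - W n \<omega>) / lil_norm (V n)) * (lil_norm (V n) / lil_norm (s2 n)) - w n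
          = S n \<omega> / lil_norm (s2 n) - w n"
        using lpos by eventually_elim (simp add: w_def add_divide_distrib[symmetric])
      ultimately show ?thesis by (rule Lim_transform_eventually)
    qed
    ultimately show ?case using seq_limit_points_cong by metis
  qed
qed

theorem perturbed_chung:
  "AE \<omega> in M. liminf (\<lambda>n. ereal (Max ((\<lambda>k. \<bar>S k \<omega>\<bar>) ` {1..n}) / chung_norm (s2 n))) = ereal (pi / sqrt 8)"
proof -
  define \<kappa> where "\<kappa> = pi / sqrt 8"
  have \<kappa>: "0 < \<kappa>" by (simp add: \<kappa>_def)
  have "\<forall>\<^sub>F x in at_top. 0 < chung_norm x" unfolding chung_norm_def by real_asymp
  from filterlim_eventually[OF V_lim this]
  have cpos: "\<forall>\<^sub>F n in sequentially. 0 < chung_norm (V n)" .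
  define q where "q = (\<lambda>n. chung_norm (V n) / chung_norm (s2 n))"
  have q: "q \<longlonglongrightarrow> 1"
    unfolding q_def by (rule inverse_ratio[OF chung_norm_ratio[OF s2_ratio V_lim]])
  show ?thesis
    using chung_lower chung_upper AE_space unfolding \<kappa>_def[symmetric]
  proof eventually_elim
    case (elim \<omega>)
    define Y where "Y = (\<lambda>n. Max ((\<lambda>k. \<bar>S k \<omega>\<bar>) ` {1..n}))"
    have SW: "\<bar>\<bar>S j \<omega>\<bar> - \<bar>W j \<omega>\<bar>\<bar> \<le> \<rho> n" if "j \<le> n" for j n
      using S_close[OF elim(3), of j] \<rho>_mono[OF that] by (simp add: \<rho>_def)
    have lo: "\<forall>\<^sub>F n in sequentially. (\<kappa> - e) * chung_norm (V n) \<le> Y n" if e: "0 < e" for e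
    proof (cases "e < \<kappa>")
      case True
      have "\<forall>\<^sub>F n in sequentially. \<exists>j\<in>{0..n}. (1 - e / (2 * \<kappa>)) * \<kappa> * chung_norm (V n) \<le> \<bar>W j \<omega>\<bar>"
        using elim(1) e \<kappa> by simp
      moreover have "\<forall>\<^sub>F n in sequentially. \<rho> n / chung_norm (V n) < e / 2"
        using e by (intro order_tendstoD(2)[OF \<rho>_chung]) auto
      ultimately show ?thesis using cpos eventually_ge_at_top[of 1]
      proof eventually_elim
        case (elim n)
        obtain j where j: "j \<in> {0..n}" "(1 - e / (2 * \<kappa>)) * \<kappa> * chung_norm (V n) \<le> \<bar>W j \<omega>\<bar>"
          using elim(1) by blast
        have "(1 - e / (2 * \<kappa>)) * \<kappa> = \<kappa> - e / 2" using \<kappa> by (simp add: field_simps)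
        with j have W: "(\<kappa> - e / 2) * chung_norm (V n) \<le> \<bar>W j \<omega>\<bar>" by simp
        have "0 < (\<kappa> - e / 2) * chung_norm (V n)" using elim True e by (intro mult_pos_pos) auto
        \<comment> \<open>The maximum in the statement runs over indices from 1, the martingale
          bound over indices from 0. As \<open>W 0 = 0\<close>, a positive lower bound excludes the
          index 0; the case \<open>e < \<kappa>\<close> supplies this positivity.\<close>
        then have "j \<noteq> 0" using W by (cases j) auto
        have "\<rho> n < e / 2 * chung_norm (V n)" using elim by (simp add: divide_less_eq)
        moreover have "\<bar>W j \<omega>\<bar> \<le> \<bar>S j \<omega>\<bar> + \<rho> n" using SW[of j n] j by auto
        ultimately have "(\<kappa> - e) * chung_norm (V n) \<le> \<bar>S j \<omega>\<bar>" using W by (simp add: algebra_simps)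
        also have "\<dots> \<le> Y n" unfolding Y_def using j \<open>j \<noteq> 0\<close> by (intro Max_ge) auto
        finally show ?case .
      qed
    next
      case False
      show ?thesis using cpos eventually_ge_at_top[of 1]
      proof eventually_elim
        case (elim n)
        have "(\<kappa> - e) * chung_norm (V n) \<le> 0" using False elim by (intro mult_nonpos_nonneg) auto
        also have "0 \<le> \<bar>S 1 \<omega>\<bar>" by simp
        also have "\<dots> \<le> Y n" unfolding Y_def using elim by (intro Max_ge) auto
        finally show ?case .
      qed
    qed
    have hi: "\<exists>\<^sub>F n in sequentially. Y n \<le> (\<kappa> + e) * chung_norm (V n)" if e: "0 < e" for e
    proof -
      have "\<exists>\<^sub>F n in sequentially. \<forall>j\<in>{0..n}. \<bar>W j \<omega>\<bar> \<le> (1 + e / (2 * \<kappa>)) * \<kappa> * chung_norm (V n)"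
        using elim(2) e \<kappa> by simp
      moreover have "\<forall>\<^sub>F n in sequentially. \<rho> n / chung_norm (V n) < e / 2"
        using e by (intro order_tendstoD(2)[OF \<rho>_chung]) auto
      then have "\<forall>\<^sub>F n in sequentially. (\<forall>j\<in>{0..n}. \<bar>W j \<omega>\<bar> \<le> (1 + e / (2 * \<kappa>)) * \<kappa> * chung_norm (V n)) \<longrightarrow>
          Y n \<le> (\<kappa> + e) * chung_norm (V n)"
        using cpos eventually_ge_at_top[of 1]
      proof eventually_elim
        case (elim n)
        have eq: "(1 + e / (2 * \<kappa>)) * \<kappa> = \<kappa> + e / 2" using \<kappa> by (simp add: field_simps)
        have r: "\<rho> n < e / 2 * chung_norm (V n)" using elim by (simp add: divide_less_eq)
        show ?case unfolding eq
        proof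
          assume *: "\<forall>j\<in>{0..n}. \<bar>W j \<omega>\<bar> \<le> (\<kappa> + e / 2) * chung_norm (V n)"
          have "\<bar>S j \<omega>\<bar> \<le> (\<kappa> + e) * chung_norm (V n)" if "j \<in> {1..n}" for j
          proof -
            have "\<bar>W j \<omega>\<bar> \<le> (\<kappa> + e / 2) * chung_norm (V n)" using * that by auto
            then show ?thesis using SW[of j n] that r by (simp add: algebra_simps)
          qed
          then show "Y n \<le> (\<kappa> + e) * chung_norm (V n)"
            unfolding Y_def using elim by (subst Max_le_iff) auto
        qed
      qed
      ultimately show ?thesis by (rule frequently_rev_mp)
    qed
    define y where "y = (\<lambda>n. Y n / chung_norm (V n))"
    have qpos: "\<forall>\<^sub>F n in sequentially. 0 < q n" using order_tendstoD(1)[OF q, of 0] by simp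
    have eq: "\<forall>\<^sub>F n in sequentially. Y n / chung_norm (s2 n) = y n * q n"
      using cpos by eventually_elim (simp add: y_def q_def)
    have "liminf (\<lambda>n. ereal (Y n / chung_norm (s2 n))) = ereal \<kappa>"
    proof (rule liminf_ereal_eqI)
      fix e :: real assume e: "0 < e"
      have "(\<lambda>n. (\<kappa> - e / 2) * q n) \<longlonglongrightarrow> (\<kappa> - e / 2) * 1" by (intro tendsto_intros q)
      then have "\<forall>\<^sub>F n in sequentially. \<kappa> - e < (\<kappa> - e / 2) * q n"
        using e by (intro order_tendstoD(1)) auto
      then show "\<forall>\<^sub>F n in sequentially. \<kappa> - e \<le> Y n / chung_norm (s2 n)"
        using lo[OF half_gt_zero[OF e]] cpos qpos eq
      proof eventually_elim
        case (elim n)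
        have "\<kappa> - e / 2 \<le> y n" using elim by (simp add: y_def le_divide_eq)
        then have "(\<kappa> - e / 2) * q n \<le> y n * q n" using elim by (intro mult_right_mono) auto
        then show ?case using elim(1) unfolding elim(5) by linarith
      qed
      have "(\<lambda>n. (\<kappa> + e / 2) * q n) \<longlonglongrightarrow> (\<kappa> + e / 2) * 1" by (intro tendsto_intros q)
      then have "\<forall>\<^sub>F n in sequentially. (\<kappa> + e / 2) * q n < \<kappa> + e"
        using e by (intro order_tendstoD(2)) auto
      then have "\<forall>\<^sub>F n in sequentially. Y n \<le> (\<kappa> + e / 2) * chung_norm (V n) \<longrightarrow> Y n / chung_norm (s2 n) \<le> \<kappa> + e"
        using cpos qpos eq
      proof eventually_elim
        case (elim n)
        show ?case
        proof
          assume "Y n \<le> (\<kappa> + e / 2) * chung_norm (V n)"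
          then have "y n \<le> \<kappa> + e / 2" using elim by (simp add: y_def divide_le_eq)
          then have "y n * q n \<le> (\<kappa> + e / 2) * q n" using elim by (intro mult_right_mono) auto
          then show "Y n / chung_norm (s2 n) \<le> \<kappa> + e" using elim(1) unfolding elim(4) by linarith
        qed
      qed
      then show "\<exists>\<^sub>F n in sequentially. Y n / chung_norm (s2 n) \<le> \<kappa> + e"
        by (rule frequently_rev_mp[OF hi[OF half_gt_zero[OF e]]])
    qed
    then show ?case by (simp add: Y_def)
  qed
qed

text \<open>Two replacements: \<open>S\<close> by \<open>W\<close>, which costs at most
  \<bar>t\<bar> times \<open>\<rho> n / sqrt (s2 n)\<close> because the cosine is 1-Lipschitz, and
  then \<open>char_bound\<close> at the frequency \<open>t / sqrt (s2 n)\<close>. There the error is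
  a polynomial without constant term in \<open>\<rho> n / sqrt (s2 n)\<close>, times
  \<open>V n / s2 n\<close>, and so vanishes.\<close>

lemma char_limit:
  "(\<lambda>n. expectation (\<lambda>\<omega>. cos (t * (S n \<omega> / sqrt (s2 n)) + \<phi>))) \<longlonglongrightarrow> exp (- t\<^sup>2 / 2) * cos \<phi>"
proof -
  define \<tau> where "\<tau> = (\<lambda>n. t / sqrt (s2 n))"
  have Vpos: "\<forall>\<^sub>F n in sequentially. 0 < V n"
    by (rule filterlim_eventually[OF V_lim eventually_gt_at_top])
  have V_s2: "(\<lambda>n. V n / s2 n) \<longlonglongrightarrow> 1" using inverse_ratio[of "\<lambda>x. x"] s2_ratio by simp
  have r0: "(\<lambda>n. \<rho> n / sqrt (s2 n)) \<longlonglongrightarrow> 0"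
  proof -
    have "(\<lambda>n. \<rho> n / sqrt (V n) * sqrt (V n / s2 n)) \<longlonglongrightarrow> 0 * sqrt 1"
      by (intro tendsto_intros \<rho>_sqrt V_s2)
    then have "(\<lambda>n. \<rho> n / sqrt (V n) * sqrt (V n / s2 n)) \<longlonglongrightarrow> 0" by simp
    moreover have "\<forall>\<^sub>F n in sequentially. \<rho> n / sqrt (V n) * sqrt (V n / s2 n) = \<rho> n / sqrt (s2 n)"
      using Vpos by eventually_elim (simp add: real_sqrt_divide)
    ultimately show ?thesis by (rule Lim_transform_eventually)
  qed
  have 1: "\<forall>\<^sub>F n in sequentially. \<bar>expectation (\<lambda>\<omega>. cos (t * (S n \<omega> / sqrt (s2 n)) + \<phi>))
      - expectation (\<lambda>\<omega>. cos (\<tau> n * W n \<omega> + \<phi>))\<bar> \<le> \<bar>t\<bar> * (\<rho> n / sqrt (s2 n))"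
    using s2_pos
  proof eventually_elim
    case (elim n)
    have pw: "\<bar>cos (\<tau> n * S n \<omega> + \<phi>) - cos (\<tau> n * W n \<omega> + \<phi>)\<bar> \<le> \<bar>t\<bar> * (\<rho> n / sqrt (s2 n))"
      if "\<omega> \<in> space M" for \<omega>
    proof -
      have "\<bar>cos (\<tau> n * S n \<omega> + \<phi>) - cos (\<tau> n * W n \<omega> + \<phi>)\<bar> \<le> \<bar>(\<tau> n * S n \<omega> + \<phi>) - (\<tau> n * W n \<omega> + \<phi>)\<bar>"
      proof -
        define a b where "a = \<tau> n * S n \<omega> + \<phi>" and "b = \<tau> n * W n \<omega> + \<phi>"
        have "\<bar>cos a - cos b\<bar> = 2 * (\<bar>sin ((a + b) / 2)\<bar> * \<bar>sin ((b - a) / 2)\<bar>)"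
          by (simp add: cos_diff_cos abs_mult)
        also have "\<dots> \<le> 2 * (1 * \<bar>(b - a) / 2\<bar>)"
          by (intro mult_left_mono mult_mono abs_sin_le_one abs_sin_x_le_abs_x) auto
        finally show ?thesis by (simp add: a_def b_def)
      qed
      also have "\<dots> = \<bar>\<tau> n * (S n \<omega> - W n \<omega>)\<bar>" by (simp add: algebra_simps)
      also have "\<dots> = \<bar>t\<bar> / sqrt (s2 n) * \<bar>S n \<omega> - W n \<omega>\<bar>"
        using elim by (simp add: \<tau>_def abs_mult)
      also have "\<dots> \<le> \<bar>t\<bar> / sqrt (s2 n) * \<rho> n"
        using S_close[OF that, of n] elim by (intro mult_left_mono) (auto simp: \<rho>_def)
      finally show ?thesis by simp
    qed
    have "\<bar>expectation (\<lambda>\<omega>. cos (\<tau> n * S n \<omega> + \<phi>)) - expectation (\<lambda>\<omega>. cos (\<tau> n * W n \<omega> + \<phi>))\<bar>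
        = \<bar>expectation (\<lambda>\<omega>. cos (\<tau> n * S n \<omega> + \<phi>) - cos (\<tau> n * W n \<omega> + \<phi>))\<bar>"
      by (subst Bochner_Integration.integral_diff)
         (intro bdd_meas_integrable bdd_meas_intros bdd_meas_S bdd_meas_W_M refl)+
    also have "\<dots> \<le> expectation (\<lambda>\<omega>. \<bar>cos (\<tau> n * S n \<omega> + \<phi>) - cos (\<tau> n * W n \<omega> + \<phi>)\<bar>)"
      by (rule integral_abs_bound)
    also have "\<dots> \<le> expectation (\<lambda>_. \<bar>t\<bar> * (\<rho> n / sqrt (s2 n)))"
      using pw by (intro integral_mono integrable_abs bdd_meas_integrable bdd_meas_intros bdd_meas_S bdd_meas_W_M)
    finally show ?case by (simp add: \<tau>_def prob_space)
  qed
  have 2: "\<bar>expectation (\<lambda>\<omega>. cos (\<tau> n * W n \<omega> + \<phi>)) - exp (- (\<tau> n)\<^sup>2 / 2 * V n) * cos \<phi>\<bar>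
      \<le> (\<bar>\<tau> n\<bar> ^ 3 * \<rho> n + \<tau> n ^ 4 * (\<rho> n)\<^sup>2) * V n" for n
    by (rule char_bound[where N = n]) (auto intro: D_le_\<rho> \<rho>_nonneg)
  have 3: "\<forall>\<^sub>F n in sequentially. (\<bar>\<tau> n\<bar> ^ 3 * \<rho> n + \<tau> n ^ 4 * (\<rho> n)\<^sup>2) * V n
      = (\<bar>t\<bar> ^ 3 * (\<rho> n / sqrt (s2 n)) + t ^ 4 * (\<rho> n / sqrt (s2 n))\<^sup>2) * (V n / s2 n)"
    using s2_pos
  proof eventually_elim
    case (elim n)
    have s: "s2 n = sqrt (s2 n) * sqrt (s2 n)" "0 < sqrt (s2 n)" using elim by auto
    define \<sigma> where "\<sigma> = sqrt (s2 n)"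
    have "0 < \<sigma>" "s2 n = \<sigma> * \<sigma>" using s by (auto simp: \<sigma>_def)
    then show ?case
      unfolding \<tau>_def \<sigma>_def[symmetric] by (simp add: power_divide eval_nat_numeral field_simps)
  qed
  have "(\<lambda>n. exp (- (\<tau> n)\<^sup>2 / 2 * V n) * cos \<phi>) \<longlonglongrightarrow> exp (- t\<^sup>2 / 2) * cos \<phi>"
  proof -
    have "(\<lambda>n. exp (- t\<^sup>2 / 2 * (V n / s2 n)) * cos \<phi>) \<longlonglongrightarrow> exp (- t\<^sup>2 / 2 * 1) * cos \<phi>"
      by (intro tendsto_intros V_s2)
    then have "(\<lambda>n. exp (- t\<^sup>2 / 2 * (V n / s2 n)) * cos \<phi>) \<longlonglongrightarrow> exp (- t\<^sup>2 / 2) * cos \<phi>"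
      by (simp only: mult_1_right)
    moreover have "\<forall>\<^sub>F n in sequentially. exp (- t\<^sup>2 / 2 * (V n / s2 n)) * cos \<phi> = exp (- (\<tau> n)\<^sup>2 / 2 * V n) * cos \<phi>"
      using s2_pos by eventually_elim (simp add: \<tau>_def power_divide)
    ultimately show ?thesis by (rule Lim_transform_eventually)
  qed
  moreover have "(\<lambda>n. expectation (\<lambda>\<omega>. cos (\<tau> n * W n \<omega> + \<phi>)) - exp (- (\<tau> n)\<^sup>2 / 2 * V n) * cos \<phi>) \<longlonglongrightarrow> 0"
  proof (rule tendsto_rabs_zero_cancel, rule tendsto_sandwich[OF _ _ tendsto_const])
    have "(\<lambda>n. (\<bar>t\<bar> ^ 3 * (\<rho> n / sqrt (s2 n)) + t ^ 4 * (\<rho> n / sqrt (s2 n))\<^sup>2) * (V n / s2 n))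
        \<longlonglongrightarrow> (\<bar>t\<bar> ^ 3 * 0 + t ^ 4 * 0\<^sup>2) * 1"
      by (intro tendsto_intros r0 V_s2)
    then show "(\<lambda>n. (\<bar>t\<bar> ^ 3 * (\<rho> n / sqrt (s2 n)) + t ^ 4 * (\<rho> n / sqrt (s2 n))\<^sup>2) * (V n / s2 n)) \<longlonglongrightarrow> 0"
      by simp
    show "\<forall>\<^sub>F n in sequentially. \<bar>expectation (\<lambda>\<omega>. cos (\<tau> n * W n \<omega> + \<phi>)) - exp (- (\<tau> n)\<^sup>2 / 2 * V n) * cos \<phi>\<bar>
        \<le> (\<bar>t\<bar> ^ 3 * (\<rho> n / sqrt (s2 n)) + t ^ 4 * (\<rho> n / sqrt (s2 n))\<^sup>2) * (V n / s2 n)"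
      using 3 by eventually_elim (use 2 in metis)
  qed simp
  ultimately have "(\<lambda>n. expectation (\<lambda>\<omega>. cos (\<tau> n * W n \<omega> + \<phi>))) \<longlonglongrightarrow> exp (- t\<^sup>2 / 2) * cos \<phi>"
    by (rule Lim_transform)
  moreover have "(\<lambda>n. expectation (\<lambda>\<omega>. cos (t * (S n \<omega> / sqrt (s2 n)) + \<phi>))
      - expectation (\<lambda>\<omega>. cos (\<tau> n * W n \<omega> + \<phi>))) \<longlonglongrightarrow> 0"
  proof (rule tendsto_rabs_zero_cancel, rule tendsto_sandwich[OF _ 1 tendsto_const])
    have "(\<lambda>n. \<bar>t\<bar> * (\<rho> n / sqrt (s2 n))) \<longlonglongrightarrow> \<bar>t\<bar> * 0" by (intro tendsto_intros r0)
    then show "(\<lambda>n. \<bar>t\<bar> * (\<rho> n / sqrt (s2 n))) \<longlonglongrightarrow> 0" by simp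
  qed simp
  ultimately show ?thesis by (rule Lim_transform)
qed

theorem perturbed_clt:
  "(\<lambda>n. \<P>(\<omega> in M. S n \<omega> / sqrt (s2 n) \<le> y))
    \<longlonglongrightarrow> (LBINT t:{..y}. 1 / sqrt (2 * pi) * exp (- t\<^sup>2 / 2))"
proof -
  interpret std: real_distribution std_normal_distribution by (rule real_dist_normal_dist)
  define \<mu> where "\<mu> = (\<lambda>n. distr M borel (\<lambda>\<omega>. S n \<omega> / sqrt (s2 n)))"
  have \<mu>: "real_distribution (\<mu> n)" for n unfolding \<mu>_def by (rule real_distribution_distr) measurable
  \<comment> \<open>The phases 0 and - pi / 2 turn the cosine into the real and the imaginary part,
    so \<open>char_limit\<close> settles both.\<close>
  have char: "char (\<mu> n) t = Complex (expectation (\<lambda>\<omega>. cos (t * (S n \<omega> / sqrt (s2 n)) + 0)))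
      (expectation (\<lambda>\<omega>. cos (t * (S n \<omega> / sqrt (s2 n)) + - (pi / 2))))" for n t
  proof -
    define Y where "Y = (\<lambda>\<omega>. S n \<omega> / sqrt (s2 n))"
    have Y: "bdd_meas M Y" unfolding Y_def divide_inverse by (intro bdd_meas_intros bdd_meas_S)
    have [measurable]: "Y \<in> borel_measurable M" using Y by (rule bdd_meas_measurable)
    have "char (\<mu> n) t = (CLINT \<omega>|M. iexp (t * Y \<omega>))"
      unfolding char_def \<mu>_def Y_def[symmetric] by (subst integral_distr) auto
    also have "(\<lambda>\<omega>. iexp (t * Y \<omega>)) = (\<lambda>\<omega>. complex_of_real (cos (t * Y \<omega>)) + \<i> * complex_of_real (sin (t * Y \<omega>)))"
      by (rule ext) (simp add: complex_eq_iff cis_conv_exp[symmetric] del: of_real_mult)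
    also have "(CLINT \<omega>|M. complex_of_real (cos (t * Y \<omega>)) + \<i> * complex_of_real (sin (t * Y \<omega>)))
        = complex_of_real (expectation (\<lambda>\<omega>. cos (t * Y \<omega>))) + \<i> * complex_of_real (expectation (\<lambda>\<omega>. sin (t * Y \<omega>)))"
    proof -
      have i: "integrable M (\<lambda>\<omega>. cos (t * Y \<omega>))" "integrable M (\<lambda>\<omega>. sin (t * Y \<omega>))"
        by (intro bdd_meas_integrable bdd_meas_intros Y)+
      show ?thesis
        by (subst Bochner_Integration.integral_add) (use i in \<open>auto intro: integrable_mult_right\<close>)
    qed
    finally show ?thesis
      unfolding Y_def by (simp add: complex_eq_iff cos_add cos_diff)
  qed
  have "(\<lambda>n. char (\<mu> n) t) \<longlonglongrightarrow> char std_normal_distribution t" for t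
  proof -
    have "(\<lambda>n. char (\<mu> n) t) \<longlonglongrightarrow> Complex (exp (- t\<^sup>2 / 2) * cos 0) (exp (- t\<^sup>2 / 2) * cos (- (pi / 2)))"
      unfolding char by (intro tendsto_Complex char_limit)
    also have "Complex (exp (- t\<^sup>2 / 2) * cos 0) (exp (- t\<^sup>2 / 2) * cos (- (pi / 2))) = char std_normal_distribution t"
      by (simp add: char_std_normal_distribution complex_eq_iff)
    finally show ?thesis .
  qed
  then have "weak_conv_m \<mu> std_normal_distribution"
    using \<mu> std.real_distribution_axioms by (intro levy_continuity)
  \<comment> \<open>Weak convergence gives convergence of distribution functions at continuity
    points only; the normal law has no atoms.\<close>
  moreover have "isCont (cdf std_normal_distribution) y"
  proof -
    have "emeasure std_normal_distribution {y} = 0"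
      by (simp add: emeasure_density nn_integral_set_ennreal[symmetric] nn_integral_null_set)
    then show ?thesis by (simp add: std.isCont_cdf measure_def)
  qed
  ultimately have "(\<lambda>n. cdf (\<mu> n) y) \<longlonglongrightarrow> cdf std_normal_distribution y"
    unfolding weak_conv_m_def weak_conv_def by blast
  moreover have "cdf (\<mu> n) y = \<P>(\<omega> in M. S n \<omega> / sqrt (s2 n) \<le> y)" for n
    unfolding cdf_def \<mu>_def by (subst measure_distr) (auto intro!: arg_cong[of _ _ prob])
  moreover have "cdf std_normal_distribution y = (LBINT t:{..y}. 1 / sqrt (2 * pi) * exp (- t\<^sup>2 / 2))"
  proof -
    have "cdf std_normal_distribution y = (\<integral>t. indicator {..y} t \<partial>std_normal_distribution)"
      by (simp add: cdf_def)
    also have "\<dots> = (LINT t|lborel. std_normal_density t *\<^sub>R indicator {..y} t)"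
      by (subst integral_density) auto
    also have "\<dots> = (LBINT t:{..y}. 1 / sqrt (2 * pi) * exp (- t\<^sup>2 / 2))"
      unfolding set_lebesgue_integral_def
      by (intro Bochner_Integration.integral_cong) (auto simp: std_normal_density_def)
    finally show ?thesis .
  qed
  ultimately show ?thesis by simp
qed

end

section \<open>The Markov chain\<close>

lemma sqsum_Suc: "sqsum a (Suc n) = sqsum a n + (a (Suc n))\<^sup>2"
  by (simp add: sqsum_def)

lemma sqsum_nonneg: "0 \<le> sqsum a n"
  by (auto simp: sqsum_def intro: sum_nonneg)

lemma sqsum_mono: "m \<le> n \<Longrightarrow> sqsum a m \<le> sqsum a n"
  unfolding sqsum_def by (intro sum_mono2) auto

text \<open>The weights \<open>b n = (\<Sum>i. a (n + i) * r ^ i)\<close> turn the weighted sum of the chain into a martingale.\<close>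

lemma martingale_weights:
  fixes a :: "nat \<Rightarrow> real" and r \<delta> :: real
  assumes r: "\<bar>r\<bar> < 1" and \<delta>: "0 < \<delta>" "\<delta> \<le> 1"
    and lim: "filterlim (sqsum a) at_top sequentially"
    and O: "(\<lambda>n. (a n)\<^sup>2) \<in> O(\<lambda>n. sqsum a n powr (1 - \<delta>))"
  obtains b C where "\<And>n. b n = a n + r * b (Suc n)" "0 \<le> C"
    "\<And>n. \<bar>b n\<bar> \<le> C * (1 + (\<Sum>k<n. (b (Suc k))\<^sup>2)) powr ((1 - \<delta>) / 2)"
    "filterlim (\<lambda>n. \<Sum>k<n. (b (Suc k))\<^sup>2) at_top sequentially"
proof -
  define A where "A = sqsum a"
  define \<beta> where "\<beta> = (1 - \<delta>) / 2"
  have \<beta>: "0 \<le> \<beta>" "\<beta> < 1 / 2" "2 * \<beta> = 1 - \<delta>" using \<delta> by (auto simp: \<beta>_def)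
  \<comment> \<open>Any \<open>q > 1\<close> with \<open>q * \<bar>r\<bar> < 1\<close> serves:
    eventually \<open>A\<close> grows by at most the factor \<open>q\<close> per step, and the
    series for \<open>b\<close> still converges geometrically with ratio
    \<open>q * \<bar>r\<bar>\<close>.\<close>
  define q where "q = 2 / (1 + \<bar>r\<bar>)"
  have q: "1 < q" "q * \<bar>r\<bar> < 1" using r by (auto simp: q_def field_simps)
  obtain c where c: "0 < c" "\<forall>\<^sub>F n in sequentially. norm ((a n)\<^sup>2) \<le> c * norm (A n powr (1 - \<delta>))"
    using landau_o.bigE[OF O] unfolding A_def by blast
  have A_lim: "filterlim A at_top sequentially" using lim by (simp add: A_def)
  have A_mono: "A m \<le> A n" if "m \<le> n" for m n using that by (simp add: A_def sqsum_mono)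
  have A0: "0 \<le> A n" for n by (simp add: A_def sqsum_nonneg)
  have AS: "A (Suc n) = A n + (a (Suc n))\<^sup>2" for n by (simp add: A_def sqsum_Suc)
  have q1: "0 < 1 - 1 / q" using q by simp
  have "\<forall>\<^sub>F x::real in at_top. c * x powr (1 - \<delta>) \<le> (1 - 1 / q) * x"
    using \<delta> c(1) q1 by real_asymp
  from filterlim_eventually[OF A_lim this] c(2) filterlim_eventually[OF A_lim eventually_ge_at_top[of 1]]
  have "\<forall>\<^sub>F n in sequentially. 1 \<le> A n \<and> (a n)\<^sup>2 \<le> c * A n powr (1 - \<delta>) \<and> (a n)\<^sup>2 \<le> (1 - 1 / q) * A n"
    by eventually_elim auto
  then obtain n0 where n0: "\<And>n. n0 \<le> n \<Longrightarrow> 1 \<le> A n" "\<And>n. n0 \<le> n \<Longrightarrow> (a n)\<^sup>2 \<le> c * A n powr (1 - \<delta>)"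
    "\<And>n. n0 \<le> n \<Longrightarrow> (a n)\<^sup>2 \<le> (1 - 1 / q) * A n"
    unfolding eventually_sequentially by blast
  have step: "A (Suc n) \<le> q * A n" if "n0 \<le> n" for n
  proof -
    have "A (Suc n) \<le> A n + (1 - 1 / q) * A (Suc n)" using n0(3)[of "Suc n"] that AS[of n] by simp
    then have "A (Suc n) / q \<le> A n" by (simp add: algebra_simps)
    then show ?thesis using q by (simp add: field_simps)
  qed
  have grow: "A (n + i) \<le> q ^ i * A n" if "n0 \<le> n" for n i
  proof (induction i)
    case (Suc i)
    have "A (n + Suc i) \<le> q * A (n + i)" using step[of "n + i"] that by simp
    also have "\<dots> \<le> q * (q ^ i * A n)" using Suc q by (intro mult_left_mono) auto
    finally show ?case by (simp add: mult.assoc)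
  qed simp
  have abound: "\<bar>a (n + i)\<bar> \<le> sqrt c * (q ^ i * A n powr \<beta>)" if "n0 \<le> n" for n i
  proof -
    have An: "1 \<le> A n" using n0(1) that by blast
    have qi: "1 \<le> q ^ i" using q by simp
    have "(a (n + i))\<^sup>2 \<le> c * A (n + i) powr (1 - \<delta>)" using n0(2) that by simp
    also have "\<dots> \<le> c * (q ^ i * A n) powr (1 - \<delta>)"
      using grow[OF that, of i] c \<delta> A0 by (intro mult_left_mono powr_mono2) auto
    also have "\<dots> = c * ((q ^ i) powr (1 - \<delta>) * A n powr (1 - \<delta>))"
      using qi An by (simp add: powr_mult)
    \<comment> \<open>Raising the exponent of \<open>q ^ i\<close> to 2 is generous but makes the
      bound a perfect square; after the root, \<open>q * \<bar>r\<bar> < 1\<close> leaves room for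
      it.\<close>
    also have "\<dots> \<le> c * ((q ^ i) powr 2 * A n powr (1 - \<delta>))"
      using qi c \<delta> by (intro mult_left_mono mult_right_mono powr_mono) auto
    also have "\<dots> = (sqrt c * (q ^ i * A n powr \<beta>))\<^sup>2"
    proof -
      have "(A n powr \<beta>)\<^sup>2 = A n powr (1 - \<delta>)"
        using An by (simp add: powr_power \<beta>(3)[symmetric] mult.commute)
      moreover have "(q ^ i) powr 2 = (q ^ i)\<^sup>2" using qi by (simp add: powr_numeral)
      ultimately show ?thesis using c by (simp add: power_mult_distrib)
    qed
    finally have "\<bar>a (n + i)\<bar>\<^sup>2 \<le> (sqrt c * (q ^ i * A n powr \<beta>))\<^sup>2" by simp
    then show ?thesis
      by (rule power2_le_imp_le) (use c qi in \<open>auto intro!: mult_nonneg_nonneg\<close>)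
  qed
  define x where "x = q * \<bar>r\<bar>"
  have x: "0 \<le> x" "x < 1" using q by (auto simp: x_def)
  have tbound: "norm (a (n + i) * r ^ i) \<le> sqrt c * A n powr \<beta> * x ^ i" if "n0 \<le> n" for n i
  proof -
    have "norm (a (n + i) * r ^ i) \<le> sqrt c * (q ^ i * A n powr \<beta>) * \<bar>r\<bar> ^ i"
      using abound[OF that, of i] by (simp add: abs_mult power_abs mult_right_mono)
    then show ?thesis by (simp add: x_def power_mult_distrib mult_ac)
  qed
  have sumg: "summable (\<lambda>i. sqrt c * A n powr \<beta> * x ^ i)" for n
    using x by (intro summable_mult summable_geometric) auto
  define b where "b = (\<lambda>n. \<Sum>i. a (n + i) * r ^ i)"
  have sum0: "summable (\<lambda>i. a (n + i) * r ^ i)" if "n0 \<le> n" for n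
    using tbound[OF that] by (intro summable_comparison_test'[OF sumg, of 0]) auto
  have sum: "summable (\<lambda>i. a (n + i) * r ^ i)" for n
  proof -
    have "summable (\<lambda>i. r ^ n0 * (a (n + n0 + i) * r ^ i))"
      by (intro summable_mult sum0) simp
    then have "summable (\<lambda>i. a (n + (i + n0)) * r ^ (i + n0))"
      by (simp add: power_add algebra_simps)
    then show ?thesis by (subst (asm) summable_iff_shift[of "\<lambda>i. a (n + i) * r ^ i" n0])
  qed
  have brec: "b n = a n + r * b (Suc n)" for n
  proof -
    have "b n = a n + (\<Sum>i. a (n + Suc i) * r ^ Suc i)"
      unfolding b_def using suminf_split_head[OF sum[of n]] by simp
    also have "(\<Sum>i. a (n + Suc i) * r ^ Suc i) = (\<Sum>i. r * (a (Suc n + i) * r ^ i))"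
      by (simp add: algebra_simps)
    also have "\<dots> = r * b (Suc n)" unfolding b_def by (rule suminf_mult[OF sum])
    finally show ?thesis .
  qed
  have b0: "\<bar>b n\<bar> \<le> sqrt c / (1 - x) * A n powr \<beta>" if "n0 \<le> n" for n
  proof -
    have "\<bar>b n\<bar> \<le> (\<Sum>i. sqrt c * A n powr \<beta> * x ^ i)"
      unfolding b_def real_norm_def[symmetric] using tbound[OF that] by (intro norm_suminf_le sumg)
    also have "\<dots> = sqrt c * A n powr \<beta> * (1 / (1 - x))"
      using x by (subst suminf_mult) (auto simp: suminf_geometric summable_geometric)
    finally show ?thesis by simp
  qed
  \<comment> \<open>The finitely many early weights are paid for by their sum; the base
    \<open>1 + A n\<close> is at least 1, so its power cannot vanish there.\<close>
  define C1 where "C1 = sqrt c / (1 - x) + (\<Sum>j<n0. \<bar>b j\<bar>)"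
  have C1: "0 \<le> C1" using c x by (auto simp: C1_def intro!: add_nonneg_nonneg sum_nonneg)
  have b1: "\<bar>b n\<bar> \<le> C1 * (1 + A n) powr \<beta>" for n
  proof (cases "n0 \<le> n")
    case True
    note b0[OF True]
    also have "sqrt c / (1 - x) * A n powr \<beta> \<le> C1 * (1 + A n) powr \<beta>"
      using c x A0[of n] \<beta> C1
      by (intro mult_mono powr_mono2) (auto simp: C1_def intro!: sum_nonneg)
    finally show ?thesis .
  next
    case False
    have "\<bar>b n\<bar> \<le> (\<Sum>j<n0. \<bar>b j\<bar>)" using False by (intro member_le_sum) auto
    also have "\<dots> \<le> C1 * 1" using c x by (simp add: C1_def)
    also have "\<dots> \<le> C1 * (1 + A n) powr \<beta>"
      using C1 A0[of n] \<beta> by (intro mult_left_mono ge_one_powr_ge_zero) auto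
    finally show ?thesis .
  qed
  define B where "B = (\<lambda>n. \<Sum>k<n. (b (Suc k))\<^sup>2)"
  have B0: "0 \<le> B n" for n by (auto simp: B_def intro: sum_nonneg)
  \<comment> \<open>The reverse comparison, by which the weights are measured through their own
    squares: a_n = b_n - r b_(n+1) bounds each square of \<open>a\<close> by twice two neighbouring
    squares of \<open>b\<close>, so each of these counts at most four times, apart from the boundary
    term.\<close>
  have AB: "A n \<le> 4 * B n + 2 * (b (Suc n))\<^sup>2" for n
  proof (induction n)
    case 0
    then show ?case by (simp add: A_def sqsum_def B_def)
  next
    case (Suc n)
    have "(a (Suc n))\<^sup>2 = (b (Suc n) - r * b (Suc (Suc n)))\<^sup>2" using brec[of "Suc n"] by simp
    also have "\<dots> \<le> 2 * (b (Suc n))\<^sup>2 + 2 * (r * b (Suc (Suc n)))\<^sup>2"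
      using zero_le_power2[of "b (Suc n) + r * b (Suc (Suc n))"] by (simp add: power2_sum power2_diff)
    also have "(r * b (Suc (Suc n)))\<^sup>2 \<le> (b (Suc (Suc n)))\<^sup>2"
      unfolding power_mult_distrib using r by (intro mult_left_le_one_le) (auto simp: abs_square_le_1)
    finally have "(a (Suc n))\<^sup>2 \<le> 2 * (b (Suc n))\<^sup>2 + 2 * (b (Suc (Suc n)))\<^sup>2" by simp
    then show ?case using Suc by (simp add: AS B_def)
  qed
  \<comment> \<open>The constant \<open>1 / (4 * q)\<close> is set so that, after
    \<open>A (Suc n) \<le> q * A n\<close>, the boundary term is at most half of \<open>A n\<close>
    and can be absorbed: \<open>A n \<le> 4 * B n + A n / 2\<close>.\<close>
  have "\<forall>\<^sub>F x::real in at_top. C1\<^sup>2 * (1 + x) powr (1 - \<delta>) \<le> 1 / (4 * q) * x"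
    using \<delta> q by real_asymp
  from filterlim_eventually[OF filterlim_compose[OF A_lim filterlim_Suc] this] eventually_ge_at_top[of n0]
  have "\<forall>\<^sub>F n in sequentially. A n \<le> 8 * B n"
  proof eventually_elim
    case (elim n)
    have "(b (Suc n))\<^sup>2 \<le> (C1 * (1 + A (Suc n)) powr \<beta>)\<^sup>2"
      using b1[of "Suc n"] by (simp only: abs_le_square_iff[symmetric])
    also have "\<dots> = C1\<^sup>2 * (1 + A (Suc n)) powr (1 - \<delta>)"
      using A0[of "Suc n"] by (simp add: power_mult_distrib powr_power \<beta>(3)[symmetric] mult.commute)
    also have "\<dots> \<le> 1 / (4 * q) * A (Suc n)" using elim by simp
    also have "\<dots> \<le> 1 / (4 * q) * (q * A n)" using step[OF elim(2)] q by (intro mult_left_mono) auto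
    also have "\<dots> = A n / 4" using q by simp
    finally show ?case using AB[of n] by simp
  qed
  then obtain n1 where n1: "\<And>n. n1 \<le> n \<Longrightarrow> A n \<le> 8 * B n"
    unfolding eventually_sequentially by blast
  define C2 where "C2 = 8 + A n1"
  have C2: "1 \<le> C2" using A0[of n1] by (simp add: C2_def)
  have AB2: "1 + A n \<le> C2 * (1 + B n)" for n
  proof (cases "n1 \<le> n")
    case True
    have "1 + A n \<le> 8 * (1 + B n)" using n1[OF True] by simp
    also have "\<dots> \<le> C2 * (1 + B n)" using A0[of n1] B0[of n] by (intro mult_right_mono) (auto simp: C2_def)
    finally show ?thesis .
  next
    case False
    have "1 + A n \<le> C2 * 1" using A_mono[of n n1] False by (simp add: C2_def)
    also have "\<dots> \<le> C2 * (1 + B n)" using C2 B0[of n] by (intro mult_left_mono) auto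
    finally show ?thesis .
  qed
  show ?thesis
  proof (rule that)
    show "b n = a n + r * b (Suc n)" for n by (rule brec)
    show "0 \<le> C1 * C2 powr \<beta>" using C1 by simp
    show "\<bar>b n\<bar> \<le> C1 * C2 powr \<beta> * (1 + (\<Sum>k<n. (b (Suc k))\<^sup>2)) powr ((1 - \<delta>) / 2)" for n
    proof -
      note b1[of n]
      also have "C1 * (1 + A n) powr \<beta> \<le> C1 * (C2 * (1 + B n)) powr \<beta>"
        using C1 AB2[of n] A0[of n] \<beta> by (intro mult_left_mono powr_mono2) auto
      also have "\<dots> = C1 * C2 powr \<beta> * (1 + B n) powr \<beta>"
        using C2 B0[of n] by (simp add: powr_mult)
      finally show ?thesis by (simp add: B_def \<beta>_def)
    qed
    have "filterlim (\<lambda>n. 1 / 8 * A n) at_top sequentially"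
      by (intro filterlim_tendsto_pos_mult_at_top[OF tendsto_const _ A_lim]) auto
    moreover have "\<forall>\<^sub>F n in sequentially. 1 / 8 * A n \<le> B n"
      using eventually_ge_at_top[of n1] by eventually_elim (use n1 in force)
    ultimately have "filterlim B at_top sequentially" by (rule filterlim_at_top_mono)
    then show "filterlim (\<lambda>n. \<Sum>k<n. (b (Suc k))\<^sup>2) at_top sequentially" unfolding B_def .
  qed
qed

section \<open>Histories, paths and innovations of the chain\<close>

context pm_markov_chain
begin

definition same :: "nat \<Rightarrow> 'a \<Rightarrow> 'a \<Rightarrow> bool" where
  "same k \<omega> \<omega>' \<longleftrightarrow> (\<forall>j\<in>{1..k}. X j \<omega> = X j \<omega>')"

definition path :: "nat \<Rightarrow> (nat \<Rightarrow> real) \<Rightarrow> 'a set" where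
  "path k c = {\<omega> \<in> space M. \<forall>j\<in>{1..k}. X j \<omega> = c j}"

text \<open>The sigma-algebra of the first \<open>k\<close> values, given through its events: those
  that do not separate sample points with equal values up to time \<open>k\<close>. As there are
  finitely many paths, these are the finite unions of path sets. At \<open>k = 0\<close> only the
  empty set and the whole space remain.\<close>

definition history :: "nat \<Rightarrow> 'a measure" where
  "history k = sigma (space M) {A \<in> events. \<forall>\<omega>\<in>space M. \<forall>\<omega>'\<in>space M. same k \<omega> \<omega>' \<longrightarrow> \<omega> \<in> A \<longrightarrow> \<omega>' \<in> A}"

lemma same_sym: "same k \<omega> \<omega>' \<Longrightarrow> same k \<omega>' \<omega>"
  by (simp add: same_def)

lemma space_history [simp]: "space (history k) = space M"
  unfolding history_def by (rule space_measure_of_conv)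

lemma sets_history:
  "sets (history k) = {A \<in> events. \<forall>\<omega>\<in>space M. \<forall>\<omega>'\<in>space M. same k \<omega> \<omega>' \<longrightarrow> \<omega> \<in> A \<longrightarrow> \<omega>' \<in> A}"
proof -
  have "sigma_algebra (space M) {A \<in> events. \<forall>\<omega>\<in>space M. \<forall>\<omega>'\<in>space M. same k \<omega> \<omega>' \<longrightarrow> \<omega> \<in> A \<longrightarrow> \<omega>' \<in> A}"
    unfolding sigma_algebra_iff2
  proof (intro conjI ballI allI impI)
    show "{A \<in> events. \<forall>\<omega>\<in>space M. \<forall>\<omega>'\<in>space M. same k \<omega> \<omega>' \<longrightarrow> \<omega> \<in> A \<longrightarrow> \<omega>' \<in> A} \<subseteq> Pow (space M)"
      using sets.sets_into_space by auto
  next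
    fix A assume "A \<in> {A \<in> events. \<forall>\<omega>\<in>space M. \<forall>\<omega>'\<in>space M. same k \<omega> \<omega>' \<longrightarrow> \<omega> \<in> A \<longrightarrow> \<omega>' \<in> A}"
    then show "space M - A \<in> {A \<in> events. \<forall>\<omega>\<in>space M. \<forall>\<omega>'\<in>space M. same k \<omega> \<omega>' \<longrightarrow> \<omega> \<in> A \<longrightarrow> \<omega>' \<in> A}"
      using same_sym by blast
  next
    fix A :: "nat \<Rightarrow> 'a set"
    assume "range A \<subseteq> {A \<in> events. \<forall>\<omega>\<in>space M. \<forall>\<omega>'\<in>space M. same k \<omega> \<omega>' \<longrightarrow> \<omega> \<in> A \<longrightarrow> \<omega>' \<in> A}"
    then show "\<Union> (range A) \<in> {A \<in> events. \<forall>\<omega>\<in>space M. \<forall>\<omega>'\<in>space M. same k \<omega> \<omega>' \<longrightarrow> \<omega> \<in> A \<longrightarrow> \<omega>' \<in> A}"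
      by blast
  qed auto
  then show ?thesis unfolding history_def by (rule sigma_algebra.sets_measure_of_eq)
qed

lemma history_subalgebra: "subalgebra M (history k)"
  by (auto simp: subalgebra_def sets_history)

lemma bdd_meas_history: "bdd_meas (history k) Z \<Longrightarrow> bdd_meas M Z"
  using measurable_from_subalg[OF history_subalgebra] unfolding bdd_meas_def by auto

lemma history_Suc: "sets (history k) \<subseteq> sets (history (Suc k))"
  unfolding sets_history same_def by fastforce

text \<open>The preimage of the single value \<open>Z \<omega>\<close> is an event of the history,
  hence contains \<omega>' together with \<omega>.\<close>

lemma history_measurable:
  assumes "Z \<in> borel_measurable (history k)" "\<omega> \<in> space M" "\<omega>' \<in> space M" "same k \<omega> \<omega>'"
  shows "Z \<omega>' = (Z \<omega> :: real)"
proof -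
  have "Z -` {Z \<omega>} \<inter> space (history k) \<in> sets (history k)"
    using assms(1) by (rule measurable_sets) simp
  then have "\<omega>' \<in> Z -` {Z \<omega>} \<inter> space (history k)"
    using assms(2-4) unfolding sets_history by auto
  then show ?thesis by simp
qed

lemma X_history:
  assumes "j \<in> {1..k}"
  shows "bdd_meas (history k) (X j)"
proof (rule bdd_measI)
  show "X j \<in> borel_measurable (history k)"
  proof (rule measurableI)
    fix B :: "real set" assume "B \<in> sets borel"
    moreover have "X j \<in> borel_measurable M" using assms by (intro rv) auto
    ultimately have "X j -` B \<inter> space M \<in> events" by (rule measurable_sets[rotated])
    then show "X j -` B \<inter> space (history k) \<in> sets (history k)"
      using assms by (auto simp: sets_history same_def)
  qed simp
  show "\<bar>X j \<omega>\<bar> \<le> 1" if "\<omega> \<in> space (history k)" for \<omega>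
    using values_pm[of j \<omega>] assms that by auto
qed

lemma path_measurable [measurable]: "path k c \<in> events"
proof -
  have "Measurable.pred M (\<lambda>\<omega>. X j \<omega> = c j)" if "j \<in> {1..k}" for j
  proof -
    have [measurable]: "X j \<in> borel_measurable M" using that by (intro rv) auto
    show ?thesis by measurable
  qed
  then have "Measurable.pred M (\<lambda>\<omega>. \<forall>j\<in>{1..k}. X j \<omega> = c j)" by (intro pred_intros_finite) auto
  then show ?thesis unfolding path_def pred_def by simp
qed

lemma X_sq: "1 \<le> k \<Longrightarrow> \<omega> \<in> space M \<Longrightarrow> X k \<omega> * X k \<omega> = 1"
  using values_pm[of k \<omega>] by auto

text \<open>The Markov property is assumed for histories of positive probability only; on null paths
  both sides vanish.\<close>

lemma path_transition:
  assumes k: "1 \<le> k" and c: "c k \<in> {1, -1}" and y: "y \<in> {1, -1}"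
  shows "\<P>(\<omega> in M. X (k + 1) \<omega> = y \<and> (\<forall>j\<in>{1..k}. X j \<omega> = c j)) = (if c k = y then p else 1 - p) * prob (path k c)"
proof (cases "prob (path k c) = 0")
  case True
  have "\<P>(\<omega> in M. X (k + 1) \<omega> = y \<and> (\<forall>j\<in>{1..k}. X j \<omega> = c j)) \<le> prob (path k c)"
    by (intro finite_measure_mono path_measurable) (auto simp: path_def)
  then show ?thesis using True by (simp add: measure_le_0_iff)
next
  case False
  then have pos: "\<P>(\<omega> in M. \<forall>j\<in>{1..k}. X j \<omega> = c j) > 0"
    unfolding path_def using zero_less_measure_iff by blast
  have "\<P>(\<omega> in M. X (k + 1) \<omega> = y \<and> (\<forall>j\<in>{1..k}. X j \<omega> = c j))
      = \<P>(\<omega> in M. X (k + 1) \<omega> = y \<bar> \<forall>j\<in>{1..k}. X j \<omega> = c j) * prob (path k c)"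
    using pos by (simp add: cond_prob_def path_def)
  also have "\<P>(\<omega> in M. X (k + 1) \<omega> = y \<bar> \<forall>j\<in>{1..k}. X j \<omega> = c j) = \<P>(\<omega> in M. X (k + 1) \<omega> = y \<bar> X k \<omega> = c k)"
    by (rule markov[OF k pos])
  also have "\<dots> = (if c k = y then p else 1 - p)"
    using c y trans_pos_pos[OF k] trans_neg_neg[OF k] trans_pos_neg[OF k] trans_neg_pos[OF k] by auto
  finally show ?thesis .
qed

lemma X_M: "1 \<le> k \<Longrightarrow> bdd_meas M (X k)"
  using values_pm by (intro bdd_measI[where B = 1] rv) force+

text \<open>The factor 2 p - 1 is p - (1 - p), the mean of the next value relative to the sign of
  the present one.\<close>

lemma expectation_path:
  assumes k: "1 \<le> k" and c: "c k \<in> {1, -1}"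
  shows "expectation (\<lambda>\<omega>. X (k + 1) \<omega> * indicator (path k c) \<omega>) = (2 * p - 1) * (c k * prob (path k c))"
proof -
  define E where "E = (\<lambda>y. {\<omega> \<in> space M. X (k + 1) \<omega> = y \<and> (\<forall>j\<in>{1..k}. X j \<omega> = c j)})"
  have EM: "E y \<in> events" for y
  proof -
    have [measurable]: "X (k + 1) \<in> borel_measurable M" by (intro rv) simp
    have "E y = {\<omega> \<in> space M. X (k + 1) \<omega> = y} \<inter> path k c" by (auto simp: E_def path_def)
    also have "\<dots> \<in> events" by measurable
    finally show ?thesis .
  qed
  have "expectation (\<lambda>\<omega>. X (k + 1) \<omega> * indicator (path k c) \<omega>)
      = expectation (\<lambda>\<omega>. indicat_real (E 1) \<omega> - indicat_real (E (-1)) \<omega>)"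
    using values_pm[of "k + 1"]
    by (intro Bochner_Integration.integral_cong) (auto simp: E_def path_def indicator_def)
  also have "\<dots> = prob (E 1) - prob (E (-1))"
    using EM by (subst Bochner_Integration.integral_diff) (auto simp: emeasure_eq_measure)
  also have "\<dots> = (2 * p - 1) * (c k * prob (path k c))"
  proof -
    have "prob (E y) = (if c k = y then p else 1 - p) * prob (path k c)" if "y \<in> {1, -1}" for y
      unfolding E_def by (rule path_transition[where c = c, OF k c that])
    then show ?thesis using c by (auto simp: algebra_simps)
  qed
  finally show ?thesis .
qed

text \<open>Every sample point follows exactly one path; the extensional functions of
  \<open>PiE\<close> make its code unique and the index set finite.\<close>

lemma sum_paths:
  assumes "\<omega> \<in> space M"
  shows "(\<Sum>c\<in>PiE {1..k} (\<lambda>_. {1, -1}). indicat_real (path k c) \<omega>) = 1"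
proof -
  define d where "d = restrict (\<lambda>j. X j \<omega>) {1..k}"
  have d: "d \<in> PiE {1..k} (\<lambda>_. {1, -1})"
    unfolding d_def using values_pm[OF _ assms] by (simp add: PiE_iff)
  have "indicat_real (path k c) \<omega> = of_bool (c = d)" if "c \<in> PiE {1..k} (\<lambda>_. {1, -1})" for c
  proof -
    have "\<omega> \<in> path k c \<longleftrightarrow> c = d"
    proof
      assume "\<omega> \<in> path k c"
      then show "c = d" by (intro PiE_ext[OF that d]) (simp add: path_def d_def)
    qed (simp add: path_def d_def assms)
    then show ?thesis by (simp add: indicator_def)
  qed
  then have "(\<Sum>c\<in>PiE {1..k} (\<lambda>_. {1, -1}). indicat_real (path k c) \<omega>)
      = (\<Sum>c\<in>PiE {1..k} (\<lambda>_. {1, -1}). if c = d then 1 else 0)"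
    by (intro sum.cong) auto
  also have "\<dots> = 1" using d by (simp add: sum.delta finite_PiE)
  finally show ?thesis .
qed

text \<open>The Markov property in tested form: \<open>Z\<close> and \<open>X k\<close> are constant
  on each path set, so the claim reduces to \<open>expectation_path\<close> and a finite
  sum.\<close>

lemma markov_expectation:
  assumes k: "1 \<le> k" and Z: "bdd_meas (history k) Z"
  shows "expectation (\<lambda>\<omega>. Z \<omega> * X (k + 1) \<omega>) = (2 * p - 1) * expectation (\<lambda>\<omega>. Z \<omega> * X k \<omega>)"
proof -
  have ZM: "bdd_meas M Z"
    using Z by (rule bdd_meas_history)
  have XM: "bdd_meas M (X (k + 1))" "bdd_meas M (X k)" using k X_M by auto
  have int: "integrable M (\<lambda>\<omega>. Z \<omega> * X i \<omega> * indicator (path k c) \<omega>)" if "i = k \<or> i = k + 1" for i c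
    using XM that by (intro bdd_meas_integrable bdd_meas_intros ZM path_measurable) auto
  have decomp: "expectation (\<lambda>\<omega>. Z \<omega> * X i \<omega>)
      = (\<Sum>c\<in>PiE {1..k} (\<lambda>_. {1, -1}). expectation (\<lambda>\<omega>. Z \<omega> * X i \<omega> * indicator (path k c) \<omega>))"
    if "i = k \<or> i = k + 1" for i
  proof -
    have "expectation (\<lambda>\<omega>. Z \<omega> * X i \<omega>)
        = expectation (\<lambda>\<omega>. \<Sum>c\<in>PiE {1..k} (\<lambda>_. {1, -1}). Z \<omega> * X i \<omega> * indicator (path k c) \<omega>)"
      by (intro Bochner_Integration.integral_cong refl)
         (simp only: sum_distrib_left[symmetric] sum_paths mult_1_right)
    also have "\<dots> = (\<Sum>c\<in>PiE {1..k} (\<lambda>_. {1, -1}). expectation (\<lambda>\<omega>. Z \<omega> * X i \<omega> * indicator (path k c) \<omega>))"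
      using int[OF that] by (rule Bochner_Integration.integral_sum)
    finally show ?thesis .
  qed
  have "expectation (\<lambda>\<omega>. Z \<omega> * X (k + 1) \<omega> * indicator (path k c) \<omega>)
      = (2 * p - 1) * expectation (\<lambda>\<omega>. Z \<omega> * X k \<omega> * indicator (path k c) \<omega>)"
    if c: "c \<in> PiE {1..k} (\<lambda>_. {1, -1})" for c
  proof (cases "path k c = {}")
    case False
    then obtain \<omega>0 where \<omega>0: "\<omega>0 \<in> path k c" by blast
    have Zc: "Z \<omega> = Z \<omega>0" if "\<omega> \<in> path k c" for \<omega>
      using Z \<omega>0 that by (intro history_measurable[of Z k]) (auto simp: bdd_meas_def path_def same_def)
    have ck: "c k \<in> {1, -1}" using c k by (auto simp: PiE_iff)
    have "expectation (\<lambda>\<omega>. Z \<omega> * X (k + 1) \<omega> * indicator (path k c) \<omega>)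
        = expectation (\<lambda>\<omega>. Z \<omega>0 * (X (k + 1) \<omega> * indicator (path k c) \<omega>))"
      using Zc by (intro Bochner_Integration.integral_cong) (auto simp: indicator_def)
    also have "\<dots> = Z \<omega>0 * ((2 * p - 1) * (c k * prob (path k c)))"
      by (simp only: integral_mult_right_zero expectation_path[where c = c, OF k ck])
    also have "\<dots> = (2 * p - 1) * (Z \<omega>0 * (c k * prob (path k c)))" by (rule mult.left_commute)
    also have "Z \<omega>0 * (c k * prob (path k c)) = expectation (\<lambda>\<omega>. (Z \<omega>0 * c k) * indicator (path k c) \<omega>)"
      by (simp add: path_measurable)
    also have "\<dots> = expectation (\<lambda>\<omega>. Z \<omega> * X k \<omega> * indicator (path k c) \<omega>)"
    proof (intro Bochner_Integration.integral_cong refl)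
      fix \<omega>
      show "Z \<omega>0 * c k * indicator (path k c) \<omega> = Z \<omega> * X k \<omega> * indicator (path k c) \<omega>"
      proof (cases "\<omega> \<in> path k c")
        case True
        then have "X k \<omega> = c k" using k by (simp add: path_def)
        then show ?thesis using Zc[OF True] by simp
      qed simp
    qed
    finally show ?thesis .
  qed simp
  then show ?thesis by (simp add: decomp sum_distrib_left)
qed

text \<open>The innovation of \<open>X (k + 1)\<close> given time \<open>k\<close>, with the index
  shifted to fit \<open>det_var_mds\<close>. At \<open>k = 0\<close> the symmetric start already has
  mean 0, and the unconstrained \<open>X 0\<close> must not occur.\<close>

definition innov :: "nat \<Rightarrow> 'a \<Rightarrow> real" where
  "innov k \<omega> = (if k = 0 then X 1 \<omega> else X (k + 1) \<omega> - (2 * p - 1) * X k \<omega>)"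

definition innov_var :: "nat \<Rightarrow> real" where
  "innov_var k = (if k = 0 then 1 else 1 - (2 * p - 1)\<^sup>2)"

lemma innov_bdd: "bdd_meas (history (Suc k)) (innov k)"
proof (cases "k = 0")
  case True
  then show ?thesis using X_history[of 1 "Suc k"] by (simp add: innov_def[abs_def])
next
  case False
  then show ?thesis unfolding innov_def by (auto intro!: bdd_meas_intros X_history)
qed

lemma expectation_X1: "expectation (X 1) = 0"
proof -
  have [measurable]: "X 1 \<in> borel_measurable M" by (intro rv) simp
  define E where "E = (\<lambda>y. {\<omega> \<in> space M. X 1 \<omega> = y})"
  have EM: "E y \<in> events" for y unfolding E_def by measurable
  have "expectation (X 1) = expectation (\<lambda>\<omega>. indicat_real (E 1) \<omega> - indicat_real (E (-1)) \<omega>)"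
    using values_pm[of 1] by (intro Bochner_Integration.integral_cong) (auto simp: E_def indicator_def)
  also have "\<dots> = prob (E 1) - prob (E (-1))"
    using EM by (subst Bochner_Integration.integral_diff) (auto simp: emeasure_eq_measure)
  also have "\<dots> = 0" unfolding E_def init_pos init_neg by simp
  finally show ?thesis .
qed

text \<open>With r = 2 p - 1, the square of the innovation is 1 + r^2 - 2 r X_k X_(k+1), linear in
  the new value. Testing with \<open>Z * X k\<close> in \<open>markov_expectation\<close> turns the
  product X_k X_(k+1) into r and leaves 1 - r^2. At \<open>k = 0\<close> the history is trivial, so
  \<open>Z\<close> is constant.\<close>

lemma innov_expectation:
  assumes Z: "bdd_meas (history k) Z"
  shows "expectation (\<lambda>\<omega>. Z \<omega> * innov k \<omega>) = 0"
    and "expectation (\<lambda>\<omega>. Z \<omega> * (innov k \<omega>)\<^sup>2) = innov_var k * expectation Z"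
proof -
  have ZM: "bdd_meas M Z"
    using Z by (rule bdd_meas_history)
  have "expectation (\<lambda>\<omega>. Z \<omega> * innov k \<omega>) = 0 \<and>
    expectation (\<lambda>\<omega>. Z \<omega> * (innov k \<omega>)\<^sup>2) = innov_var k * expectation Z"
  proof (cases "k = 0")
    case True
    obtain \<omega>0 where \<omega>0: "\<omega>0 \<in> space M" using not_empty by blast
    have Zc: "Z \<omega> = Z \<omega>0" if "\<omega> \<in> space M" for \<omega>
      using Z \<omega>0 that True by (intro history_measurable[of Z k]) (auto simp: bdd_meas_def same_def)
    have "expectation (\<lambda>\<omega>. Z \<omega> * innov k \<omega>) = expectation (\<lambda>\<omega>. Z \<omega>0 * X 1 \<omega>)"
      using Zc True by (intro Bochner_Integration.integral_cong) (auto simp: innov_def)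
    also have "\<dots> = 0" using expectation_X1 by simp
    finally have 1: "expectation (\<lambda>\<omega>. Z \<omega> * innov k \<omega>) = 0" .
    have "expectation (\<lambda>\<omega>. Z \<omega> * (innov k \<omega>)\<^sup>2) = expectation Z"
      using X_sq[of 1] True by (intro Bochner_Integration.integral_cong) (auto simp: innov_def power2_eq_square)
    with 1 True show ?thesis by (simp add: innov_var_def)
  next
    case False
    then have k: "1 \<le> k" by simp
    define r where "r = 2 * p - 1"
    have XM: "bdd_meas M (X (k + 1))" "bdd_meas M (X k)" using k X_M by auto
    have XF: "bdd_meas (history k) (X k)" using k by (intro X_history) auto
    have "expectation (\<lambda>\<omega>. Z \<omega> * innov k \<omega>) = expectation (\<lambda>\<omega>. Z \<omega> * X (k + 1) \<omega> - r * (Z \<omega> * X k \<omega>))"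
      using False by (simp add: innov_def r_def algebra_simps)
    also have "\<dots> = expectation (\<lambda>\<omega>. Z \<omega> * X (k + 1) \<omega>) - r * expectation (\<lambda>\<omega>. Z \<omega> * X k \<omega>)"
      unfolding integral_mult_right_zero[symmetric]
      by (rule Bochner_Integration.integral_diff) (intro bdd_meas_integrable bdd_meas_intros ZM XM)+
    also have "\<dots> = 0" using markov_expectation[OF k Z] by (simp add: r_def)
    finally have 1: "expectation (\<lambda>\<omega>. Z \<omega> * innov k \<omega>) = 0" .
    have "expectation (\<lambda>\<omega>. Z \<omega> * (innov k \<omega>)\<^sup>2)
        = expectation (\<lambda>\<omega>. (1 + r\<^sup>2) * Z \<omega> - 2 * r * ((Z \<omega> * X k \<omega>) * X (k + 1) \<omega>))"
    proof (intro Bochner_Integration.integral_cong refl)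
      fix \<omega> assume \<omega>: "\<omega> \<in> space M"
      have "(innov k \<omega>)\<^sup>2 = X (k + 1) \<omega> * X (k + 1) \<omega> - 2 * r * (X k \<omega> * X (k + 1) \<omega>) + r\<^sup>2 * (X k \<omega> * X k \<omega>)"
        using False by (simp add: innov_def r_def power2_eq_square algebra_simps)
      also have "\<dots> = 1 - 2 * r * (X k \<omega> * X (k + 1) \<omega>) + r\<^sup>2"
        using X_sq[OF k \<omega>] X_sq[of "k + 1", OF _ \<omega>] by simp
      finally have inn: "(innov k \<omega>)\<^sup>2 = 1 - 2 * r * (X k \<omega> * X (k + 1) \<omega>) + r\<^sup>2" .
      show "Z \<omega> * (innov k \<omega>)\<^sup>2 = (1 + r\<^sup>2) * Z \<omega> - 2 * r * ((Z \<omega> * X k \<omega>) * X (k + 1) \<omega>)"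
        unfolding inn by (simp add: algebra_simps)
    qed
    also have "\<dots> = (1 + r\<^sup>2) * expectation Z - 2 * r * expectation (\<lambda>\<omega>. (Z \<omega> * X k \<omega>) * X (k + 1) \<omega>)"
      unfolding integral_mult_right_zero[symmetric]
      by (rule Bochner_Integration.integral_diff) (intro bdd_meas_integrable bdd_meas_intros ZM XM)+
    also have "expectation (\<lambda>\<omega>. (Z \<omega> * X k \<omega>) * X (k + 1) \<omega>) = r * expectation (\<lambda>\<omega>. (Z \<omega> * X k \<omega>) * X k \<omega>)"
      unfolding r_def by (rule markov_expectation[OF k bdd_meas_mult[OF Z XF]])
    also have "expectation (\<lambda>\<omega>. (Z \<omega> * X k \<omega>) * X k \<omega>) = expectation Z"
      using X_sq[OF k] by (intro Bochner_Integration.integral_cong) (auto simp: mult.assoc)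
    finally have "expectation (\<lambda>\<omega>. Z \<omega> * (innov k \<omega>)\<^sup>2) = (1 - r\<^sup>2) * expectation Z"
      by (simp add: algebra_simps power2_eq_square)
    moreover have "innov_var k = 1 - r\<^sup>2" using False by (simp add: innov_var_def r_def)
    ultimately show ?thesis using 1 by simp
  qed
  then show "expectation (\<lambda>\<omega>. Z \<omega> * innov k \<omega>) = 0"
    "expectation (\<lambda>\<omega>. Z \<omega> * (innov k \<omega>)\<^sup>2) = innov_var k * expectation Z" by auto
qed

lemma innov_mds: "det_var_mds M history (\<lambda>k \<omega>. b (Suc k) * innov k \<omega>) (\<lambda>k. (b (Suc k))\<^sup>2 * innov_var k)"
proof (intro det_var_mds.intro det_var_mds_axioms.intro prob_space_axioms history_subalgebra history_Suc)
  show "bdd_meas (history (Suc k)) (\<lambda>\<omega>. b (Suc k) * innov k \<omega>)" for k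
    by (intro bdd_meas_intros innov_bdd)
  fix k Z assume Z: "bdd_meas (history k) Z"
  show "expectation (\<lambda>\<omega>. Z \<omega> * (b (Suc k) * innov k \<omega>)) = 0"
    using innov_expectation(1)[OF Z] by (simp add: mult.left_commute[of _ "b (Suc k)"])
  show "expectation (\<lambda>\<omega>. Z \<omega> * (b (Suc k) * innov k \<omega>)\<^sup>2) = (b (Suc k))\<^sup>2 * innov_var k * expectation Z"
    using innov_expectation(2)[OF Z] by (simp add: power_mult_distrib mult.left_commute[of _ "(b (Suc k))\<^sup>2"])
qed

text \<open>Summation by parts: inserting a_n = b_n - (2 p - 1) b_(n+1) and regrouping by
  \<open>b\<close> leaves one boundary term. The guard at \<open>n = 0\<close> keeps the arbitrary
  \<open>X 0\<close> out.\<close>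

lemma wsum_decomposition:
  assumes b: "\<And>n. b n = a n + (2 * p - 1) * b (Suc n)"
  shows "wsum a X n \<omega> = (\<Sum>k<n. b (Suc k) * innov k \<omega>) - (if n = 0 then 0 else (2 * p - 1) * b (Suc n) * X n \<omega>)"
proof (induction n)
  case 0
  then show ?case by (simp add: wsum_def)
next
  case (Suc n)
  define g where "g = (if n = 0 then 0 else (2 * p - 1) * b (Suc n) * X n \<omega>)"
  have "wsum a X (Suc n) \<omega> = wsum a X n \<omega> + a (Suc n) * X (Suc n) \<omega>" by (simp add: wsum_def)
  moreover have "a (Suc n) * X (Suc n) \<omega> = b (Suc n) * X (Suc n) \<omega> - (2 * p - 1) * b (Suc (Suc n)) * X (Suc n) \<omega>"
  proof -
    have "a (Suc n) = b (Suc n) - (2 * p - 1) * b (Suc (Suc n))" using b[of "Suc n"] by simp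
    then show ?thesis by (simp only: left_diff_distrib)
  qed
  moreover have "b (Suc n) * innov n \<omega> = b (Suc n) * X (Suc n) \<omega> - g"
    by (simp add: innov_def g_def algebra_simps)
  ultimately have "wsum a X (Suc n) \<omega> = ((\<Sum>k<n. b (Suc k) * innov k \<omega>) + b (Suc n) * innov n \<omega>)
      - (2 * p - 1) * b (Suc (Suc n)) * X (Suc n) \<omega>"
    using Suc unfolding g_def[symmetric] by linarith
  then show ?case by simp
qed

end

section \<open>The weighted sum as a perturbed martingale, and the three laws\<close>

lemma (in pm_markov_chain) innov_le: "\<omega> \<in> space M \<Longrightarrow> 0 < p \<Longrightarrow> p < 1 \<Longrightarrow> \<bar>innov k \<omega>\<bar> \<le> 2"
  using values_pm[of k \<omega>] values_pm[of "k + 1" \<omega>] by (auto simp: innov_def)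

lemma (in pm_markov_chain) wsum_perturbed_mds:
  assumes p: "0 < p" "p < 1" and lim: "filterlim (sqsum a) at_top sequentially"
    and \<delta>: "0 < \<delta>" "\<delta> \<le> 1" and O: "(\<lambda>n. (a n)\<^sup>2) \<in> O(\<lambda>n. sqsum a n powr (1 - \<delta>))"
  obtains D v h where "perturbed_mds M history D v h (wsum a X)"
proof -
  define r where "r = 2 * p - 1"
  define \<beta> where "\<beta> = (1 - \<delta>) / 2"
  have \<beta>: "0 \<le> \<beta>" using \<delta> by (simp add: \<beta>_def)
  have r: "\<bar>r\<bar> < 1" using p by (auto simp: r_def)
  obtain b C where b: "\<And>n. b n = a n + r * b (Suc n)" and C: "0 \<le> C"
    and bC: "\<And>n. \<bar>b n\<bar> \<le> C * (1 + (\<Sum>k<n. (b (Suc k))\<^sup>2)) powr \<beta>"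
    and blim: "filterlim (\<lambda>n. \<Sum>k<n. (b (Suc k))\<^sup>2) at_top sequentially"
    using martingale_weights[OF r \<delta> lim O] unfolding \<beta>_def by blast
  define D where "D = (\<lambda>k \<omega>. b (Suc k) * innov k \<omega>)"
  define v where "v = (\<lambda>k. (b (Suc k))\<^sup>2 * innov_var k)"
  interpret mds: det_var_mds M history D v unfolding D_def v_def by (rule innov_mds)
  \<comment> \<open>The smallest innovation variance among times after the first, positive because 0
    < p < 1. It bounds \<open>V\<close> from below by the squared weights, so that bounds in terms
    of those squares become bounds in terms of \<open>V\<close>.\<close>
  define w where "w = 1 - r\<^sup>2"
  have r2: "r\<^sup>2 < 1" using r by (simp add: abs_square_less_1)
  have w: "0 < w" "w \<le> 1" using r2 by (auto simp: w_def)
  have iv: "w \<le> innov_var k" for k by (simp add: innov_var_def w_def r_def)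
  have wV: "w * (\<Sum>k<n. (b (Suc k))\<^sup>2) \<le> mds.V n" for n
    unfolding mds.V_def sum_distrib_left
    by (intro sum_mono) (simp add: v_def mult.commute[of w] mult_left_mono iv)
  \<comment> \<open>The 2 is the bound on the innovations; the power of \<open>1 / w\<close> comes
    from replacing the sum of squared weights by \<open>V\<close> divided by
    \<open>w\<close>.\<close>
  define K where "K = 2 * C * (1 / w) powr \<beta>"
  define h where "h = (\<lambda>x. K * (1 + x) powr \<beta>)"
  have K: "0 \<le> K" using C by (simp add: K_def)
  have bh: "2 * \<bar>b n\<bar> \<le> h (mds.V n)" for n
  proof -
    define B where "B = (\<Sum>k<n. (b (Suc k))\<^sup>2)"
    have B: "0 \<le> B" by (auto simp: B_def intro: sum_nonneg)
    have "w * (1 + B) \<le> 1 + mds.V n" using wV[of n] w by (simp add: B_def distrib_left)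
    then have "1 + B \<le> 1 / w * (1 + mds.V n)" using w by (simp add: field_simps)
    then have "(1 + B) powr \<beta> \<le> (1 / w * (1 + mds.V n)) powr \<beta>"
      using B \<beta> by (intro powr_mono2) auto
    also have "\<dots> = (1 / w) powr \<beta> * (1 + mds.V n) powr \<beta>"
      using w mds.V_nonneg[of n] by (simp only: powr_mult)
    finally have "2 * C * (1 + B) powr \<beta> \<le> 2 * C * ((1 / w) powr \<beta> * (1 + mds.V n) powr \<beta>)"
      using C by (intro mult_left_mono) auto
    then show ?thesis using bC[of n] by (simp add: h_def K_def B_def)
  qed
  have "perturbed_mds M history D v h (wsum a X)"
  proof (intro perturbed_mds.intro growing_mds.intro growing_mds_axioms.intro perturbed_mds_axioms.intro mds.det_var_mds_axioms)
    have "filterlim (\<lambda>n. w * (\<Sum>k<n. (b (Suc k))\<^sup>2)) at_top sequentially"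
      using w by (intro filterlim_tendsto_pos_mult_at_top[OF tendsto_const _ blim])
    then show "filterlim mds.V at_top sequentially"
      by (rule filterlim_at_top_mono) (simp add: wV)
    show "\<bar>D k \<omega>\<bar> \<le> h (mds.V (Suc k))" if "\<omega> \<in> space M" for \<omega> k
    proof -
      have "\<bar>D k \<omega>\<bar> \<le> \<bar>b (Suc k)\<bar> * 2"
        unfolding D_def abs_mult using innov_le[OF that p] by (intro mult_left_mono) auto
      then show ?thesis using bh[of "Suc k"] by simp
    qed
    show "h x \<le> h y" if "0 \<le> x" "x \<le> y" for x y
      unfolding h_def using that K \<beta> by (intro mult_left_mono powr_mono2) auto
    show "0 \<le> h x" if "0 \<le> x" for x using K by (simp add: h_def)
    \<comment> \<open>Positivity of \<delta> enters here: the exponent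
      \<open>(1 - \<delta>) / 2\<close> is below 1 / 2, and the missing power beats the iterated
      logarithm.\<close>
    show "((\<lambda>x. h x * sqrt (ln (ln x) / x)) \<longlongrightarrow> 0) at_top"
      unfolding h_def \<beta>_def using \<delta> by real_asymp
    show "wsum a X n \<in> borel_measurable M" for n
      unfolding wsum_def[abs_def] by (intro borel_measurable_sum borel_measurable_times borel_measurable_const rv) auto
    show "\<bar>wsum a X n \<omega> - mds.W n \<omega>\<bar> \<le> h (mds.V (Suc n))" if "\<omega> \<in> space M" for \<omega> n
    proof -
      have dec: "wsum a X n \<omega> = mds.W n \<omega> - (if n = 0 then 0 else r * b (Suc n) * X n \<omega>)"
      proof -
        have W: "mds.W n \<omega> = (\<Sum>k<n. b (Suc k) * innov k \<omega>)"
          unfolding mds.W_def by (simp add: D_def)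
        show ?thesis
          unfolding W r_def by (rule wsum_decomposition) (rule b[unfolded r_def])
      qed
      have "\<bar>wsum a X n \<omega> - mds.W n \<omega>\<bar> \<le> \<bar>b (Suc n)\<bar>"
      proof (cases "n = 0")
        case False
        then have X: "\<bar>X n \<omega>\<bar> = 1" using values_pm[of n \<omega>] that by auto
        have "\<bar>wsum a X n \<omega> - mds.W n \<omega>\<bar> = \<bar>r\<bar> * \<bar>b (Suc n)\<bar>"
          using False by (simp add: dec abs_mult X)
        also have "\<dots> \<le> \<bar>b (Suc n)\<bar>" using r by (intro mult_left_le_one_le) auto
        finally show ?thesis .
      next
        case True
        with dec show ?thesis by simp
      qed
      then show ?thesis using bh[of "Suc n"] by linarith
    qed
  qed
  then show ?thesis by (rule that)
qed

theorem corollary2p4: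
  fixes M :: "'a measure" and X :: "nat \<Rightarrow> 'a \<Rightarrow> real" and p :: real and a :: "nat \<Rightarrow> real"
  assumes "0 < p" and "p < 1"
    and "pm_markov_chain M X p"
    and "filterlim (sqsum a) at_top sequentially"
    and "\<exists>\<delta>. 0 < \<delta> \<and> \<delta> \<le> 1 \<and> (\<lambda>n. (a n)\<^sup>2) \<in> O(\<lambda>n. sqsum a n powr (1 - \<delta>))"
  shows "(\<forall>y::real. (\<lambda>n. \<P>(\<omega> in M. wsum a X n \<omega> / wsd M a X n \<le> y))
            \<longlonglongrightarrow> (LBINT t:{..y}. 1 / sqrt (2 * pi) * exp (- t\<^sup>2 / 2)))
       \<and> (AE \<omega> in M. seq_limit_points (\<lambda>n. wsum a X n \<omega> /
            sqrt (2 * (wsd M a X n)\<^sup>2 * ln (ln ((wsd M a X n)\<^sup>2)))) = {-1..1})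
       \<and> (AE \<omega> in M. liminf (\<lambda>n. ereal (sqrt (ln (ln ((wsd M a X n)\<^sup>2)) / (wsd M a X n)\<^sup>2) *
            Max ((\<lambda>k. \<bar>wsum a X k \<omega>\<bar>) ` {1..n}))) = ereal (pi / sqrt 8))"
proof -
  interpret pm_markov_chain M X p by fact
  obtain \<delta> where \<delta>: "0 < \<delta>" "\<delta> \<le> 1" "(\<lambda>n. (a n)\<^sup>2) \<in> O(\<lambda>n. sqsum a n powr (1 - \<delta>))"
    using assms(5) by blast
  obtain D v h where "perturbed_mds M history D v h (wsum a X)"
    using wsum_perturbed_mds[OF assms(1,2,4) \<delta>] .
  then interpret S: perturbed_mds M history D v h "wsum a X" .
  have wsd: "wsd M a X n = sqrt (S.s2 n)" for n by (simp add: wsd_def S.s2_def)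
  have s2: "(wsd M a X n)\<^sup>2 = S.s2 n" for n unfolding wsd by (simp add: S.s2_def)
  have lil: "sqrt (2 * (wsd M a X n)\<^sup>2 * ln (ln ((wsd M a X n)\<^sup>2))) = lil_norm (S.s2 n)" for n
    by (simp add: lil_norm_def s2)
  \<comment> \<open>This holds without side conditions, since \<open>sqrt\<close> distributes over
    quotients of arbitrary reals and division by 0 yields 0; early \<open>n\<close> are thus
    covered.\<close>
  have chung: "sqrt (ln (ln ((wsd M a X n)\<^sup>2)) / (wsd M a X n)\<^sup>2) * y = y / chung_norm (S.s2 n)" for n y
    by (simp add: chung_norm_def s2 real_sqrt_divide)
  show ?thesis
    unfolding lil chung unfolding wsd
    by (intro conjI allI S.perturbed_clt S.perturbed_lil S.perturbed_chung)
qed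

end
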